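(* Let $R$ be a subdirectly irreducible $*$-regular ring such that the ortholattice $\mathsf{L}^\perp(R)$ is of height at least $3$ and has a representation in the inner product space $V$. Then the $*$-ring $R$ has a representation within a closed subspace of some ultrapower of $V$.
   Context: Rings are associative with unit $1$, preserved by homomorphisms. A $*$-ring is a ring $R$ with an involution $r\mapsto r^*$ (an additive map with $(rs)^*=s^*r^*$, $r^{**}=r$). It is $*$-regular if it is von Neumann regular (for each $a$ there is $x$ with $axa=a$) and $rr^*=0$ only for $r=0$. In a $*$-regular ring every (two-sided) ideal is closed under the involution, and $R$ is subdirectly irreducible iff it has a smallest nonzero two-sided ideal. A projection is an idempotent $e=e^*$; in a $*$-regular ring, each $a$ has a unique projection $e$ with $aR=eR$. Lattices have bounds $0,1$ as constants; joins and meets are written $+$ and $\cap$. The height of a lattice is the supremum of the lengths of its chains (a chain with $k+1$ elements has length $k$). An ortholattice is a lattice with an order-reversing involution $a\mapsto a^\perp$ such that $a+a^\perp=1$ and $a\cap a^\perp=0$ for all $a$. For a $*$-regular ring $R$, $\mathsf{L}^\perp(R)$ (the ortholattice of projections of $R$) is the modular ortholattice of principal right ideals of $R$ (ordered by inclusion) with $(aR)^\perp=(1-e)R$, where $e$ is the projection with $aR=eR$. An inner product space $V$ is a vector space over a division ring $F$ with involution, endowed with a form $\langle\cdot\mid\cdot\rangle$ that is sesquilinear with respect to the involution of $F$, anisotropic ($\langle v\mid v\rangle=0$ only for $v=0$) and orthosymmetric ($\langle v\mid w\rangle=0$ iff $\langle w\mid v\rangle=0$). Inner product spaces are considered as $2$-sorted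 structures with sorts $V$ and $F$; ultrapowers are formed in this sense, and are again inner product spaces. For $X\subseteq V$, $X^\perp=\{y\in V\mid \langle x\mid y\rangle=0\ \forall x\in X\}$. A linear subspace $U$ is closed if $U^{\perp\perp}=U$; it is regarded as an inner product space with the restricted form. $\mathsf{L}(V)$ is the lattice of all linear subspaces of $V$. $\mathrm{End}^*(V)$ is the $*$-ring of those linear endomorphisms $\varphi$ of $V$ having an adjoint $\varphi^*$, i.e. $\langle\varphi v\mid w\rangle=\langle v\mid\varphi^*w\rangle$ for all $v,w$. A representation of a $*$-ring $R$ within $V$ is an embedding of $*$-rings $R\to\mathrm{End}^*(V)$. A representation of an ortholattice $L$ in $V$ is a lattice embedding $\eta:L\to\mathsf{L}(V)$ (preserving bounds) with $\eta(a^\perp)=\eta(a)^\perp$ for all $a\in L$. *)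

theory Defs
  imports "HOL-Algebra.Ideal" "HOL-Algebra.Module" "HOL-Library.Extended_Nat"
begin

record 'a star_ring = "'a ring" +
  star :: "'a \<Rightarrow> 'a"

locale star_ring = ring R for R (structure) +
  assumes star_closed: "a \<in> carrier R \<Longrightarrow> star R a \<in> carrier R"
    and star_add: "\<lbrakk>a \<in> carrier R; b \<in> carrier R\<rbrakk> \<Longrightarrow> star R (a \<oplus> b) = star R a \<oplus> star R b"
    and star_mult: "\<lbrakk>a \<in> carrier R; b \<in> carrier R\<rbrakk> \<Longrightarrow> star R (a \<otimes> b) = star R b \<otimes> star R a"
    and star_star: "a \<in> carrier R \<Longrightarrow> star R (star R a) = a"

locale star_regular_ring = star_ring R for R (structure) +
  assumes von_Neumann_regular:
      "a \<in> carrier R \<Longrightarrow> \<exists>x\<in>carrier R. a \<otimes> x \<otimes> a = a"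
    and star_proper:
      "\<lbrakk>r \<in> carrier R; r \<otimes> star R r = \<zero>\<rbrakk> \<Longrightarrow> r = \<zero>"

locale division_star_ring = star_ring F for F (structure) +
  assumes one_not_zero: "\<one> \<noteq> \<zero>"
    and nonzero_Units: "\<lbrakk>a \<in> carrier F; a \<noteq> \<zero>\<rbrakk> \<Longrightarrow> a \<in> Units F"

text \<open>
  Ideals of a \<open>*\<close>-regular ring are closed under the involution, so that no condition on
  the involution is needed here.
\<close>

definition subdirectly_irreducible :: "('a, 'm) ring_scheme \<Rightarrow> bool" where
  "subdirectly_irreducible R \<longleftrightarrow>
    (\<exists>J. ideal J R \<and> J \<noteq> {\<zero>\<^bsub>R\<^esub>} \<and>
      (\<forall>I. ideal I R \<longrightarrow> I \<noteq> {\<zero>\<^bsub>R\<^esub>} \<longrightarrow> J \<subseteq> I))"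

definition projection :: "('a, 'm) star_ring_scheme \<Rightarrow> 'a \<Rightarrow> bool" where
  "projection R e \<longleftrightarrow> e \<in> carrier R \<and> e \<otimes>\<^bsub>R\<^esub> e = e \<and> star R e = e"

record 'a ortho_gorder = "'a gorder" +
  ocompl :: "'a \<Rightarrow> 'a"

text \<open>
  An infinite chain contains finite chains of every length, so finite chains
  suffice to determine the height.
\<close>

definition lattice_height :: "('a, 'm) gorder_scheme \<Rightarrow> enat" where
  "lattice_height L =
    Sup {enat k | k. \<exists>C \<subseteq> carrier L. finite C \<and> card C = k + 1 \<and>
                        (\<forall>x\<in>C. \<forall>y\<in>C. x \<sqsubseteq>\<^bsub>L\<^esub> y \<or> y \<sqsubseteq>\<^bsub>L\<^esub> x)}"

definition projection_ortholattice :: "('a, 'm) star_ring_scheme \<Rightarrow> 'a set ortho_gorder" where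
  "projection_ortholattice R =
    \<lparr>carrier = {a <#\<^bsub>R\<^esub> carrier R | a. a \<in> carrier R}, eq = (=), le = (\<subseteq>),
     ocompl = (\<lambda>X. (\<one>\<^bsub>R\<^esub> \<ominus>\<^bsub>R\<^esub> (THE e. projection R e \<and> X = e <#\<^bsub>R\<^esub> carrier R)) <#\<^bsub>R\<^esub> carrier R)\<rparr>"

text \<open>
  The fields \<^const>\<open>mult\<close> and \<^const>\<open>one\<close> that the record of vectors inherits
  from \<^type>\<open>module_ext\<close> carry no meaning.  Vector spaces are left vector spaces; a right
  vector space becomes a left one by \<open>\<lambda>v = v\<lambda>\<^sup>*\<close>, which turns the identity
  \<open>\<langle>v\<lambda>|w\<mu>\<rangle> = \<lambda>\<^sup>*\<langle>v|w\<rangle>\<mu>\<close> into the one assumed below and leaves subspaces, orthogonals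
  and adjoints unchanged.
\<close>

record ('f, 'v) inner_product_space = "('f, 'v) module" +
  form :: "'v \<Rightarrow> 'v \<Rightarrow> 'f"

locale inner_product_space = F: division_star_ring F + V: abelian_group V
  for F :: "('f, 'm) star_ring_scheme" (structure)
  and V :: "('f, 'v, 'n) inner_product_space_scheme" (structure) +
  assumes smult_closed: "\<lbrakk>a \<in> carrier F; v \<in> carrier V\<rbrakk> \<Longrightarrow> a \<odot>\<^bsub>V\<^esub> v \<in> carrier V"
    and smult_l_distr: "\<lbrakk>a \<in> carrier F; b \<in> carrier F; v \<in> carrier V\<rbrakk> \<Longrightarrow>
      (a \<oplus>\<^bsub>F\<^esub> b) \<odot>\<^bsub>V\<^esub> v = a \<odot>\<^bsub>V\<^esub> v \<oplus>\<^bsub>V\<^esub> b \<odot>\<^bsub>V\<^esub> v"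
    and smult_r_distr: "\<lbrakk>a \<in> carrier F; v \<in> carrier V; w \<in> carrier V\<rbrakk> \<Longrightarrow>
      a \<odot>\<^bsub>V\<^esub> (v \<oplus>\<^bsub>V\<^esub> w) = a \<odot>\<^bsub>V\<^esub> v \<oplus>\<^bsub>V\<^esub> a \<odot>\<^bsub>V\<^esub> w"
    and smult_assoc: "\<lbrakk>a \<in> carrier F; b \<in> carrier F; v \<in> carrier V\<rbrakk> \<Longrightarrow>
      (a \<otimes>\<^bsub>F\<^esub> b) \<odot>\<^bsub>V\<^esub> v = a \<odot>\<^bsub>V\<^esub> (b \<odot>\<^bsub>V\<^esub> v)"
    and smult_one: "v \<in> carrier V \<Longrightarrow> \<one>\<^bsub>F\<^esub> \<odot>\<^bsub>V\<^esub> v = v"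
    and form_closed: "\<lbrakk>v \<in> carrier V; w \<in> carrier V\<rbrakk> \<Longrightarrow> form V v w \<in> carrier F"
    and form_add_left: "\<lbrakk>u \<in> carrier V; v \<in> carrier V; w \<in> carrier V\<rbrakk> \<Longrightarrow>
      form V (u \<oplus>\<^bsub>V\<^esub> v) w = form V u w \<oplus>\<^bsub>F\<^esub> form V v w"
    and form_add_right: "\<lbrakk>u \<in> carrier V; v \<in> carrier V; w \<in> carrier V\<rbrakk> \<Longrightarrow>
      form V u (v \<oplus>\<^bsub>V\<^esub> w) = form V u v \<oplus>\<^bsub>F\<^esub> form V u w"
    and form_smult: "\<lbrakk>a \<in> carrier F; b \<in> carrier F; v \<in> carrier V; w \<in> carrier V\<rbrakk> \<Longrightarrow>
      form V (a \<odot>\<^bsub>V\<^esub> v) (b \<odot>\<^bsub>V\<^esub> w) = a \<otimes>\<^bsub>F\<^esub> form V v w \<otimes>\<^bsub>F\<^esub> star F b"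
    and anisotropic: "\<lbrakk>v \<in> carrier V; form V v v = \<zero>\<^bsub>F\<^esub>\<rbrakk> \<Longrightarrow> v = \<zero>\<^bsub>V\<^esub>"
    and orthosymmetric: "\<lbrakk>v \<in> carrier V; w \<in> carrier V\<rbrakk> \<Longrightarrow>
      form V v w = \<zero>\<^bsub>F\<^esub> \<longleftrightarrow> form V w v = \<zero>\<^bsub>F\<^esub>"

definition orthogonal ::
  "('f, 'm) star_ring_scheme \<Rightarrow> ('f, 'v, 'n) inner_product_space_scheme \<Rightarrow> 'v set \<Rightarrow> 'v set" where
  "orthogonal F V X = {y \<in> carrier V. \<forall>x\<in>X. form V x y = \<zero>\<^bsub>F\<^esub>}"

definition closed_subspace ::
  "('f, 'm) star_ring_scheme \<Rightarrow> ('f, 'v, 'n) inner_product_space_scheme \<Rightarrow> 'v set \<Rightarrow> bool" where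
  "closed_subspace F V U \<longleftrightarrow> submodule U F V \<and> orthogonal F V (orthogonal F V U) = U"

definition subspace_lattice ::
  "('f, 'm) star_ring_scheme \<Rightarrow> ('f, 'v, 'n) inner_product_space_scheme \<Rightarrow> 'v set gorder" where
  "subspace_lattice F V = \<lparr>carrier = {U. submodule U F V}, eq = (=), le = (\<subseteq>)\<rparr>"

text \<open>
  Endomorphisms are extensional functions, so that equality of endomorphisms is equality
  of functions.
\<close>

definition endomorphisms ::
  "('f, 'm) star_ring_scheme \<Rightarrow> ('f, 'v, 'n) inner_product_space_scheme \<Rightarrow> ('v \<Rightarrow> 'v) set" where
  "endomorphisms F V = {\<phi> \<in> carrier V \<rightarrow>\<^sub>E carrier V.
    (\<forall>v\<in>carrier V. \<forall>w\<in>carrier V. \<phi> (v \<oplus>\<^bsub>V\<^esub> w) = \<phi> v \<oplus>\<^bsub>V\<^esub> \<phi> w) \<and>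
    (\<forall>a\<in>carrier F. \<forall>v\<in>carrier V. \<phi> (a \<odot>\<^bsub>V\<^esub> v) = a \<odot>\<^bsub>V\<^esub> \<phi> v)}"

definition is_adjoint ::
  "('f, 'm) star_ring_scheme \<Rightarrow> ('f, 'v, 'n) inner_product_space_scheme \<Rightarrow>
    ('v \<Rightarrow> 'v) \<Rightarrow> ('v \<Rightarrow> 'v) \<Rightarrow> bool" where
  "is_adjoint F V \<phi> \<psi> \<longleftrightarrow> \<psi> \<in> endomorphisms F V \<and>
    (\<forall>v\<in>carrier V. \<forall>w\<in>carrier V. form V (\<phi> v) w = form V v (\<psi> w))"

definition End_star ::
  "('f, 'm) star_ring_scheme \<Rightarrow> ('f, 'v, 'n) inner_product_space_scheme \<Rightarrow> ('v \<Rightarrow> 'v) star_ring" where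
  "End_star F V =
    \<lparr>carrier = {\<phi> \<in> endomorphisms F V. \<exists>\<psi>. is_adjoint F V \<phi> \<psi>},
     mult = (\<lambda>\<phi> \<psi>. \<lambda>v\<in>carrier V. \<phi> (\<psi> v)), one = (\<lambda>v\<in>carrier V. v),
     zero = (\<lambda>v\<in>carrier V. \<zero>\<^bsub>V\<^esub>), add = (\<lambda>\<phi> \<psi>. \<lambda>v\<in>carrier V. \<phi> v \<oplus>\<^bsub>V\<^esub> \<psi> v),
     star = (\<lambda>\<phi>. THE \<psi>. is_adjoint F V \<phi> \<psi>)\<rparr>"

definition star_ring_representation ::
  "('r, 'k) star_ring_scheme \<Rightarrow> ('f, 'm) star_ring_scheme \<Rightarrow>
    ('f, 'v, 'n) inner_product_space_scheme \<Rightarrow> ('r \<Rightarrow> 'v \<Rightarrow> 'v) \<Rightarrow> bool" where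
  "star_ring_representation R F V \<rho> \<longleftrightarrow>
    \<rho> \<in> ring_hom R (End_star F V) \<and>
    (\<forall>r\<in>carrier R. \<rho> (star R r) = star (End_star F V) (\<rho> r)) \<and>
    inj_on \<rho> (carrier R)"

definition ortholattice_representation ::
  "('l, 'k) ortho_gorder_scheme \<Rightarrow> ('f, 'm) star_ring_scheme \<Rightarrow>
    ('f, 'v, 'n) inner_product_space_scheme \<Rightarrow> ('l \<Rightarrow> 'v set) \<Rightarrow> bool" where
  "ortholattice_representation L F V \<eta> \<longleftrightarrow>
    \<eta> \<in> carrier L \<rightarrow> carrier (subspace_lattice F V) \<and>
    join_pres L (subspace_lattice F V) \<eta> \<and>
    meet_pres L (subspace_lattice F V) \<eta> \<and>
    \<eta> \<bottom>\<^bsub>L\<^esub> = \<bottom>\<^bsub>subspace_lattice F V\<^esub> \<and>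
    \<eta> \<top>\<^bsub>L\<^esub> = \<top>\<^bsub>subspace_lattice F V\<^esub> \<and>
    inj_on \<eta> (carrier L) \<and>
    (\<forall>a\<in>carrier L. \<eta> (ocompl L a) = orthogonal F V (\<eta> a))"

definition ultrafilter :: "'i filter \<Rightarrow> bool" where
  "ultrafilter \<U> \<longleftrightarrow> \<U> \<noteq> bot \<and> (\<forall>P. eventually P \<U> \<or> eventually (\<lambda>i. \<not> P i) \<U>)"

definition ultra_rel :: "'i filter \<Rightarrow> 'a set \<Rightarrow> (('i \<Rightarrow> 'a) \<times> ('i \<Rightarrow> 'a)) set" where
  "ultra_rel \<U> A = {(f, g). f \<in> UNIV \<rightarrow> A \<and> g \<in> UNIV \<rightarrow> A \<and> (\<forall>\<^sub>F i in \<U>. f i = g i)}"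

definition ultra_carrier :: "'i filter \<Rightarrow> 'a set \<Rightarrow> ('i \<Rightarrow> 'a) set set" where
  "ultra_carrier \<U> A = (UNIV \<rightarrow> A) // ultra_rel \<U> A"

definition ultra_const :: "'i filter \<Rightarrow> 'a set \<Rightarrow> 'a \<Rightarrow> ('i \<Rightarrow> 'a) set" where
  "ultra_const \<U> A a = ultra_rel \<U> A `` {\<lambda>i. a}"

text \<open>
  In the liftings of operations the set argument is the carrier of the sort of the result;
  all representatives of the arguments yield the same class.
\<close>

definition ultra_lift :: "'i filter \<Rightarrow> 'b set \<Rightarrow> ('a \<Rightarrow> 'b) \<Rightarrow> ('i \<Rightarrow> 'a) set \<Rightarrow> ('i \<Rightarrow> 'b) set" where
  "ultra_lift \<U> B op X = (\<Union>f\<in>X. ultra_rel \<U> B `` {\<lambda>i. op (f i)})"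

definition ultra_lift2 ::
  "'i filter \<Rightarrow> 'c set \<Rightarrow> ('a \<Rightarrow> 'b \<Rightarrow> 'c) \<Rightarrow> ('i \<Rightarrow> 'a) set \<Rightarrow> ('i \<Rightarrow> 'b) set \<Rightarrow> ('i \<Rightarrow> 'c) set" where
  "ultra_lift2 \<U> C op X Y = (\<Union>f\<in>X. \<Union>g\<in>Y. ultra_rel \<U> C `` {\<lambda>i. op (f i) (g i)})"

definition ultrapower_scalars ::
  "'i filter \<Rightarrow> ('f, 'm) star_ring_scheme \<Rightarrow> ('i \<Rightarrow> 'f) set star_ring" where
  "ultrapower_scalars \<U> F =
    \<lparr>carrier = ultra_carrier \<U> (carrier F),
     mult = ultra_lift2 \<U> (carrier F) (\<otimes>\<^bsub>F\<^esub>), one = ultra_const \<U> (carrier F) \<one>\<^bsub>F\<^esub>,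
     zero = ultra_const \<U> (carrier F) \<zero>\<^bsub>F\<^esub>, add = ultra_lift2 \<U> (carrier F) (\<oplus>\<^bsub>F\<^esub>),
     star = ultra_lift \<U> (carrier F) (star F)\<rparr>"

definition ultrapower_vectors ::
  "'i filter \<Rightarrow> ('f, 'm) star_ring_scheme \<Rightarrow> ('f, 'v, 'n) inner_product_space_scheme \<Rightarrow>
    (('i \<Rightarrow> 'f) set, ('i \<Rightarrow> 'v) set) inner_product_space" where
  "ultrapower_vectors \<U> F V =
    \<lparr>carrier = ultra_carrier \<U> (carrier V), mult = undefined, one = undefined,
     zero = ultra_const \<U> (carrier V) \<zero>\<^bsub>V\<^esub>, add = ultra_lift2 \<U> (carrier V) (\<oplus>\<^bsub>V\<^esub>),
     smult = ultra_lift2 \<U> (carrier V) (\<odot>\<^bsub>V\<^esub>), form = ultra_lift2 \<U> (carrier F) (form V)\<rparr>"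

text \<open>
  The index sets of ultrapowers range over types, which HOL cannot quantify existentially.
  Existence of an ultrapower is therefore stated for one large index type built from the
  types of the structures involved.  An ultrapower over a set \<open>I\<close> is isomorphic to one over
  any type into which \<open>I\<close> embeds, so this type subsumes all index sets of at most its
  cardinality.
\<close>

type_synonym ('r, 'f, 'v) ultra_index = "('r + 'f + 'v) set"

end

theory Submission
  imports Defs
begin

text \<open>
  Let \<open>\<eta>\<close> represent the ortholattice, write \<open>N x = \<eta>(xR)\<close>, and let \<open>e\<close>, \<open>f\<close> be orthogonal projections.
  For \<open>a \<in> fRe\<close> the subspace \<open>N(e + a)\<close> is the graph of a linear map \<open>N e \<rightarrow> N f\<close>, and
  orthogonality of \<open>(e + a)R\<close> and \<open>(f - a\<^sup>*)R\<close> makes the maps of \<open>a\<close> and \<open>-a\<^sup>*\<close> adjoint up to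
  sign.  Orthogonality relations of this kind between principal right ideals also show that the
  correspondence respects sums and products of off-diagonal elements, as long as there is room in a third
  orthogonal projection.  Height 3 and primeness of \<open>R\<close> supply orthogonal projections
  \<open>e\<^sub>0, e\<^sub>1, e\<^sub>2\<close> with sum \<open>1\<close> such that \<open>e\<^sub>0R \<noteq> 0\<close> is isomorphic to \<open>e\<^sub>1R\<close> and embeds into
  \<open>e\<^sub>2R\<close>.  This yields an additive map \<open>T\<close> from \<open>Re\<^sub>0\<close> into the linear maps \<open>N e\<^sub>0 \<rightarrow> V\<close> with
  \<open>\<langle>T(a)v | T(b)w\<rangle> = \<langle>v | T(a\<^sup>*b)w\<rangle>\<close>, and by anisotropy \<open>R\<close> acts faithfully, with adjoints, on the span
  \<open>W\<close> of the images through \<open>r T(c)v = T(rc)v\<close>.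

  The subspace \<open>W\<close> need not be closed.  Compressing the action of \<open>r\<close> to finite-dimensional subspaces
  of \<open>W\<close>, which split off orthogonally, and passing to an ultraproduct gives adjointable operators
  \<open>A r\<close> on an ultrapower of \<open>V\<close> that need not be multiplicative.  The vectors \<open>v\<close> with
  \<open>A 1 v = v\<close> and \<open>A r (A s v) = A (rs) v\<close> for all \<open>r, s\<close> form an intersection of kernels of adjointable
  operators, hence a closed subspace; it is invariant and contains the diagonal copy of \<open>W\<close>.
\<close>

section \<open>Inner product spaces\<close>

context star_ring
begin

lemma star_zero: "star R \<zero> = \<zero>"
proof -
  have "star R \<zero> \<oplus> star R \<zero> = star R \<zero> \<oplus> \<zero>"
    using star_add[of \<zero> \<zero>] star_closed[of \<zero>] by simp
  then show ?thesis using star_closed[of \<zero>] by (metis add.l_cancel_one r_zero zero_closed)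
qed

lemma star_one: "star R \<one> = \<one>"
  using star_mult[of "star R \<one>" \<one>] star_star[of \<one>] star_closed[of \<one>] by simp

lemma star_minus:
  assumes "a \<in> carrier R"
  shows "star R (\<ominus> a) = \<ominus> star R a"
  using star_add[of a "\<ominus> a"] assms star_zero star_closed
  by (metis a_inv_closed minus_equality r_neg a_comm)

end

context inner_product_space
begin

lemma submodule_carrier: "submodule W F V \<Longrightarrow> v \<in> W \<Longrightarrow> v \<in> carrier V"
  using subgroup.mem_carrier[of W "add_monoid V" v] by (simp add: submodule_def)

lemma submodule_add: "submodule W F V \<Longrightarrow> v \<in> W \<Longrightarrow> w \<in> W \<Longrightarrow> v \<oplus>\<^bsub>V\<^esub> w \<in> W"
  using subgroup.m_closed[of W "add_monoid V"] by (simp add: submodule_def)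

lemma submodule_zero: "submodule W F V \<Longrightarrow> \<zero>\<^bsub>V\<^esub> \<in> W"
  using subgroup.one_closed[of W "add_monoid V"] by (simp add: submodule_def)

lemma submodule_minus: "submodule W F V \<Longrightarrow> v \<in> W \<Longrightarrow> \<ominus>\<^bsub>V\<^esub> v \<in> W"
  using subgroup.m_inv_closed[of W "add_monoid V"] by (simp add: submodule_def a_inv_def)

lemma submodule_smult: "submodule W F V \<Longrightarrow> a \<in> carrier F \<Longrightarrow> v \<in> W \<Longrightarrow> a \<odot>\<^bsub>V\<^esub> v \<in> W"
  by (rule submodule.smult_closed)

text \<open>Closure under negatives comes from scalar multiplication: \<open>0 v = 0\<close> makes
  \<open>(- 1) v\<close> the negative of \<open>v\<close>.\<close>

lemma submoduleI:
  assumes "W \<subseteq> carrier V" "\<zero>\<^bsub>V\<^esub> \<in> W"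
    and "\<And>v w. v \<in> W \<Longrightarrow> w \<in> W \<Longrightarrow> v \<oplus>\<^bsub>V\<^esub> w \<in> W"
    and smult: "\<And>a v. a \<in> carrier F \<Longrightarrow> v \<in> W \<Longrightarrow> a \<odot>\<^bsub>V\<^esub> v \<in> W"
  shows "submodule W F V"
proof -
  have "\<ominus>\<^bsub>V\<^esub> v \<in> W" if "v \<in> W" for v
  proof -
    have v: "v \<in> carrier V" using that assms(1) by blast
    have "\<zero> \<odot>\<^bsub>V\<^esub> v \<oplus>\<^bsub>V\<^esub> \<zero> \<odot>\<^bsub>V\<^esub> v = \<zero> \<odot>\<^bsub>V\<^esub> v \<oplus>\<^bsub>V\<^esub> \<zero>\<^bsub>V\<^esub>"
      using smult_l_distr[of \<zero> \<zero> v] smult_closed[of \<zero> v] v by simp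
    then have z: "\<zero> \<odot>\<^bsub>V\<^esub> v = \<zero>\<^bsub>V\<^esub>" 
      using smult_closed[of \<zero> v] v by (simp add: V.add.l_cancel_one)
    have "v \<oplus>\<^bsub>V\<^esub> (\<ominus> \<one>) \<odot>\<^bsub>V\<^esub> v = \<zero>\<^bsub>V\<^esub>"
      using smult_l_distr[of \<one> "\<ominus> \<one>" v] v smult_one[of v] z by (simp add: F.r_neg)
    then have "\<ominus>\<^bsub>V\<^esub> v = (\<ominus> \<one>) \<odot>\<^bsub>V\<^esub> v"
      using v smult_closed[of "\<ominus> \<one>" v] by (metis F.a_inv_closed F.one_closed V.a_comm V.minus_equality)
    then show ?thesis using smult[of "\<ominus> \<one>" v] that by simp
  qed
  then show ?thesis using assms
    by (auto simp: submodule_def submodule_axioms_def subgroup_def a_inv_def)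
qed

lemma smult_zero_right: "a \<in> carrier F \<Longrightarrow> a \<odot>\<^bsub>V\<^esub> \<zero>\<^bsub>V\<^esub> = \<zero>\<^bsub>V\<^esub>"
  using smult_r_distr[of a "\<zero>\<^bsub>V\<^esub>" "\<zero>\<^bsub>V\<^esub>"] smult_closed[of a "\<zero>\<^bsub>V\<^esub>"]
  by (metis V.add.l_cancel_one V.l_zero V.zero_closed)

lemma form_smult_left:
  "a \<in> carrier F \<Longrightarrow> v \<in> carrier V \<Longrightarrow> w \<in> carrier V \<Longrightarrow> form V (a \<odot>\<^bsub>V\<^esub> v) w = a \<otimes> form V v w"
  using form_smult[of a \<one> v w] smult_one[of w] form_closed[of v w] F.star_one by simp

lemma form_smult_right:
  "b \<in> carrier F \<Longrightarrow> v \<in> carrier V \<Longrightarrow> w \<in> carrier V \<Longrightarrow>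
    form V v (b \<odot>\<^bsub>V\<^esub> w) = form V v w \<otimes> star F b"
  using form_smult[of \<one> b v w] smult_one[of v] form_closed[of v w] by simp

lemma form_zero_left: "w \<in> carrier V \<Longrightarrow> form V \<zero>\<^bsub>V\<^esub> w = \<zero>"
  using form_add_left[of "\<zero>\<^bsub>V\<^esub>" "\<zero>\<^bsub>V\<^esub>" w] form_closed[of "\<zero>\<^bsub>V\<^esub>" w]
  by (metis F.add.l_cancel_one V.l_zero V.zero_closed)

lemma form_zero_right: "w \<in> carrier V \<Longrightarrow> form V w \<zero>\<^bsub>V\<^esub> = \<zero>"
  using form_zero_left orthosymmetric by blast

lemma form_minus_left: "v \<in> carrier V \<Longrightarrow> w \<in> carrier V \<Longrightarrow> form V (\<ominus>\<^bsub>V\<^esub> v) w = \<ominus> form V v w"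
  using form_add_left[of v "\<ominus>\<^bsub>V\<^esub> v" w] form_zero_left form_closed
  by (metis F.a_comm F.minus_equality V.a_inv_closed V.r_neg)

lemma form_minus_right: "v \<in> carrier V \<Longrightarrow> w \<in> carrier V \<Longrightarrow> form V v (\<ominus>\<^bsub>V\<^esub> w) = \<ominus> form V v w"
  using form_add_right[of v w "\<ominus>\<^bsub>V\<^esub> w"] form_zero_right form_closed
  by (metis F.a_comm F.minus_equality V.a_inv_closed V.r_neg)

text \<open>The difference \<open>x - y\<close> is itself a test vector from \<open>W\<close>, so it
  is orthogonal to itself and vanishes by anisotropy. Equations between vectors of
  \<open>N f\<close> or of a span are proved this way below.\<close>

lemma form_eqI:
  assumes "submodule W F V" "x \<in> W" "y \<in> W"
    and eq: "\<And>w. w \<in> W \<Longrightarrow> form V x w = form V y w"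
  shows "x = y"
proof -
  note c = submodule_carrier[OF assms(1)]
  let ?d = "x \<oplus>\<^bsub>V\<^esub> \<ominus>\<^bsub>V\<^esub> y"
  have d: "?d \<in> W" using assms submodule_add submodule_minus by blast
  have "form V ?d ?d = \<zero>"
    using eq[OF d] c[OF d] c[OF assms(2)] c[OF assms(3)]
    by (simp add: form_add_left form_minus_left form_closed F.r_neg)
  then have "?d = \<zero>\<^bsub>V\<^esub>" using anisotropic c[OF d] by blast
  then show ?thesis using c[OF assms(2)] c[OF assms(3)]
    by (metis V.a_inv_closed V.minus_equality V.minus_minus)
qed

lemma submodule_inner_product_space:
  assumes W: "submodule W F V"
  shows "inner_product_space F (V\<lparr>carrier := W\<rparr>)"
proof -
  note c = submodule_carrier[OF W]
  have "abelian_group (V\<lparr>carrier := W\<rparr>)"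
  proof (rule abelian_groupI, simp_all add: submodule_add[OF W] submodule_zero[OF W])
    fix x y z assume "x \<in> W" "y \<in> W" "z \<in> W"
    then show "x \<oplus>\<^bsub>V\<^esub> y \<oplus>\<^bsub>V\<^esub> z = x \<oplus>\<^bsub>V\<^esub> (y \<oplus>\<^bsub>V\<^esub> z)" using c V.a_assoc by auto
  next
    fix x y assume "x \<in> W" "y \<in> W"
    then show "x \<oplus>\<^bsub>V\<^esub> y = y \<oplus>\<^bsub>V\<^esub> x" using c V.a_comm by auto
  next
    fix x assume x: "x \<in> W"
    then show "\<zero>\<^bsub>V\<^esub> \<oplus>\<^bsub>V\<^esub> x = x" using c by simp
    show "\<exists>y\<in>W. y \<oplus>\<^bsub>V\<^esub> x = \<zero>\<^bsub>V\<^esub>"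
      using submodule_minus[OF W x] c[OF x] V.l_neg by blast
  qed
  then show ?thesis
    using F.division_star_ring_axioms submodule_smult[OF W]
    by (intro inner_product_space.intro inner_product_space_axioms.intro)
      (simp_all add: c smult_l_distr smult_r_distr smult_assoc smult_one form_closed form_add_left
        form_add_right form_smult anisotropic, use c orthosymmetric in blast)
qed

text \<open>Anisotropy makes adjoints agree on the carrier and extensionality makes them agree off
  it, so the description in \<open>End_star\<close> denotes.\<close>

lemma star_End_star:
  assumes "is_adjoint F V \<phi> \<psi>" "\<phi> \<in> carrier V \<rightarrow> carrier V"
  shows "star (End_star F V) \<phi> = \<psi>"
proof -
  have "\<psi>' = \<psi>" if "is_adjoint F V \<phi> \<psi>'" for \<psi>'
  proof
    fix w
    have ext: "\<psi> \<in> carrier V \<rightarrow>\<^sub>E carrier V" "\<psi>' \<in> carrier V \<rightarrow>\<^sub>E carrier V"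
      using that assms by (auto simp: is_adjoint_def endomorphisms_def)
    show "\<psi>' w = \<psi> w"
    proof (cases "w \<in> carrier V")
      case True
      then have w: "\<psi> w \<in> carrier V" "\<psi>' w \<in> carrier V" using ext by auto
      let ?d = "\<psi>' w \<oplus>\<^bsub>V\<^esub> \<ominus>\<^bsub>V\<^esub> \<psi> w"
      have d: "?d \<in> carrier V" using w by simp
      have "form V ?d (\<psi>' w) = form V ?d (\<psi> w)"
        using that assms True d by (simp add: is_adjoint_def)
      then have "form V ?d ?d = \<zero>"
        using w d by (simp add: form_add_right[OF d] form_minus_right[OF d] form_closed F.r_neg)
      then have "?d = \<zero>\<^bsub>V\<^esub>" using anisotropic d by blast
      then show ?thesis using w by (metis V.a_inv_closed V.minus_equality V.minus_minus)
    next
      case False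
      then show ?thesis using ext by (metis PiE_arb)
    qed
  qed
  then have "(THE \<psi>. is_adjoint F V \<phi> \<psi>) = \<psi>" 
    by (rule the_equality[of "is_adjoint F V \<phi>", OF assms(1)])
  then show ?thesis by (simp add: End_star_def)
qed

text \<open>For \<open>u\<close> in \<open>U\<close>, the form of \<open>u\<close> with
  \<open>\<psi> (\<phi> x)\<close> is that of \<open>\<phi> u = 0\<close> with
  \<open>\<phi> x\<close>. So \<open>\<psi> (\<phi> x)\<close> lies in the orthogonal of
  \<open>U\<close> and is orthogonal to \<open>x\<close>, whence \<open>\<phi> x\<close> is
  orthogonal to itself. Kernels of adjointable operators are therefore closed.\<close>

lemma double_orthogonal_kernel:
  assumes \<phi>: "\<And>v. v \<in> carrier V \<Longrightarrow> \<phi> v \<in> carrier V"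
    and \<psi>: "\<And>v. v \<in> carrier V \<Longrightarrow> \<psi> v \<in> carrier V"
    and adj: "\<And>v w. v \<in> carrier V \<Longrightarrow> w \<in> carrier V \<Longrightarrow> form V (\<phi> v) w = form V v (\<psi> w)"
    and "U \<subseteq> carrier V" and "\<And>u. u \<in> U \<Longrightarrow> \<phi> u = \<zero>\<^bsub>V\<^esub>"
    and x: "x \<in> orthogonal F V (orthogonal F V U)"
  shows "\<phi> x = \<zero>\<^bsub>V\<^esub>"
proof -
  have xV: "x \<in> carrier V" using x by (simp add: orthogonal_def)
  have "form V u (\<psi> (\<phi> x)) = \<zero>" if "u \<in> U" for u
    using adj[of u "\<phi> x"] that assms(4,5) \<phi>[OF xV] form_zero_left by fastforce
  then have "\<psi> (\<phi> x) \<in> orthogonal F V U" using \<phi> \<psi> xV by (auto simp: orthogonal_def)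
  then have "form V (\<psi> (\<phi> x)) x = \<zero>" using x by (simp add: orthogonal_def)
  then have "form V (\<phi> x) (\<phi> x) = \<zero>"
    using adj[of x "\<phi> x"] \<phi> \<psi> xV orthosymmetric by metis
  then show ?thesis using anisotropic \<phi> xV by blast
qed

section \<open>Star-representations on closed invariant subspaces\<close>

lemma is_adjoint_submodule:
  assumes U: "submodule U F V"
    and \<phi>: "\<And>v. v \<in> U \<Longrightarrow> \<phi> v \<in> U" "\<And>v. v \<in> U \<Longrightarrow> \<psi> v \<in> U"
    and \<psi>_add: "\<And>v w. v \<in> U \<Longrightarrow> w \<in> U \<Longrightarrow> \<psi> (v \<oplus>\<^bsub>V\<^esub> w) = \<psi> v \<oplus>\<^bsub>V\<^esub> \<psi> w"
    and \<psi>_smult: "\<And>a v. a \<in> carrier F \<Longrightarrow> v \<in> U \<Longrightarrow> \<psi> (a \<odot>\<^bsub>V\<^esub> v) = a \<odot>\<^bsub>V\<^esub> \<psi> v"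
    and adj: "\<And>v w. v \<in> U \<Longrightarrow> w \<in> U \<Longrightarrow> form V (\<phi> v) w = form V v (\<psi> w)"
  shows "is_adjoint F (V\<lparr>carrier := U\<rparr>) (restrict \<phi> U) (restrict \<psi> U)"
  using assms submodule_add[OF U] submodule_smult[OF U]
  by (auto simp: is_adjoint_def endomorphisms_def)

text \<open>The operators \<open>A r\<close> are additive in \<open>r\<close> and adjointable on all
  of \<open>V\<close>, but known to be multiplicative on \<open>W\<close> only. The representation
  lives on the set \<open>U\<close> of all vectors that respect unit and products; \<open>U\<close>
  contains \<open>W\<close>, which carries faithfulness over.\<close>

lemma closed_star_representation:
  fixes R :: "('r, 'k) star_ring_scheme"
  assumes R: "star_ring R"
    and A_closed: "\<And>r v. r \<in> carrier R \<Longrightarrow> v \<in> carrier V \<Longrightarrow> A r v \<in> carrier V"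
    and A_add: "\<And>r v w. r \<in> carrier R \<Longrightarrow> v \<in> carrier V \<Longrightarrow> w \<in> carrier V \<Longrightarrow>
      A r (v \<oplus>\<^bsub>V\<^esub> w) = A r v \<oplus>\<^bsub>V\<^esub> A r w"
    and A_smult: "\<And>r a v. r \<in> carrier R \<Longrightarrow> a \<in> carrier F \<Longrightarrow> v \<in> carrier V \<Longrightarrow>
      A r (a \<odot>\<^bsub>V\<^esub> v) = a \<odot>\<^bsub>V\<^esub> A r v"
    and A_adj: "\<And>r v w. r \<in> carrier R \<Longrightarrow> v \<in> carrier V \<Longrightarrow> w \<in> carrier V \<Longrightarrow>
      form V (A r v) w = form V v (A (star R r) w)"
    and A_plus: "\<And>r s v. r \<in> carrier R \<Longrightarrow> s \<in> carrier R \<Longrightarrow> v \<in> carrier V \<Longrightarrow>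
      A (r \<oplus>\<^bsub>R\<^esub> s) v = A r v \<oplus>\<^bsub>V\<^esub> A s v"
    and W: "W \<subseteq> carrier V"
    and W_one: "\<And>w. w \<in> W \<Longrightarrow> A \<one>\<^bsub>R\<^esub> w = w"
    and W_mult: "\<And>r s w. r \<in> carrier R \<Longrightarrow> s \<in> carrier R \<Longrightarrow> w \<in> W \<Longrightarrow>
      A r (A s w) = A (r \<otimes>\<^bsub>R\<^esub> s) w"
    and faithful: "\<And>r. r \<in> carrier R \<Longrightarrow> r \<noteq> \<zero>\<^bsub>R\<^esub> \<Longrightarrow> \<exists>w\<in>W. A r w \<noteq> \<zero>\<^bsub>V\<^esub>"
  shows "\<exists>U \<rho>. closed_subspace F V U \<and> star_ring_representation R F (V\<lparr>carrier := U\<rparr>) \<rho>"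
proof -
  interpret R: star_ring R by (rule R)
  \<comment> \<open>\<open>U\<close> is the intersection of the kernels of \<open>A 1 - id\<close>
    and of all \<open>A r A s - A (r s)\<close>.\<close>
  define U where "U = {v \<in> carrier V. A \<one>\<^bsub>R\<^esub> v = v \<and>
    (\<forall>r\<in>carrier R. \<forall>s\<in>carrier R. A r (A s v) = A (r \<otimes>\<^bsub>R\<^esub> s) v)}"
  have UV: "v \<in> carrier V" if "v \<in> U" for v using that by (simp add: U_def)
  have A_zero: "A r \<zero>\<^bsub>V\<^esub> = \<zero>\<^bsub>V\<^esub>" if "r \<in> carrier R" for r
    using A_add[of r "\<zero>\<^bsub>V\<^esub>" "\<zero>\<^bsub>V\<^esub>"] A_closed[of r "\<zero>\<^bsub>V\<^esub>"] that 
    by (metis V.add.l_cancel_one V.l_zero V.zero_closed)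
  \<comment> \<open>Products regroup:
    \<open>A r (A s (A t v)) = A r (A (s t) v) = A (r s t) v\<close>.\<close>
  have AU: "A t v \<in> U" if t: "t \<in> carrier R" and v: "v \<in> U" for t v
    using v t by (auto simp: U_def A_closed R.m_assoc)
  have U: "submodule U F V"
    by (rule submoduleI) (auto simp: U_def A_zero A_closed A_add A_smult smult_closed)
  \<comment> \<open>Each of the operators defining \<open>U\<close> has an adjoint built from
    \<open>star R\<close>, so its kernel contains the double orthogonal of \<open>U\<close>.\<close>
  have "x \<in> U" if x: "x \<in> orthogonal F V (orthogonal F V U)" for x
  proof -
    have xV: "x \<in> carrier V" using x by (simp add: orthogonal_def)
    have eq0: "a = b" if "a \<oplus>\<^bsub>V\<^esub> \<ominus>\<^bsub>V\<^esub> b = \<zero>\<^bsub>V\<^esub>" "a \<in> carrier V" "b \<in> carrier V" for a b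
      using that by (metis V.a_inv_closed V.minus_equality V.minus_minus)
    have "A \<one>\<^bsub>R\<^esub> x \<oplus>\<^bsub>V\<^esub> \<ominus>\<^bsub>V\<^esub> x = \<zero>\<^bsub>V\<^esub>"
    proof (rule double_orthogonal_kernel[where U = U and x = x and \<phi> = "\<lambda>x. A \<one>\<^bsub>R\<^esub> x \<oplus>\<^bsub>V\<^esub> \<ominus>\<^bsub>V\<^esub> x"
          and \<psi> = "\<lambda>x. A (star R \<one>\<^bsub>R\<^esub>) x \<oplus>\<^bsub>V\<^esub> \<ominus>\<^bsub>V\<^esub> x"])
      fix v w assume "v \<in> carrier V" "w \<in> carrier V"
      then show "form V (A \<one>\<^bsub>R\<^esub> v \<oplus>\<^bsub>V\<^esub> \<ominus>\<^bsub>V\<^esub> v) w = form V v (A (star R \<one>\<^bsub>R\<^esub>) w \<oplus>\<^bsub>V\<^esub> \<ominus>\<^bsub>V\<^esub> w)"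
        by (simp add: form_add_left form_add_right form_minus_left form_minus_right A_adj A_closed R.star_closed)
    qed (auto simp: A_closed R.star_closed x UV V.r_neg, auto simp: U_def V.r_neg)
    moreover have "A r (A s x) \<oplus>\<^bsub>V\<^esub> \<ominus>\<^bsub>V\<^esub> A (r \<otimes>\<^bsub>R\<^esub> s) x = \<zero>\<^bsub>V\<^esub>"
      if r: "r \<in> carrier R" and s: "s \<in> carrier R" for r s
    proof (rule double_orthogonal_kernel[where U = U and x = x
          and \<phi> = "\<lambda>x. A r (A s x) \<oplus>\<^bsub>V\<^esub> \<ominus>\<^bsub>V\<^esub> A (r \<otimes>\<^bsub>R\<^esub> s) x"
          and \<psi> = "\<lambda>x. A (star R s) (A (star R r) x) \<oplus>\<^bsub>V\<^esub> \<ominus>\<^bsub>V\<^esub> A (star R (r \<otimes>\<^bsub>R\<^esub> s)) x"])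
      fix v w assume "v \<in> carrier V" "w \<in> carrier V"
      then show "form V (A r (A s v) \<oplus>\<^bsub>V\<^esub> \<ominus>\<^bsub>V\<^esub> A (r \<otimes>\<^bsub>R\<^esub> s) v) w =
          form V v (A (star R s) (A (star R r) w) \<oplus>\<^bsub>V\<^esub> \<ominus>\<^bsub>V\<^esub> A (star R (r \<otimes>\<^bsub>R\<^esub> s)) w)"
        using r s
        by (simp add: form_add_left form_add_right form_minus_left form_minus_right A_adj A_closed R.star_closed)
    next
      fix u assume u: "u \<in> U"
      then have "A r (A s u) = A (r \<otimes>\<^bsub>R\<^esub> s) u" using r s by (simp add: U_def)
      then show "A r (A s u) \<oplus>\<^bsub>V\<^esub> \<ominus>\<^bsub>V\<^esub> A (r \<otimes>\<^bsub>R\<^esub> s) u = \<zero>\<^bsub>V\<^esub>"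
        using UV[OF u] r s by (simp add: A_closed V.r_neg)
    qed (auto simp: A_closed R.star_closed x UV r s)
    ultimately show ?thesis using xV eq0 A_closed by (simp add: U_def)
  qed
  moreover have "U \<subseteq> orthogonal F V (orthogonal F V U)"
    using UV orthosymmetric by (auto simp: orthogonal_def)
  ultimately have closed: "closed_subspace F V U" using U by (auto simp: closed_subspace_def)
  let ?V = "V\<lparr>carrier := U\<rparr>"
  interpret VU: inner_product_space F ?V by (rule submodule_inner_product_space[OF U])
  define \<rho> where "\<rho> r = restrict (A r) U" for r
  have adj: "is_adjoint F ?V (\<rho> r) (\<rho> (star R r))" if r: "r \<in> carrier R" for r
    unfolding \<rho>_def
    using r by (intro is_adjoint_submodule[OF U]) (simp_all add: AU UV R.star_closed A_add A_smult A_adj)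
  have end_\<rho>: "\<rho> r \<in> endomorphisms F ?V" if r: "r \<in> carrier R" for r
    using adj[OF R.star_closed[OF r]] r by (simp add: is_adjoint_def R.star_star)
  have hom: "\<rho> \<in> ring_hom R (End_star F ?V)"
  proof (rule ring_hom_memI)
    fix r assume "r \<in> carrier R"
    then show "\<rho> r \<in> carrier (End_star F ?V)" using adj end_\<rho> by (auto simp: End_star_def)
  next
    fix r s assume rs: "r \<in> carrier R" "s \<in> carrier R"
    have "A r (A s v) = A (r \<otimes>\<^bsub>R\<^esub> s) v" if "v \<in> U" for v using that rs by (simp add: U_def)
    then show "\<rho> (r \<otimes>\<^bsub>R\<^esub> s) = \<rho> r \<otimes>\<^bsub>End_star F ?V\<^esub> \<rho> s"
      using rs AU by (auto simp: End_star_def \<rho>_def restrict_def)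
    show "\<rho> (r \<oplus>\<^bsub>R\<^esub> s) = \<rho> r \<oplus>\<^bsub>End_star F ?V\<^esub> \<rho> s"
      using rs UV by (auto simp: End_star_def \<rho>_def restrict_def A_plus)
  next
    show "\<rho> \<one>\<^bsub>R\<^esub> = \<one>\<^bsub>End_star F ?V\<^esub>"
      by (auto simp: End_star_def \<rho>_def U_def restrict_def)
  qed
  have star: "\<rho> (star R r) = star (End_star F ?V) (\<rho> r)" if r: "r \<in> carrier R" for r
  proof -
    have "\<rho> r \<in> carrier ?V \<rightarrow> carrier ?V" using AU[OF r] by (auto simp: \<rho>_def)
    then show ?thesis using VU.star_End_star[OF adj[OF r]] by simp
  qed
  have "inj_on \<rho> (carrier R)"
  proof (rule inj_onI)
    fix r s assume rs: "r \<in> carrier R" "s \<in> carrier R" "\<rho> r = \<rho> s"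
    let ?d = "r \<oplus>\<^bsub>R\<^esub> \<ominus>\<^bsub>R\<^esub> s"
    \<comment> \<open>A vector of \<open>W\<close> lies in \<open>U\<close>, where
      \<open>\<rho> r\<close> and \<open>\<rho> s\<close> agree; additivity in the ring argument
      then makes \<open>A (r - s)\<close> vanish on it.\<close>
    have "A ?d w = \<zero>\<^bsub>V\<^esub>" if "w \<in> W" for w
    proof -
      have w: "w \<in> U" "w \<in> carrier V" using that W W_one W_mult by (auto simp: U_def)
      then have "A r w = A s w" using rs(3) by (metis \<rho>_def restrict_apply)
      then have "A ?d w \<oplus>\<^bsub>V\<^esub> A s w = A s w"
        using A_plus[of ?d s w] rs w by (simp add: R.a_assoc R.l_neg)
      then show ?thesis using rs w A_closed by simp
    qed
    then have "?d = \<zero>\<^bsub>R\<^esub>" using faithful[of ?d] rs by auto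
    then show "r = s" using rs by (metis R.a_inv_closed R.minus_equality R.minus_minus)
  qed
  then show ?thesis using closed hom star by (auto simp: star_ring_representation_def)
qed

text \<open>Gram-Schmidt: the construction yields the orthogonal projection onto the span of
  \<open>D\<close>, each new direction being normalised by the inverse of its form value, which
  exists by anisotropy.\<close>

lemma finite_projection:
  assumes "finite D" "submodule W F V" "D \<subseteq> W"
  shows "\<exists>P. (\<forall>v\<in>carrier V. P v \<in> W) \<and>
    (\<forall>v\<in>carrier V. \<forall>w\<in>carrier V. P (v \<oplus>\<^bsub>V\<^esub> w) = P v \<oplus>\<^bsub>V\<^esub> P w) \<and>
    (\<forall>a\<in>carrier F. \<forall>v\<in>carrier V. P (a \<odot>\<^bsub>V\<^esub> v) = a \<odot>\<^bsub>V\<^esub> P v) \<and>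
    (\<forall>v\<in>carrier V. \<forall>w\<in>carrier V. form V (P v) w = form V v (P w)) \<and>
    (\<forall>v\<in>D. P v = v)"
proof -
  note c = submodule_carrier[OF assms(2)]
  \<comment> \<open>The induction carries a one-sided form of self-adjointness:
    \<open>w - P w\<close> is orthogonal to the range of \<open>P\<close>. The form is
    orthosymmetric but not assumed Hermitian, so only zeros, not values, can be reversed.\<close>
  have "\<exists>P. (\<forall>v\<in>carrier V. P v \<in> W) \<and>
    (\<forall>v\<in>carrier V. \<forall>w\<in>carrier V. P (v \<oplus>\<^bsub>V\<^esub> w) = P v \<oplus>\<^bsub>V\<^esub> P w) \<and>
    (\<forall>a\<in>carrier F. \<forall>v\<in>carrier V. P (a \<odot>\<^bsub>V\<^esub> v) = a \<odot>\<^bsub>V\<^esub> P v) \<and>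
    (\<forall>v\<in>carrier V. \<forall>w\<in>carrier V. form V (P v) w = form V (P v) (P w)) \<and>
    (\<forall>v\<in>D. P v = v)"
    using assms(1,3)
  proof (induction D)
    case empty
    show ?case
      by (rule exI[of _ "\<lambda>_. \<zero>\<^bsub>V\<^esub>"])
        (simp add: submodule_zero[OF assms(2)] smult_zero_right form_zero_left)
  next
    case (insert d D)
    then have "D \<subseteq> W" by simp
    from insert.IH[OF this] obtain P where P: "\<forall>v\<in>carrier V. P v \<in> W"
      "\<forall>v\<in>carrier V. \<forall>w\<in>carrier V. P (v \<oplus>\<^bsub>V\<^esub> w) = P v \<oplus>\<^bsub>V\<^esub> P w"
      "\<forall>a\<in>carrier F. \<forall>v\<in>carrier V. P (a \<odot>\<^bsub>V\<^esub> v) = a \<odot>\<^bsub>V\<^esub> P v"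
      "\<forall>v\<in>carrier V. \<forall>w\<in>carrier V. form V (P v) w = form V (P v) (P w)"
      "\<forall>v\<in>D. P v = v"
      by blast
    note P_closed = P(1)[rule_format] and P_add = P(2)[rule_format] and P_smult = P(3)[rule_format]
      and P_form = P(4)[rule_format] and P_D = P(5)[rule_format]
    note PV = c[OF P_closed]
    have d: "d \<in> W" "d \<in> carrier V" using insert.prems c by auto
    \<comment> \<open>The part of \<open>d\<close> orthogonal to the range of \<open>P\<close>;
      unless it vanishes it is the new direction.\<close>
    define u where "u = d \<oplus>\<^bsub>V\<^esub> \<ominus>\<^bsub>V\<^esub> P d"
    have u: "u \<in> W" "u \<in> carrier V"
      using d P_closed c submodule_add[OF assms(2)] submodule_minus[OF assms(2)] by (auto simp: u_def)
    have Pu: "form V (P v) u = \<zero>" if "v \<in> carrier V" for v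
      using P_form[of v d] that PV d
      by (simp add: u_def form_add_right form_minus_right F.r_neg form_closed)
    show ?case
    proof (cases "u = \<zero>\<^bsub>V\<^esub>")
      case True
      then have "P d = d" using d PV u_def
        by (metis V.a_inv_closed V.minus_equality V.minus_minus)
      then show ?thesis using P_closed P_add P_smult P_form P_D
        by (intro exI[of _ P]) auto
    next
      case False
      define c where "c = inv (form V u u)"
      have "form V u u \<in> Units F"
        using False anisotropic u F.nonzero_Units form_closed by blast
      then have cF: "c \<in> carrier F" and c_inv: "c \<otimes> form V u u = \<one>"
        by (auto simp: c_def)
      \<comment> \<open>The coordinate along \<open>u\<close>. Scalars act on the left and need not
        commute, so the inverse of \<open>form V u u\<close> stands on the right.\<close>
      define \<alpha> where "\<alpha> v = form V v u \<otimes> c" for v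
      have \<alpha>: "\<alpha> v \<in> carrier F" if "v \<in> carrier V" for v
        using that cF u by (simp add: \<alpha>_def form_closed)
      define Q where "Q v = P v \<oplus>\<^bsub>V\<^esub> \<alpha> v \<odot>\<^bsub>V\<^esub> u" for v
      have \<alpha>u: "\<alpha> v \<odot>\<^bsub>V\<^esub> u \<in> carrier V" if "v \<in> carrier V" for v
        using \<alpha> that u smult_closed by blast
      have Q_closed: "Q v \<in> W" if "v \<in> carrier V" for v
        using that P_closed \<alpha> u submodule_add[OF assms(2)] submodule_smult[OF assms(2)] by (auto simp: Q_def)
      have QV: "Q v \<in> carrier V" if "v \<in> carrier V" for v
        using Q_closed that submodule_carrier[OF assms(2)] by blast
      have "Q (v \<oplus>\<^bsub>V\<^esub> w) = Q v \<oplus>\<^bsub>V\<^esub> Q w" if "v \<in> carrier V" "w \<in> carrier V" for v w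
      proof -
        have "\<alpha> (v \<oplus>\<^bsub>V\<^esub> w) = \<alpha> v \<oplus> \<alpha> w"
          using that u cF by (simp add: \<alpha>_def form_add_left form_closed F.l_distr)
        then show ?thesis
          using that \<alpha> \<alpha>u PV u by (simp add: Q_def P_add smult_l_distr V.a_ac)
      qed
      moreover have "Q (a \<odot>\<^bsub>V\<^esub> v) = a \<odot>\<^bsub>V\<^esub> Q v" if "a \<in> carrier F" "v \<in> carrier V" for a v
      proof -
        have "\<alpha> (a \<odot>\<^bsub>V\<^esub> v) = a \<otimes> \<alpha> v"
          using that u cF by (simp add: \<alpha>_def form_smult_left form_closed F.m_assoc)
        then show ?thesis
          using that \<alpha> \<alpha>u PV u by (simp add: Q_def P_smult smult_r_distr smult_assoc)
      qed
      moreover have "form V (Q v) w = form V (Q v) (Q w)" if v: "v \<in> carrier V" and w: "w \<in> carrier V" for v w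
      proof -
        have uP: "form V u (P w) = \<zero>" using Pu[OF w] PV[OF w] u orthosymmetric by blast
        \<comment> \<open>The coefficient is chosen so that \<open>w - \<alpha> w u\<close> has form
          value \<open>0\<close> with \<open>u\<close>. Reversing this zero by orthosymmetry gives
          the value of \<open>form V u w\<close>.\<close>
        have "form V (w \<oplus>\<^bsub>V\<^esub> \<ominus>\<^bsub>V\<^esub> (\<alpha> w \<odot>\<^bsub>V\<^esub> u)) u = form V w u \<oplus> \<ominus> (form V w u \<otimes> c \<otimes> form V u u)"
          using w u \<alpha>u[OF w] \<alpha>[OF w] by (simp add: form_add_left form_minus_left form_smult_left \<alpha>_def)
        also have "\<dots> = \<zero>"
          using w u cF c_inv by (simp add: F.m_assoc form_closed F.r_neg)
        finally have "form V u (w \<oplus>\<^bsub>V\<^esub> \<ominus>\<^bsub>V\<^esub> (\<alpha> w \<odot>\<^bsub>V\<^esub> u)) = \<zero>"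
          using w u \<alpha>u[OF w] orthosymmetric by (metis V.a_inv_closed V.a_closed)
        then have uw: "form V u w = form V u (\<alpha> w \<odot>\<^bsub>V\<^esub> u)"
          using w u \<alpha>u[OF w] form_closed[of u w] form_closed[of u "\<alpha> w \<odot>\<^bsub>V\<^esub> u"]
          by (simp add: form_add_right form_minus_right)
            (metis F.a_inv_closed F.minus_equality F.minus_minus)
        have "form V (P v) (\<alpha> w \<odot>\<^bsub>V\<^esub> u) = \<zero>"
          using Pu[OF v] PV[OF v] u \<alpha>[OF w] by (simp add: form_smult_right F.star_closed)
        then have "form V (P v) (Q w) = form V (P v) w"
          using P_form[OF v w] PV v w \<alpha>u by (simp add: Q_def form_add_right form_closed)
        moreover have "form V u (Q w) = form V u w"
          using uP uw PV w u \<alpha>u by (simp add: Q_def form_add_right form_closed)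
        ultimately show ?thesis
          using PV[OF v] \<alpha>u[OF v] \<alpha>[OF v] QV[OF w] u w
          by (simp add: Q_def[of v] form_add_left form_smult_left)
      qed
      moreover have "Q v = v" if "v \<in> D" for v
      proof -
        have v: "v \<in> carrier V" using that insert.prems submodule_carrier[OF assms(2)] by auto
        have "\<alpha> v = \<zero>" using Pu[OF v] P_D[OF that] cF by (simp add: \<alpha>_def)
        then have "\<alpha> v \<odot>\<^bsub>V\<^esub> u = \<zero>\<^bsub>V\<^esub>" 
          using smult_l_distr[of \<zero> \<zero> u] \<alpha>u[OF v] u by simp
        then show ?thesis using P_D[OF that] v by (simp add: Q_def)
      qed
      moreover have "Q d = d"
      proof -
        \<comment> \<open>\<open>P d\<close> is orthogonal to \<open>u\<close>, so \<open>d\<close>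
          has coefficient \<open>1\<close> and \<open>Q d = P d + u = d\<close>.\<close>
        have "form V u u = form V d u \<oplus> \<ominus> form V (P d) u"
          using d u PV[OF d(2)]
          by (subst u_def) (simp add: form_add_left form_minus_left del: form_zero_left)
        then have "form V d u = form V u u" using Pu[OF d(2)] d u form_closed by simp
        then have "\<alpha> d = \<one>"
          using \<open>form V u u \<in> Units F\<close> by (simp add: \<alpha>_def c_def)
        then show ?thesis using d u PV[OF d(2)] smult_one[of u]
          by (simp add: Q_def) (simp add: u_def V.a_lcomm V.r_neg)
      qed
      ultimately show ?thesis using Q_closed by (intro exI[of _ Q]) auto
    qed
  qed
  then obtain P where P: "\<forall>v\<in>carrier V. P v \<in> W"
    "\<forall>v\<in>carrier V. \<forall>w\<in>carrier V. P (v \<oplus>\<^bsub>V\<^esub> w) = P v \<oplus>\<^bsub>V\<^esub> P w"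
    "\<forall>a\<in>carrier F. \<forall>v\<in>carrier V. P (a \<odot>\<^bsub>V\<^esub> v) = a \<odot>\<^bsub>V\<^esub> P v"
    "\<forall>v\<in>D. P v = v"
    and form: "\<And>v w. v \<in> carrier V \<Longrightarrow> w \<in> carrier V \<Longrightarrow> form V (P v) w = form V (P v) (P w)"
    by blast
  have "form V (P v) w = form V v (P w)" if v: "v \<in> carrier V" and w: "w \<in> carrier V" for v w
  proof -
    have PV: "P v \<in> carrier V" "P w \<in> carrier V" using P(1) v w c by auto
    \<comment> \<open>By the invariant \<open>P w\<close> is orthogonal to \<open>v - P v\<close>;
      reversing this zero gives full self-adjointness.\<close>
    let ?d = "v \<oplus>\<^bsub>V\<^esub> \<ominus>\<^bsub>V\<^esub> P v"
    have "form V (P w) ?d = \<zero>"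
      using form[OF w v] v w PV by (simp add: form_add_right form_minus_right form_closed F.r_neg)
    then have "form V ?d (P w) = \<zero>" using v PV orthosymmetric by (metis V.a_inv_closed V.a_closed)
    then have "form V v (P w) = form V (P v) (P w)"
      using v w PV by (simp add: form_add_left form_minus_left)
        (metis F.a_inv_closed F.minus_equality F.minus_minus form_closed)
    then show ?thesis using form[OF v w] by simp
  qed
  then show ?thesis using P by (intro exI[of _ P]) auto
qed

end

section \<open>Ultrapowers\<close>

text \<open>Zorn's lemma on the proper filters below \<open>F\<close>, ordered so that finer filters
  are larger. A finest proper filter decides every predicate, since adjoining the predicate either
  makes it improper or changes nothing.\<close>

lemma exists_ultrafilter_le:
  assumes "F \<noteq> bot"
  shows "\<exists>\<U>. ultrafilter \<U> \<and> \<U> \<le> F"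
proof -
  define r where "r = {(G, H). H \<le> G \<and> G \<noteq> bot \<and> G \<le> F \<and> H \<noteq> bot \<and> H \<le> F}"
  have fld: "Field r = {G. G \<noteq> bot \<and> G \<le> F}"
    by (auto simp: Field_def r_def)
  have po: "Partial_order r"
    unfolding partial_order_on_def preorder_on_def fld
    by (auto simp: refl_on_def trans_def antisym_def r_def)
  have "\<exists>m\<in>Field r. \<forall>a\<in>Field r. (m, a) \<in> r \<longrightarrow> a = m"
  proof (rule Zorns_po_lemma[OF po])
    fix C assume C: "C \<in> Chains r"
    show "\<exists>u\<in>Field r. \<forall>a\<in>C. (a, u) \<in> r"
    proof (cases "C = {}")
      case True
      then show ?thesis using assms by (auto simp: fld)
    next
      case False
      have sub: "C \<subseteq> Field r" using C by (auto simp: Chains_def Field_def)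
      \<comment> \<open>A chain is directed, so an event of \<open>Inf C\<close> is already an event
        of some member; \<open>False\<close> is an event of none.\<close>
      have base: "\<exists>x\<in>C. x \<le> inf G H" if "G \<in> C" "H \<in> C" for G H
        using C that by (auto simp: Chains_def r_def)
      have "Inf C \<noteq> bot"
        using eventually_Inf_base[OF False base, of "\<lambda>_. False"] sub
        by (auto simp: trivial_limit_def fld)
      moreover have "Inf C \<le> F"
        using False sub by (auto simp: fld intro: Inf_lower2)
      ultimately show ?thesis using sub[unfolded fld]
        by (intro bexI[of _ "Inf C"]) (auto simp: fld, auto simp: r_def intro: Inf_lower)
    qed
  qed
  then obtain \<U> where \<U>: "\<U> \<noteq> bot" "\<U> \<le> F"
    and max: "\<And>G. G \<noteq> bot \<Longrightarrow> G \<le> \<U> \<Longrightarrow> G = \<U>"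
    unfolding fld by (auto simp: r_def)
  have "eventually P \<U> \<or> eventually (\<lambda>i. \<not> P i) \<U>" for P
  proof (cases "inf \<U> (principal {i. P i}) = bot")
    case True
    then show ?thesis
      by (simp add: trivial_limit_def eventually_inf_principal)
  next
    case False
    then have "inf \<U> (principal {i. P i}) = \<U>" by (intro max) auto
    then have "\<U> \<le> principal {i. P i}" by (metis inf.orderI)
    then show ?thesis by (simp add: le_principal)
  qed
  with \<U> show ?thesis by (auto simp: ultrafilter_def)
qed

text \<open>The class is empty when \<open>f\<close> leaves \<open>A\<close>.\<close>

definition ultra_class :: "'i filter \<Rightarrow> 'a set \<Rightarrow> ('i \<Rightarrow> 'a) \<Rightarrow> ('i \<Rightarrow> 'a) set" where
  "ultra_class \<U> A f = ultra_rel \<U> A `` {f}"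

lemma mem_ultra_class:
  "g \<in> ultra_class \<U> A f \<longleftrightarrow> f \<in> UNIV \<rightarrow> A \<and> g \<in> UNIV \<rightarrow> A \<and> (\<forall>\<^sub>F i in \<U>. f i = g i)"
  by (auto simp: ultra_class_def ultra_rel_def)

lemma ultra_class_eq_iff:
  assumes "f \<in> UNIV \<rightarrow> A" "g \<in> UNIV \<rightarrow> A"
  shows "ultra_class \<U> A f = ultra_class \<U> A g \<longleftrightarrow> (\<forall>\<^sub>F i in \<U>. f i = g i)"
proof
  assume "ultra_class \<U> A f = ultra_class \<U> A g"
  moreover have "g \<in> ultra_class \<U> A g" using assms by (simp add: mem_ultra_class)
  ultimately show "\<forall>\<^sub>F i in \<U>. f i = g i" by (metis mem_ultra_class)
next
  assume fg: "\<forall>\<^sub>F i in \<U>. f i = g i"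
  show "ultra_class \<U> A f = ultra_class \<U> A g"
    using assms fg
    by (auto simp: mem_ultra_class set_eq_iff elim: eventually_elim2[OF fg])
qed

lemma ultra_carrier_conv: "X \<in> ultra_carrier \<U> A \<longleftrightarrow> (\<exists>f \<in> UNIV \<rightarrow> A. X = ultra_class \<U> A f)"
  by (auto simp: ultra_carrier_def quotient_def ultra_class_def)

lemma ultra_const_conv: "ultra_const \<U> A a = ultra_class \<U> A (\<lambda>i. a)"
  by (simp add: ultra_const_def ultra_class_def)

text \<open>An internal map of the ultrapower: in contrast to \<open>ultra_lift\<close>, the
  function depends on the coordinate, as compressions to varying subspaces do.\<close>

definition ultra_map :: "'i filter \<Rightarrow> 'b set \<Rightarrow> ('i \<Rightarrow> 'a \<Rightarrow> 'b) \<Rightarrow> ('i \<Rightarrow> 'a) set \<Rightarrow> ('i \<Rightarrow> 'b) set" where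
  "ultra_map \<U> B h X = (\<Union>f\<in>X. ultra_class \<U> B (\<lambda>i. h i (f i)))"

lemma ultra_map_class:
  assumes f: "f \<in> UNIV \<rightarrow> A" and h: "\<And>i a. a \<in> A \<Longrightarrow> h i a \<in> B"
  shows "ultra_map \<U> B h (ultra_class \<U> A f) = ultra_class \<U> B (\<lambda>i. h i (f i))"
proof -
  have "ultra_class \<U> B (\<lambda>i. h i (g i)) = ultra_class \<U> B (\<lambda>i. h i (f i))"
    if "g \<in> ultra_class \<U> A f" for g
    using that h
    by (subst ultra_class_eq_iff) (auto simp: mem_ultra_class Pi_iff elim: eventually_mono)
  moreover have "f \<in> ultra_class \<U> A f" using f by (simp add: mem_ultra_class)
  ultimately show ?thesis unfolding ultra_map_def by blast
qed

lemma ultra_lift_class: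
  assumes "f \<in> UNIV \<rightarrow> A" and "\<And>a. a \<in> A \<Longrightarrow> h a \<in> B"
  shows "ultra_lift \<U> B h (ultra_class \<U> A f) = ultra_class \<U> B (\<lambda>i. h (f i))"
  using ultra_map_class[of f A "\<lambda>_. h" B \<U>] assms
  by (simp add: ultra_lift_def ultra_map_def ultra_class_def)

lemma ultra_lift2_class:
  assumes f: "f \<in> UNIV \<rightarrow> A" and g: "g \<in> UNIV \<rightarrow> B" and h: "\<And>a b. a \<in> A \<Longrightarrow> b \<in> B \<Longrightarrow> h a b \<in> C"
  shows "ultra_lift2 \<U> C h (ultra_class \<U> A f) (ultra_class \<U> B g) = ultra_class \<U> C (\<lambda>i. h (f i) (g i))"
proof -
  have "ultra_class \<U> C (\<lambda>i. h (f' i) (g' i)) = ultra_class \<U> C (\<lambda>i. h (f i) (g i))"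
    if "f' \<in> ultra_class \<U> A f" "g' \<in> ultra_class \<U> B g" for f' g'
    using that h
    by (subst ultra_class_eq_iff) (auto simp: mem_ultra_class Pi_iff elim: eventually_elim2)
  moreover have "f \<in> ultra_class \<U> A f" "g \<in> ultra_class \<U> B g"
    using f g by (simp_all add: mem_ultra_class)
  ultimately show ?thesis
    unfolding ultra_lift2_def ultra_class_def[symmetric] by blast
qed

section \<open>The ultrapower of an inner product space\<close>

locale inner_product_ultrapower = inner_product_space F V
  for F :: "('f, 'm) star_ring_scheme" (structure)
    and V :: "('f, 'v, 'n) inner_product_space_scheme" (structure) +
  fixes \<U> :: "'i filter"
  assumes \<U>: "ultrafilter \<U>"
begin

abbreviation "FU \<equiv> ultrapower_scalars \<U> F"
abbreviation "VU \<equiv> ultrapower_vectors \<U> F V"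
abbreviation "sc \<equiv> ultra_class \<U> (carrier F)"
abbreviation "vc \<equiv> ultra_class \<U> (carrier V)"

lemma scalars_carrier: "X \<in> carrier FU \<longleftrightarrow> (\<exists>f. (\<forall>i. f i \<in> carrier F) \<and> X = sc f)"
  by (simp add: ultrapower_scalars_def ultra_carrier_conv Bex_def Pi_iff)

lemma vectors_carrier: "X \<in> carrier VU \<longleftrightarrow> (\<exists>f. (\<forall>i. f i \<in> carrier V) \<and> X = vc f)"
  by (simp add: ultrapower_vectors_def ultra_carrier_conv Bex_def Pi_iff)

lemma sc_eq_iff: "\<forall>i. f i \<in> carrier F \<Longrightarrow> \<forall>i. g i \<in> carrier F \<Longrightarrow> sc f = sc g \<longleftrightarrow> (\<forall>\<^sub>F i in \<U>. f i = g i)"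
  by (simp add: ultra_class_eq_iff)

lemma vc_eq_iff: "\<forall>i. f i \<in> carrier V \<Longrightarrow> \<forall>i. g i \<in> carrier V \<Longrightarrow> vc f = vc g \<longleftrightarrow> (\<forall>\<^sub>F i in \<U>. f i = g i)"
  by (simp add: ultra_class_eq_iff)

lemma scalars_ops:
  "\<one>\<^bsub>FU\<^esub> = sc (\<lambda>i. \<one>)"
  "\<zero>\<^bsub>FU\<^esub> = sc (\<lambda>i. \<zero>)"
  "\<forall>i. f i \<in> carrier F \<Longrightarrow> \<forall>i. g i \<in> carrier F \<Longrightarrow> sc f \<otimes>\<^bsub>FU\<^esub> sc g = sc (\<lambda>i. f i \<otimes> g i)"
  "\<forall>i. f i \<in> carrier F \<Longrightarrow> \<forall>i. g i \<in> carrier F \<Longrightarrow> sc f \<oplus>\<^bsub>FU\<^esub> sc g = sc (\<lambda>i. f i \<oplus> g i)"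
  "\<forall>i. f i \<in> carrier F \<Longrightarrow> star FU (sc f) = sc (\<lambda>i. star F (f i))"
  by (simp_all add: ultrapower_scalars_def ultra_const_conv F.star_closed
      ultra_lift2_class[where A = "carrier F" and B = "carrier F"] ultra_lift_class[where A = "carrier F"])

lemma vectors_ops:
  "\<zero>\<^bsub>VU\<^esub> = vc (\<lambda>i. \<zero>\<^bsub>V\<^esub>)"
  "\<forall>i. v i \<in> carrier V \<Longrightarrow> \<forall>i. w i \<in> carrier V \<Longrightarrow> vc v \<oplus>\<^bsub>VU\<^esub> vc w = vc (\<lambda>i. v i \<oplus>\<^bsub>V\<^esub> w i)"
  "\<forall>i. f i \<in> carrier F \<Longrightarrow> \<forall>i. w i \<in> carrier V \<Longrightarrow> sc f \<odot>\<^bsub>VU\<^esub> vc w = vc (\<lambda>i. f i \<odot>\<^bsub>V\<^esub> w i)"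
  "\<forall>i. v i \<in> carrier V \<Longrightarrow> \<forall>i. w i \<in> carrier V \<Longrightarrow> form VU (vc v) (vc w) = sc (\<lambda>i. form V (v i) (w i))"
  by (simp_all add: ultrapower_vectors_def ultra_const_conv smult_closed form_closed
      ultra_lift2_class[where A = "carrier V" and B = "carrier V"]
      ultra_lift2_class[where A = "carrier F" and B = "carrier V"])

lemma sc_closed: "\<forall>i. f i \<in> carrier F \<Longrightarrow> sc f \<in> carrier FU"
  by (auto simp: scalars_carrier)

lemma vc_closed: "\<forall>i. f i \<in> carrier V \<Longrightarrow> vc f \<in> carrier VU"
  by (auto simp: vectors_carrier)

lemma division_star_ring_ultrapower: "division_star_ring FU"
proof -
  have "ring FU"
  proof (rule ringI)
    show "abelian_group FU"
    proof (rule abelian_groupI)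
      fix X Y assume "X \<in> carrier FU" "Y \<in> carrier FU"
      then show "X \<oplus>\<^bsub>FU\<^esub> Y \<in> carrier FU"
        by (auto simp: scalars_carrier[of X] scalars_carrier[of Y] scalars_ops sc_closed)
    next
      fix X assume "X \<in> carrier FU"
      then obtain f where f: "\<forall>i. f i \<in> carrier F" "X = sc f" by (auto simp: scalars_carrier)
      then have "sc (\<lambda>i. \<ominus> f i) \<oplus>\<^bsub>FU\<^esub> X = \<zero>\<^bsub>FU\<^esub>" by (simp add: scalars_ops F.l_neg)
      then show "\<exists>Y\<in>carrier FU. Y \<oplus>\<^bsub>FU\<^esub> X = \<zero>\<^bsub>FU\<^esub>"
        using f by (intro bexI[of _ "sc (\<lambda>i. \<ominus> f i)"]) (simp_all add: sc_closed)
    qed (auto simp: scalars_carrier scalars_ops F.a_ac)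
    show "Group.monoid FU"
    proof (rule monoidI)
      fix X Y assume "X \<in> carrier FU" "Y \<in> carrier FU"
      then show "X \<otimes>\<^bsub>FU\<^esub> Y \<in> carrier FU"
        by (auto simp: scalars_carrier[of X] scalars_carrier[of Y] scalars_ops sc_closed)
    qed (auto simp: scalars_carrier scalars_ops F.m_assoc)
  qed (auto simp: scalars_carrier scalars_ops F.l_distr F.r_distr)
  moreover have "star_ring_axioms FU"
  proof (rule star_ring_axioms.intro)
    fix X assume "X \<in> carrier FU"
    then show "star FU X \<in> carrier FU"
      by (auto simp: scalars_carrier[of X] scalars_ops sc_closed F.star_closed)
  qed (auto simp: scalars_carrier scalars_ops F.star_add F.star_mult F.star_star F.star_closed)
  moreover have "division_star_ring_axioms FU"
  proof
    show "\<one>\<^bsub>FU\<^esub> \<noteq> \<zero>\<^bsub>FU\<^esub>"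
      using \<U> by (simp add: scalars_ops sc_eq_iff F.one_not_zero ultrafilter_def trivial_limit_def)
  next
    fix X assume "X \<in> carrier FU" and nz: "X \<noteq> \<zero>\<^bsub>FU\<^esub>"
    then obtain f where f: "\<forall>i. f i \<in> carrier F" "X = sc f" by (auto simp: scalars_carrier)
    \<comment> \<open>Coordinatewise inverses, with default \<open>\<zero>\<close> where
      \<open>f i\<close> vanishes. These coordinates are negligible: the ultrafilter decides whether
      \<open>f i = \<zero>\<close>, and \<open>X\<close> is nonzero.\<close>
    define g where "g i = (if f i = \<zero> then \<zero> else inv (f i))" for i
    have g: "\<forall>i. g i \<in> carrier F" and fg: "\<And>i. f i \<noteq> \<zero> \<Longrightarrow> g i \<otimes> f i = \<one>" "\<And>i. f i \<noteq> \<zero> \<Longrightarrow> f i \<otimes> g i = \<one>"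
      using f F.nonzero_Units by (auto simp: g_def)
    have "\<forall>\<^sub>F i in \<U>. f i \<noteq> \<zero>"
      using \<U> f nz by (auto simp: scalars_ops sc_eq_iff ultrafilter_def)
    then have "sc g \<otimes>\<^bsub>FU\<^esub> X = \<one>\<^bsub>FU\<^esub>" "X \<otimes>\<^bsub>FU\<^esub> sc g = \<one>\<^bsub>FU\<^esub>"
      using f g by (auto simp: scalars_ops sc_eq_iff fg elim: eventually_mono)
    then show "X \<in> Units FU" using f g sc_closed by (auto simp: Units_def)
  qed
  ultimately show ?thesis by (intro division_star_ring.intro star_ring.intro)
qed

lemma inner_product_space_ultrapower: "inner_product_space FU VU"
proof (intro inner_product_space.intro division_star_ring_ultrapower inner_product_space_axioms.intro)
  show "abelian_group VU"
  proof (rule abelian_groupI)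
    fix X Y assume "X \<in> carrier VU" "Y \<in> carrier VU"
    then show "X \<oplus>\<^bsub>VU\<^esub> Y \<in> carrier VU"
      by (auto simp: vectors_carrier[of X] vectors_carrier[of Y] vectors_ops vc_closed)
  next
    fix X assume "X \<in> carrier VU"
    then obtain f where f: "\<forall>i. f i \<in> carrier V" "X = vc f" by (auto simp: vectors_carrier)
    then have "vc (\<lambda>i. \<ominus>\<^bsub>V\<^esub> f i) \<oplus>\<^bsub>VU\<^esub> X = \<zero>\<^bsub>VU\<^esub>" by (simp add: vectors_ops V.l_neg)
    then show "\<exists>Y\<in>carrier VU. Y \<oplus>\<^bsub>VU\<^esub> X = \<zero>\<^bsub>VU\<^esub>"
      using f by (intro bexI[of _ "vc (\<lambda>i. \<ominus>\<^bsub>V\<^esub> f i)"]) (simp_all add: vc_closed)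
  qed (auto simp: vectors_carrier vectors_ops V.a_ac)
next
  fix a X assume "a \<in> carrier FU" "X \<in> carrier VU"
  then show "a \<odot>\<^bsub>VU\<^esub> X \<in> carrier VU"
    by (auto simp: scalars_carrier[of a] vectors_carrier[of X] vectors_ops vc_closed smult_closed)
next
  fix X Y assume "X \<in> carrier VU" "Y \<in> carrier VU"
  then show "form VU X Y \<in> carrier FU"
    by (auto simp: vectors_carrier vectors_ops sc_closed form_closed)
next
  fix X assume X: "X \<in> carrier VU" "form VU X X = \<zero>\<^bsub>FU\<^esub>"
  then obtain f where f: "\<forall>i. f i \<in> carrier V" "X = vc f" by (auto simp: vectors_carrier)
  then have "\<forall>\<^sub>F i in \<U>. form V (f i) (f i) = \<zero>"
    using X by (simp add: vectors_ops scalars_ops sc_eq_iff form_closed)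
  then have "\<forall>\<^sub>F i in \<U>. f i = \<zero>\<^bsub>V\<^esub>"
    by (rule eventually_mono) (use f anisotropic in blast)
  then show "X = \<zero>\<^bsub>VU\<^esub>" using f by (simp add: vectors_ops vc_eq_iff)
next
  fix X Y assume "X \<in> carrier VU" "Y \<in> carrier VU"
  then obtain f g where f: "\<forall>i. f i \<in> carrier V" "X = vc f" and g: "\<forall>i. g i \<in> carrier V" "Y = vc g"
    by (auto simp: vectors_carrier)
  have "form V (f i) (g i) = \<zero> \<longleftrightarrow> form V (g i) (f i) = \<zero>" for i
    using f g orthosymmetric by blast
  then show "form VU X Y = \<zero>\<^bsub>FU\<^esub> \<longleftrightarrow> form VU Y X = \<zero>\<^bsub>FU\<^esub>"
    using f g by (simp add: vectors_ops scalars_ops sc_eq_iff form_closed)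
qed (auto simp: scalars_carrier vectors_carrier scalars_ops vectors_ops smult_closed smult_l_distr
    smult_r_distr smult_assoc smult_one form_closed form_add_left form_add_right form_smult F.star_closed)

end

text \<open>The action is given on \<open>W\<close> alone, while operators with adjoints on the
  whole space are required. The compressions \<open>P i A r P i\<close> are defined everywhere, and
  an ultrafilter on finite subsets of \<open>W\<close> makes them agree with \<open>A r\<close> on
  constant families from \<open>W\<close>.\<close>

lemma (in inner_product_space) ultrapower_star_representation:
  fixes R :: "('r, 'k) star_ring_scheme"
  assumes R: "star_ring R" and W: "submodule W F V"
    and A_closed: "\<And>r v. r \<in> carrier R \<Longrightarrow> v \<in> W \<Longrightarrow> A r v \<in> W"
    and A_add: "\<And>r v w. r \<in> carrier R \<Longrightarrow> v \<in> W \<Longrightarrow> w \<in> W \<Longrightarrow>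
      A r (v \<oplus>\<^bsub>V\<^esub> w) = A r v \<oplus>\<^bsub>V\<^esub> A r w"
    and A_smult: "\<And>r a v. r \<in> carrier R \<Longrightarrow> a \<in> carrier F \<Longrightarrow> v \<in> W \<Longrightarrow>
      A r (a \<odot>\<^bsub>V\<^esub> v) = a \<odot>\<^bsub>V\<^esub> A r v"
    and A_adj: "\<And>r v w. r \<in> carrier R \<Longrightarrow> v \<in> W \<Longrightarrow> w \<in> W \<Longrightarrow>
      form V (A r v) w = form V v (A (star R r) w)"
    and A_plus: "\<And>r s v. r \<in> carrier R \<Longrightarrow> s \<in> carrier R \<Longrightarrow> v \<in> W \<Longrightarrow>
      A (r \<oplus>\<^bsub>R\<^esub> s) v = A r v \<oplus>\<^bsub>V\<^esub> A s v"
    and A_one: "\<And>w. w \<in> W \<Longrightarrow> A \<one>\<^bsub>R\<^esub> w = w"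
    and A_mult: "\<And>r s w. r \<in> carrier R \<Longrightarrow> s \<in> carrier R \<Longrightarrow> w \<in> W \<Longrightarrow>
      A r (A s w) = A (r \<otimes>\<^bsub>R\<^esub> s) w"
    and faithful: "\<And>r. r \<in> carrier R \<Longrightarrow> r \<noteq> \<zero>\<^bsub>R\<^esub> \<Longrightarrow> \<exists>w\<in>W. A r w \<noteq> \<zero>\<^bsub>V\<^esub>"
  shows "\<exists>(\<U> :: ('r, 'f, 'v) ultra_index filter) U \<rho>. ultrafilter \<U> \<and>
    closed_subspace (ultrapower_scalars \<U> F) (ultrapower_vectors \<U> F V) U \<and>
    star_ring_representation R (ultrapower_scalars \<U> F)
      ((ultrapower_vectors \<U> F V)\<lparr>carrier := U\<rparr>) \<rho>"
proof -
  interpret R: star_ring R by (rule R)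
  note c = submodule_carrier[OF W]
  \<comment> \<open>Almost every index is finite and contains a given vector of \<open>W\<close>.
    The vectors enter the prescribed index type through the tag \<open>Inr\<close> applied
    twice.\<close>
  define G :: "('r, 'f, 'v) ultra_index filter" where "G = finite_subsets_at_top (Inr ` Inr ` W)"
  obtain \<U> where \<U>: "ultrafilter \<U>" "\<U> \<le> G"
    using exists_ultrafilter_le[of G] by (auto simp: G_def)
  \<comment> \<open>A finite index \<open>i\<close> stands for the span of the vectors in it, \<open>P i\<close> for the orthogonal projection onto it.\<close>
  define D where "D i = {v \<in> W. Inr (Inr v) \<in> i}" for i :: "('r, 'f, 'v) ultra_index"
  \<comment> \<open>Indices with \<open>D i\<close> infinite receive a projection for the empty set
    as default; they are negligible for \<open>\<U>\<close>.\<close>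
  have "\<exists>P. (\<forall>v\<in>carrier V. P v \<in> W) \<and>
    (\<forall>v\<in>carrier V. \<forall>w\<in>carrier V. P (v \<oplus>\<^bsub>V\<^esub> w) = P v \<oplus>\<^bsub>V\<^esub> P w) \<and>
    (\<forall>a\<in>carrier F. \<forall>v\<in>carrier V. P (a \<odot>\<^bsub>V\<^esub> v) = a \<odot>\<^bsub>V\<^esub> P v) \<and>
    (\<forall>v\<in>carrier V. \<forall>w\<in>carrier V. form V (P v) w = form V v (P w)) \<and>
    (\<forall>v\<in>(if finite (D i) then D i else {}). P v = v)" for i
    by (rule finite_projection[OF _ W]) (auto simp: D_def)
  then have "\<exists>P. \<forall>i. (\<forall>v\<in>carrier V. P i v \<in> W) \<and>
    (\<forall>v\<in>carrier V. \<forall>w\<in>carrier V. P i (v \<oplus>\<^bsub>V\<^esub> w) = P i v \<oplus>\<^bsub>V\<^esub> P i w) \<and>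
    (\<forall>a\<in>carrier F. \<forall>v\<in>carrier V. P i (a \<odot>\<^bsub>V\<^esub> v) = a \<odot>\<^bsub>V\<^esub> P i v) \<and>
    (\<forall>v\<in>carrier V. \<forall>w\<in>carrier V. form V (P i v) w = form V v (P i w)) \<and>
    (\<forall>v\<in>(if finite (D i) then D i else {}). P i v = v)"
    by (intro choice allI)
  then obtain P :: "('r, 'f, 'v) ultra_index \<Rightarrow> 'v \<Rightarrow> 'v" where P: "\<forall>i. (\<forall>v\<in>carrier V. P i v \<in> W) \<and>
    (\<forall>v\<in>carrier V. \<forall>w\<in>carrier V. P i (v \<oplus>\<^bsub>V\<^esub> w) = P i v \<oplus>\<^bsub>V\<^esub> P i w) \<and>
    (\<forall>a\<in>carrier F. \<forall>v\<in>carrier V. P i (a \<odot>\<^bsub>V\<^esub> v) = a \<odot>\<^bsub>V\<^esub> P i v) \<and>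
    (\<forall>v\<in>carrier V. \<forall>w\<in>carrier V. form V (P i v) w = form V v (P i w)) \<and>
    (\<forall>v\<in>(if finite (D i) then D i else {}). P i v = v)" ..
  have PW: "P i v \<in> W" if "v \<in> carrier V" for i v using P that by blast
  note PV = c[OF PW]
  have P_add: "P i (v \<oplus>\<^bsub>V\<^esub> w) = P i v \<oplus>\<^bsub>V\<^esub> P i w" if "v \<in> carrier V" "w \<in> carrier V" for i v w
    using P that by blast
  have P_smult: "P i (a \<odot>\<^bsub>V\<^esub> v) = a \<odot>\<^bsub>V\<^esub> P i v" if "a \<in> carrier F" "v \<in> carrier V" for i a v
    using P that by blast
  have P_adj: "form V (P i v) w = form V v (P i w)" if "v \<in> carrier V" "w \<in> carrier V" for i v w
    using P that by blast
  have P_id: "\<forall>\<^sub>F i in \<U>. P i w = w" if w: "w \<in> W" for w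
  proof -
    have "P i w = w" if "finite i" "Inr (Inr w) \<in> i" for i
    proof -
      have "finite (D i)"
        by (rule inj_on_finite[of "\<lambda>v. Inr (Inr v)" _ i]) (use that in \<open>auto simp: D_def inj_on_def\<close>)
      then have "w \<in> (if finite (D i) then D i else {})" using that w by (simp add: D_def)
      then show ?thesis using P by blast
    qed
    then have "\<forall>\<^sub>F i in G. P i w = w"
      unfolding G_def eventually_finite_subsets_at_top
      using w by (intro exI[of _ "{Inr (Inr w)}"]) auto
    then show ?thesis using \<U>(2) filter_leD by blast
  qed
  interpret U: inner_product_ultrapower F V \<U> by unfold_locales (rule \<U>(1))
  interpret VU: inner_product_space U.FU U.VU by (rule U.inner_product_space_ultrapower)
  \<comment> \<open>\<open>P i\<close> maps into \<open>W\<close>, so this is defined on all of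
    \<open>V\<close>, and self-adjointness of \<open>P i\<close> provides the adjoint
    \<open>B (star R r) i\<close>. Multiplicativity may be lost.\<close>
  define B where "B r i v = P i (A r (P i v))" for r i v
  have B_closed: "B r i v \<in> carrier V" if "r \<in> carrier R" "v \<in> carrier V" for r i v
    using that by (simp add: B_def PV A_closed c PW)
  have B_add: "B r i (v \<oplus>\<^bsub>V\<^esub> w) = B r i v \<oplus>\<^bsub>V\<^esub> B r i w"
    if "r \<in> carrier R" "v \<in> carrier V" "w \<in> carrier V" for r i v w
    using that by (simp add: B_def P_add A_add PW A_closed c)
  have B_smult: "B r i (a \<odot>\<^bsub>V\<^esub> v) = a \<odot>\<^bsub>V\<^esub> B r i v"
    if "r \<in> carrier R" "a \<in> carrier F" "v \<in> carrier V" for r i a v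
    using that by (simp add: B_def P_smult A_smult PW A_closed c)
  have B_adj: "form V (B r i v) w = form V v (B (star R r) i w)"
    if "r \<in> carrier R" "v \<in> carrier V" "w \<in> carrier V" for r i v w
    using that by (simp add: B_def P_adj A_adj PV PW A_closed c R.star_closed)
  have B_plus: "B (r \<oplus>\<^bsub>R\<^esub> s) i v = B r i v \<oplus>\<^bsub>V\<^esub> B s i v"
    if "r \<in> carrier R" "s \<in> carrier R" "v \<in> carrier V" for r s i v
    using that by (simp add: B_def P_add A_plus PW A_closed c)
  define C where "C r = ultra_map \<U> (carrier V) (B r)" for r
  have C_class: "C r (U.vc f) = U.vc (\<lambda>i. B r i (f i))" if "r \<in> carrier R" "\<forall>i. f i \<in> carrier V" for r f
    using that B_closed unfolding C_def by (intro ultra_map_class[where A = "carrier V"]) auto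
  \<comment> \<open>Both \<open>w\<close> and \<open>A r w\<close> lie in \<open>W\<close>, so
    almost all \<open>P i\<close> fix them.\<close>
  have B_W: "\<forall>\<^sub>F i in \<U>. B r i w = A r w" if "r \<in> carrier R" "w \<in> W" for r w
    using P_id[OF that(2)] P_id[OF A_closed[OF that]]
    by eventually_elim (simp add: B_def)
  have C_W: "C r (U.vc (\<lambda>_. w)) = U.vc (\<lambda>_. A r w)" if "r \<in> carrier R" "w \<in> W" for r w
    using B_W[OF that] that c A_closed B_closed by (simp add: C_class U.vc_eq_iff)
  have "\<exists>U \<rho>. closed_subspace U.FU U.VU U \<and>
      star_ring_representation R U.FU (U.VU\<lparr>carrier := U\<rparr>) \<rho>"
  \<comment> \<open>Unit and products are checked on the diagonal copy of \<open>W\<close> only,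
    where \<open>C\<close> acts as \<open>A\<close>.\<close>
  proof (rule VU.closed_star_representation[OF R, where A = C and W = "(\<lambda>w. U.vc (\<lambda>_. w)) ` W"])
    fix r X assume "r \<in> carrier R" "X \<in> carrier U.VU"
    then show "C r X \<in> carrier U.VU"
      by (auto simp: U.vectors_carrier[of X] C_class B_closed U.vc_closed)
  next
    fix r X Y assume "r \<in> carrier R" "X \<in> carrier U.VU" "Y \<in> carrier U.VU"
    then show "C r (X \<oplus>\<^bsub>U.VU\<^esub> Y) = C r X \<oplus>\<^bsub>U.VU\<^esub> C r Y"
      by (auto simp: U.vectors_carrier C_class U.vectors_ops B_closed B_add)
  next
    fix r a X assume "r \<in> carrier R" "a \<in> carrier U.FU" "X \<in> carrier U.VU"
    then show "C r (a \<odot>\<^bsub>U.VU\<^esub> X) = a \<odot>\<^bsub>U.VU\<^esub> C r X"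
      by (auto simp: U.vectors_carrier U.scalars_carrier C_class U.vectors_ops B_closed smult_closed B_smult)
  next
    fix r X Y assume "r \<in> carrier R" "X \<in> carrier U.VU" "Y \<in> carrier U.VU"
    then show "form U.VU (C r X) Y = form U.VU X (C (star R r) Y)"
      by (auto simp: U.vectors_carrier C_class U.vectors_ops B_closed R.star_closed B_adj)
  next
    fix r s X assume "r \<in> carrier R" "s \<in> carrier R" "X \<in> carrier U.VU"
    then show "C (r \<oplus>\<^bsub>R\<^esub> s) X = C r X \<oplus>\<^bsub>U.VU\<^esub> C s X"
      by (auto simp: U.vectors_carrier C_class U.vectors_ops B_closed B_plus)
  next
    show "(\<lambda>w. U.vc (\<lambda>_. w)) ` W \<subseteq> carrier U.VU" using c by (auto simp: U.vc_closed)
  next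
    fix r assume r: "r \<in> carrier R" "r \<noteq> \<zero>\<^bsub>R\<^esub>"
    then obtain w where w: "w \<in> W" "A r w \<noteq> \<zero>\<^bsub>V\<^esub>" using faithful by blast
    then have "C r (U.vc (\<lambda>_. w)) \<noteq> \<zero>\<^bsub>U.VU\<^esub>"
      using \<U>(1) r c A_closed by (simp add: C_W U.vectors_ops U.vc_eq_iff ultrafilter_def)
    then show "\<exists>X\<in>(\<lambda>w. U.vc (\<lambda>_. w)) ` W. C r X \<noteq> \<zero>\<^bsub>U.VU\<^esub>" using w by blast
  qed (auto simp: C_W A_one A_mult A_closed)
  then show ?thesis using \<U>(1) by blast
qed

section \<open>Actions induced from a left ideal\<close>

text \<open>\<open>T a v\<close> stands for a product \<open>a v\<close>, given for \<open>a\<close>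
  in a left ideal \<open>L\<close> and \<open>v\<close> in a subspace \<open>H\<close>;
  \<open>T_form\<close> says that \<open>star R a\<close> is the adjoint of \<open>a\<close>. These
  data determine an action of the whole ring on the span of all \<open>T a v\<close>.\<close>

locale left_ideal_action = inner_product_space F V + R: star_ring R
  for F :: "('f, 'm) star_ring_scheme" (structure)
    and V :: "('f, 'v, 'n) inner_product_space_scheme" (structure)
    and R :: "('r, 'k) star_ring_scheme" +
  fixes L :: "'r set" and H :: "'v set" and T :: "'r \<Rightarrow> 'v \<Rightarrow> 'v"
  assumes H: "submodule H F V"
    and L_subset: "L \<subseteq> carrier R"
    and L_add: "a \<in> L \<Longrightarrow> b \<in> L \<Longrightarrow> a \<oplus>\<^bsub>R\<^esub> b \<in> L"
    and L_mult: "r \<in> carrier R \<Longrightarrow> a \<in> L \<Longrightarrow> r \<otimes>\<^bsub>R\<^esub> a \<in> L"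
    and T_closed: "a \<in> L \<Longrightarrow> v \<in> H \<Longrightarrow> T a v \<in> carrier V"
    and T_plus: "a \<in> L \<Longrightarrow> b \<in> L \<Longrightarrow> v \<in> H \<Longrightarrow> T (a \<oplus>\<^bsub>R\<^esub> b) v = T a v \<oplus>\<^bsub>V\<^esub> T b v"
    and T_smult: "a \<in> L \<Longrightarrow> c \<in> carrier F \<Longrightarrow> v \<in> H \<Longrightarrow> T a (c \<odot>\<^bsub>V\<^esub> v) = c \<odot>\<^bsub>V\<^esub> T a v"
    and T_form: "a \<in> L \<Longrightarrow> b \<in> L \<Longrightarrow> v \<in> H \<Longrightarrow> w \<in> H \<Longrightarrow>
      form V (T a v) (T b w) = form V v (T (star R a \<otimes>\<^bsub>R\<^esub> b) w)"
begin

text \<open>The list is a formal sum of products \<open>c v\<close>. \<open>comb xs r\<close> is the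
  result of applying \<open>r\<close> to it, so that \<open>comb xs 1\<close> is the vector which
  the list denotes.\<close>

definition comb :: "('r \<times> 'v) list \<Rightarrow> 'r \<Rightarrow> 'v" where
  "comb xs r = foldr (\<lambda>(c, v) y. T (r \<otimes>\<^bsub>R\<^esub> c) v \<oplus>\<^bsub>V\<^esub> y) xs \<zero>\<^bsub>V\<^esub>"

definition coeffs :: "('r \<times> 'v) list set" where
  "coeffs = lists (L \<times> H)"

lemma comb_simps [simp]:
  "comb [] r = \<zero>\<^bsub>V\<^esub>"
  "comb ((c, v) # xs) r = T (r \<otimes>\<^bsub>R\<^esub> c) v \<oplus>\<^bsub>V\<^esub> comb xs r"
  by (simp_all add: comb_def)

lemma coeffs_simps [simp]:
  "[] \<in> coeffs"
  "(c, v) # xs \<in> coeffs \<longleftrightarrow> c \<in> L \<and> v \<in> H \<and> xs \<in> coeffs"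
  "xs @ ys \<in> coeffs \<longleftrightarrow> xs \<in> coeffs \<and> ys \<in> coeffs"
  by (auto simp: coeffs_def)

lemma L_carrier: "a \<in> L \<Longrightarrow> a \<in> carrier R"
  using L_subset by blast

lemma comb_closed: "xs \<in> coeffs \<Longrightarrow> r \<in> carrier R \<Longrightarrow> comb xs r \<in> carrier V"
  by (induction xs) (auto simp: T_closed L_mult)

lemma comb_append:
  "xs \<in> coeffs \<Longrightarrow> ys \<in> coeffs \<Longrightarrow> r \<in> carrier R \<Longrightarrow> comb (xs @ ys) r = comb xs r \<oplus>\<^bsub>V\<^esub> comb ys r"
  by (induction xs) (auto simp: comb_closed T_closed L_mult V.a_assoc)

lemma comb_smult:
  "xs \<in> coeffs \<Longrightarrow> r \<in> carrier R \<Longrightarrow> a \<in> carrier F \<Longrightarrow>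
    comb (map (\<lambda>(c, v). (c, a \<odot>\<^bsub>V\<^esub> v)) xs) r = a \<odot>\<^bsub>V\<^esub> comb xs r"
  by (induction xs) (auto simp: comb_closed T_closed L_mult smult_r_distr T_smult smult_zero_right)

lemma coeffs_smult: "xs \<in> coeffs \<Longrightarrow> a \<in> carrier F \<Longrightarrow> map (\<lambda>(c, v). (c, a \<odot>\<^bsub>V\<^esub> v)) xs \<in> coeffs"
  by (induction xs) (auto simp: submodule_smult[OF H])

lemma comb_mult:
  "xs \<in> coeffs \<Longrightarrow> r \<in> carrier R \<Longrightarrow> s \<in> carrier R \<Longrightarrow>
    comb (map (\<lambda>(c, v). (s \<otimes>\<^bsub>R\<^esub> c, v)) xs) r = comb xs (r \<otimes>\<^bsub>R\<^esub> s)"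
  by (induction xs) (auto simp: R.m_assoc L_carrier)

lemma coeffs_mult: "xs \<in> coeffs \<Longrightarrow> s \<in> carrier R \<Longrightarrow> map (\<lambda>(c, v). (s \<otimes>\<^bsub>R\<^esub> c, v)) xs \<in> coeffs"
  by (induction xs) (auto simp: L_mult)

lemma comb_plus:
  "xs \<in> coeffs \<Longrightarrow> r \<in> carrier R \<Longrightarrow> s \<in> carrier R \<Longrightarrow>
    comb xs (r \<oplus>\<^bsub>R\<^esub> s) = comb xs r \<oplus>\<^bsub>V\<^esub> comb xs s"
  by (induction xs) (auto simp: comb_closed T_closed L_mult L_carrier R.l_distr T_plus V.a_ac)

text \<open>For each pair \<open>(d, w)\<close> of \<open>ys\<close>, \<open>T_form\<close> turns
  both sides into \<open>form V v (T x w)\<close> with the same \<open>x\<close>, the product of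
  \<open>star R c\<close>, \<open>star R r\<close>, \<open>s\<close> and \<open>d\<close>.\<close>

lemma form_T_comb:
  assumes "ys \<in> coeffs" "r \<in> carrier R" "s \<in> carrier R" "c \<in> L" "v \<in> H"
  shows "form V (T (r \<otimes>\<^bsub>R\<^esub> c) v) (comb ys s) = form V (T c v) (comb ys (star R r \<otimes>\<^bsub>R\<^esub> s))"
  using assms(1)
proof (induction ys)
  case Nil
  then show ?case using assms by (simp add: form_zero_right T_closed L_mult)
next
  case (Cons y ys)
  obtain d w where y: "y = (d, w)" by (cases y)
  with Cons.prems have d: "d \<in> L" "w \<in> H" "ys \<in> coeffs" by auto
  have "form V (T (r \<otimes>\<^bsub>R\<^esub> c) v) (T (s \<otimes>\<^bsub>R\<^esub> d) w) =
      form V v (T (star R c \<otimes>\<^bsub>R\<^esub> (star R r \<otimes>\<^bsub>R\<^esub> s \<otimes>\<^bsub>R\<^esub> d)) w)"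
    using assms d by (simp add: T_form L_mult L_carrier R.star_mult R.star_closed R.m_assoc)
  also have "\<dots> = form V (T c v) (T (star R r \<otimes>\<^bsub>R\<^esub> s \<otimes>\<^bsub>R\<^esub> d) w)"
    using assms d by (simp add: T_form L_mult R.star_closed)
  finally show ?case
    using Cons.IH[OF d(3)] assms d
    by (simp add: y form_add_right T_closed L_mult comb_closed R.star_closed)
qed

lemma form_comb:
  assumes "xs \<in> coeffs" "ys \<in> coeffs" "r \<in> carrier R"
  shows "form V (comb xs r) (comb ys \<one>\<^bsub>R\<^esub>) = form V (comb xs \<one>\<^bsub>R\<^esub>) (comb ys (star R r))"
  using assms(1)
proof (induction xs)
  case Nil
  then show ?case using assms by (simp add: form_zero_left comb_closed R.star_closed)
next
  case (Cons x xs)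
  obtain c v where x: "x = (c, v)" by (cases x)
  with Cons.prems have "c \<in> L" "v \<in> H" "xs \<in> coeffs" by auto
  then show ?case
    using Cons.IH assms form_T_comb[of ys r "\<one>\<^bsub>R\<^esub>" c v]
    by (simp add: x form_add_left T_closed L_mult comb_closed R.star_closed L_carrier)
qed

definition span :: "'v set" where
  "span = (\<lambda>xs. comb xs \<one>\<^bsub>R\<^esub>) ` coeffs"

lemma spanI: "xs \<in> coeffs \<Longrightarrow> comb xs \<one>\<^bsub>R\<^esub> \<in> span"
  by (simp add: span_def)

lemma comb_in_span:
  assumes "xs \<in> coeffs" "r \<in> carrier R"
  shows "comb xs r \<in> span"
  using spanI[OF coeffs_mult[OF assms]] assms by (simp add: comb_mult)

lemma submodule_span: "submodule span F V"
proof (rule submoduleI)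
  show "\<zero>\<^bsub>V\<^esub> \<in> span" using spanI[of "[]"] by simp
next
  fix v w assume "v \<in> span" "w \<in> span"
  then obtain xs ys where "xs \<in> coeffs" "ys \<in> coeffs" "v = comb xs \<one>\<^bsub>R\<^esub>" "w = comb ys \<one>\<^bsub>R\<^esub>"
    by (auto simp: span_def)
  then show "v \<oplus>\<^bsub>V\<^esub> w \<in> span" using spanI[of "xs @ ys"] by (simp add: comb_append)
next
  fix a v assume "a \<in> carrier F" "v \<in> span"
  then obtain xs where "xs \<in> coeffs" "v = comb xs \<one>\<^bsub>R\<^esub>" by (auto simp: span_def)
  then show "a \<odot>\<^bsub>V\<^esub> v \<in> span"
    using spanI[OF coeffs_smult[of xs a]] \<open>a \<in> carrier F\<close> by (simp add: comb_smult)
qed (auto simp: span_def comb_closed)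

text \<open>By \<open>form_comb\<close>, the form of \<open>comb xs r\<close> with a vector of the
  span is the form of \<open>comb xs 1\<close> with another vector. So it depends only on the vector
  denoted by \<open>xs\<close>, and anisotropy makes the action of \<open>r\<close> well
  defined.\<close>

lemma comb_cong:
  assumes "xs \<in> coeffs" "ys \<in> coeffs" "r \<in> carrier R" "comb xs \<one>\<^bsub>R\<^esub> = comb ys \<one>\<^bsub>R\<^esub>"
  shows "comb xs r = comb ys r"
proof (rule form_eqI[OF submodule_span])
  fix w assume "w \<in> span"
  then obtain zs where "zs \<in> coeffs" "w = comb zs \<one>\<^bsub>R\<^esub>" by (auto simp: span_def)
  then show "form V (comb xs r) w = form V (comb ys r) w"
    using assms by (simp add: form_comb)
qed (use assms comb_in_span in auto)

text \<open>The choice of the list is immaterial by \<open>comb_cong\<close>.\<close>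

definition act :: "'r \<Rightarrow> 'v \<Rightarrow> 'v" where
  "act r x = comb (SOME xs. xs \<in> coeffs \<and> comb xs \<one>\<^bsub>R\<^esub> = x) r"

lemma act_comb:
  assumes "xs \<in> coeffs" "r \<in> carrier R"
  shows "act r (comb xs \<one>\<^bsub>R\<^esub>) = comb xs r"
proof -
  define ys where "ys = (SOME ys. ys \<in> coeffs \<and> comb ys \<one>\<^bsub>R\<^esub> = comb xs \<one>\<^bsub>R\<^esub>)"
  have "ys \<in> coeffs \<and> comb ys \<one>\<^bsub>R\<^esub> = comb xs \<one>\<^bsub>R\<^esub>"
    unfolding ys_def by (rule someI[of _ xs]) (use assms in simp)
  then have "comb ys r = comb xs r" using assms comb_cong by blast
  then show ?thesis unfolding act_def ys_def .
qed

lemma act_mult_comb: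
  assumes "xs \<in> coeffs" "r \<in> carrier R" "s \<in> carrier R"
  shows "act r (comb xs s) = comb xs (r \<otimes>\<^bsub>R\<^esub> s)"
  using act_comb[OF coeffs_mult[of xs s], of r] assms by (simp add: comb_mult)

lemma ultrapower_star_representation_if_faithful:
  assumes faithful: "\<And>r. r \<in> carrier R \<Longrightarrow> r \<noteq> \<zero>\<^bsub>R\<^esub> \<Longrightarrow> \<exists>c\<in>L. \<exists>v\<in>H. T (r \<otimes>\<^bsub>R\<^esub> c) v \<noteq> \<zero>\<^bsub>V\<^esub>"
  shows "\<exists>(\<U> :: ('r, 'f, 'v) ultra_index filter) U \<rho>. ultrafilter \<U> \<and>
    closed_subspace (ultrapower_scalars \<U> F) (ultrapower_vectors \<U> F V) U \<and>
    star_ring_representation R (ultrapower_scalars \<U> F)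
      ((ultrapower_vectors \<U> F V)\<lparr>carrier := U\<rparr>) \<rho>"
proof (rule ultrapower_star_representation[OF R.star_ring_axioms submodule_span, where A = act])
  fix r v w assume r: "r \<in> carrier R" and "v \<in> span" "w \<in> span"
  then obtain xs ys where xs: "xs \<in> coeffs" "v = comb xs \<one>\<^bsub>R\<^esub>" and ys: "ys \<in> coeffs" "w = comb ys \<one>\<^bsub>R\<^esub>"
    by (auto simp: span_def)
  show "act r (v \<oplus>\<^bsub>V\<^esub> w) = act r v \<oplus>\<^bsub>V\<^esub> act r w"
    using act_comb[of "xs @ ys" r] r xs ys by (simp add: comb_append act_comb)
  show "form V (act r v) w = form V v (act (star R r) w)"
    using r xs ys by (simp add: act_comb R.star_closed form_comb)
next
  fix r a v assume r: "r \<in> carrier R" and a: "a \<in> carrier F" and "v \<in> span"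
  then obtain xs where xs: "xs \<in> coeffs" "v = comb xs \<one>\<^bsub>R\<^esub>" by (auto simp: span_def)
  then show "act r (a \<odot>\<^bsub>V\<^esub> v) = a \<odot>\<^bsub>V\<^esub> act r v"
    using act_comb[OF coeffs_smult[OF xs(1) a] r] r a by (simp add: comb_smult act_comb)
next
  fix r assume "r \<in> carrier R" "r \<noteq> \<zero>\<^bsub>R\<^esub>"
  then obtain c v where cv: "c \<in> L" "v \<in> H" "T (r \<otimes>\<^bsub>R\<^esub> c) v \<noteq> \<zero>\<^bsub>V\<^esub>" using faithful by blast
  then show "\<exists>w\<in>span. act r w \<noteq> \<zero>\<^bsub>V\<^esub>"
    using act_comb[of "[(c, v)]" r] spanI[of "[(c, v)]"] \<open>r \<in> carrier R\<close>
    by (intro bexI[of _ "comb [(c, v)] \<one>\<^bsub>R\<^esub>"]) (auto simp: T_closed L_mult)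
qed (auto simp: span_def act_comb act_mult_comb comb_plus comb_in_span[unfolded span_def])

end

section \<open>Graphs of off-diagonal elements\<close>

context star_ring
begin

text \<open>For idempotents this is the Peirce component \<open>f R e\<close>, target first: left
  multiplication by its elements maps \<open>eR\<close> to \<open>fR\<close>.\<close>

definition corner :: "'a \<Rightarrow> 'a \<Rightarrow> 'a set" where
  "corner f e = {a \<in> carrier R. f \<otimes> a = a \<and> a \<otimes> e = a}"

definition orth :: "'a \<Rightarrow> 'a \<Rightarrow> bool" where
  "orth e f \<longleftrightarrow> projection R e \<and> projection R f \<and> e \<otimes> f = \<zero>"

lemma projection_carrier: "projection R e \<Longrightarrow> e \<in> carrier R"
  by (simp add: projection_def)

lemma orth_sym: "orth e f \<Longrightarrow> orth f e"
  using star_mult[of e f] star_zero by (auto simp: orth_def projection_def)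

lemma orthD:
  assumes "orth e f"
  shows "projection R e" "projection R f" "e \<in> carrier R" "f \<in> carrier R" "e \<otimes> f = \<zero>" "f \<otimes> e = \<zero>"
  using assms orth_sym[OF assms] by (auto simp: orth_def projection_def)

lemma orth_plus:
  assumes "orth f g"
  shows "projection R (f \<oplus> g)"
  using orthD[OF assms] by (simp add: projection_def l_distr r_distr star_add)

lemma orth_plus_right:
  assumes "orth e f" "orth e g" "orth f g"
  shows "orth e (f \<oplus> g)"
  using orthD[OF assms(1)] orthD[OF assms(2)] orth_plus[OF assms(3)] by (simp add: orth_def r_distr)

lemma cornerD:
  assumes "a \<in> corner f e"
  shows "a \<in> carrier R" "f \<otimes> a = a" "a \<otimes> e = a"
  using assms by (auto simp: corner_def)

lemma corner_self: "projection R e \<Longrightarrow> e \<in> corner e e"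
  by (simp add: corner_def projection_def)

lemma corner_zero: "e \<in> carrier R \<Longrightarrow> f \<in> carrier R \<Longrightarrow> \<zero> \<in> corner f e"
  by (simp add: corner_def)

lemma corner_add: "a \<in> corner f e \<Longrightarrow> b \<in> corner f e \<Longrightarrow> e \<in> carrier R \<Longrightarrow> f \<in> carrier R \<Longrightarrow> a \<oplus> b \<in> corner f e"
  by (simp add: corner_def l_distr r_distr)

lemma corner_minus: "a \<in> corner f e \<Longrightarrow> e \<in> carrier R \<Longrightarrow> f \<in> carrier R \<Longrightarrow> \<ominus> a \<in> corner f e"
  by (simp add: corner_def l_minus r_minus)

lemma corner_mult:
  assumes "a \<in> corner f g" "b \<in> corner g e" "e \<in> carrier R" "f \<in> carrier R"
  shows "a \<otimes> b \<in> corner f e"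
  using cornerD[OF assms(1)] cornerD[OF assms(2)] assms(3,4)
  by (simp add: corner_def m_assoc m_assoc[symmetric, of f a b])

lemma corner_star: "a \<in> corner f e \<Longrightarrow> projection R e \<Longrightarrow> projection R f \<Longrightarrow> star R a \<in> corner e f"
  by (auto simp: corner_def projection_def star_closed) (metis star_mult)+

lemma corner_orth_mult:
  assumes "a \<in> corner f e" "b \<in> corner g h" "orth e g"
  shows "a \<otimes> b = \<zero>"
proof -
  note a = cornerD[OF assms(1)] and b = cornerD[OF assms(2)] and eg = orthD[OF assms(3)]
  have "a \<otimes> b = (a \<otimes> e) \<otimes> (g \<otimes> b)" using a b by simp
  also have "\<dots> = a \<otimes> (e \<otimes> g) \<otimes> b" by (simp add: m_assoc a(1) b(1) eg(3,4))
  finally show ?thesis using a b eg by simp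
qed

end

text \<open>\<open>N x\<close> is the subspace assigned to \<open>xR\<close>. The equation in
  \<open>N_orth\<close> says that \<open>yR\<close> lies in the orthocomplement of
  \<open>xR\<close>; \<open>N_join\<close> says that joins become sums, and with
  \<open>y = x\<close> it also gives monotonicity.\<close>

locale lattice_action = inner_product_space F V + R: star_ring R
  for F :: "('f, 'm) star_ring_scheme" (structure)
    and V :: "('f, 'v, 'n) inner_product_space_scheme" (structure)
    and R :: "('r, 'k) star_ring_scheme" +
  fixes N :: "'r \<Rightarrow> 'v set"
  assumes N_submodule: "x \<in> carrier R \<Longrightarrow> submodule (N x) F V"
    and N_orth: "x \<in> carrier R \<Longrightarrow> y \<in> carrier R \<Longrightarrow> star R x \<otimes>\<^bsub>R\<^esub> y = \<zero>\<^bsub>R\<^esub> \<Longrightarrow>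
      v \<in> N x \<Longrightarrow> w \<in> N y \<Longrightarrow> form V v w = \<zero>"
    and N_join: "x \<in> carrier R \<Longrightarrow> y \<in> carrier R \<Longrightarrow> r \<in> carrier R \<Longrightarrow> s \<in> carrier R \<Longrightarrow>
      v \<in> N (x \<otimes>\<^bsub>R\<^esub> r \<oplus>\<^bsub>R\<^esub> y \<otimes>\<^bsub>R\<^esub> s) \<Longrightarrow> \<exists>v1\<in>N x. \<exists>v2\<in>N y. v = v1 \<oplus>\<^bsub>V\<^esub> v2"
    and N_inj: "x \<in> carrier R \<Longrightarrow> N x \<subseteq> {\<zero>\<^bsub>V\<^esub>} \<Longrightarrow> x = \<zero>\<^bsub>R\<^esub>"
begin

abbreviation "corner \<equiv> R.corner"
abbreviation "orth \<equiv> R.orth"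

lemma N_carrier: "x \<in> carrier R \<Longrightarrow> v \<in> N x \<Longrightarrow> v \<in> carrier V"
  using N_submodule submodule_carrier by blast

lemma N_orth_projections: "orth e f \<Longrightarrow> v \<in> N e \<Longrightarrow> w \<in> N f \<Longrightarrow> form V v w = \<zero>"
  using N_orth[of e f v w] R.orthD[of e f] by (simp add: projection_def)

text \<open>\<open>N (e + a)\<close> is the graph of a map from \<open>N e\<close> to
  \<open>N f\<close>, and this is its value at \<open>v\<close>. The value is chosen here; its
  uniqueness follows from \<open>form_graph\<close>.\<close>

definition rho :: "'r \<Rightarrow> 'r \<Rightarrow> 'r \<Rightarrow> 'v \<Rightarrow> 'v" where
  "rho f e a v = (SOME w. w \<in> N f \<and> v \<oplus>\<^bsub>V\<^esub> w \<in> N (e \<oplus>\<^bsub>R\<^esub> a))"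

text \<open>Since \<open>e = (e + a) - f a\<close>, a vector of \<open>N e\<close> is a sum of
  vectors of \<open>N (e + a)\<close> and \<open>N f\<close>; moving the second to the other side
  gives a point of the graph.\<close>

lemma graph_exists:
  assumes ef: "orth e f" and a: "a \<in> corner f e" and v: "v \<in> N e"
  shows "\<exists>w. w \<in> N f \<and> v \<oplus>\<^bsub>V\<^esub> w \<in> N (e \<oplus>\<^bsub>R\<^esub> a)"
proof -
  note ef' = R.orthD[OF ef] and a' = R.cornerD[OF a]
  have "(e \<oplus>\<^bsub>R\<^esub> a) \<otimes>\<^bsub>R\<^esub> \<one>\<^bsub>R\<^esub> \<oplus>\<^bsub>R\<^esub> f \<otimes>\<^bsub>R\<^esub> (\<ominus>\<^bsub>R\<^esub> a) = e"
    using ef' a' by (simp add: R.r_minus R.a_assoc R.r_neg)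
  then obtain x y where xy: "x \<in> N (e \<oplus>\<^bsub>R\<^esub> a)" "y \<in> N f" "v = x \<oplus>\<^bsub>V\<^esub> y"
    using N_join[of "e \<oplus>\<^bsub>R\<^esub> a" f "\<one>\<^bsub>R\<^esub>" "\<ominus>\<^bsub>R\<^esub> a" v] v ef' a' by auto
  have c: "x \<in> carrier V" "y \<in> carrier V" using N_carrier[OF _ xy(1)] N_carrier[OF _ xy(2)] ef' a' by auto
  then have "v \<oplus>\<^bsub>V\<^esub> \<ominus>\<^bsub>V\<^esub> y = x" using xy by (simp add: V.a_assoc V.r_neg)
  then show ?thesis using xy submodule_minus[OF N_submodule[OF ef'(4)]] by (intro exI[of _ "\<ominus>\<^bsub>V\<^esub> y"]) simp
qed

lemma rho:
  assumes "orth e f" "a \<in> corner f e" "v \<in> N e"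
  shows "rho f e a v \<in> N f" "v \<oplus>\<^bsub>V\<^esub> rho f e a v \<in> N (e \<oplus>\<^bsub>R\<^esub> a)"
  using someI_ex[OF graph_exists[OF assms]] unfolding rho_def by auto

lemma rho_carrier:
  assumes "orth e f" "a \<in> corner f e" "v \<in> N e"
  shows "rho f e a v \<in> carrier V"
  using rho(1)[OF assms] N_carrier R.orthD[OF assms(1)] by blast

lemma corner_minus_star: "orth e f \<Longrightarrow> a \<in> corner f e \<Longrightarrow> \<ominus>\<^bsub>R\<^esub> star R a \<in> corner e f"
  using R.orthD by (intro R.corner_minus R.corner_star) auto

text \<open>\<open>star R (e + a)\<close> times \<open>f - star R a\<close> is
  \<open>- star R a + star R a = 0\<close>, so graph points of \<open>a\<close> and of
  \<open>- star R a\<close> are orthogonal, and the terms pairing \<open>N e\<close> with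
  \<open>N f\<close> vanish. The graph point over \<open>v\<close> is kept arbitrary so that the
  identity decides uniqueness.\<close>

lemma form_graph:
  assumes ef: "orth e f" and a: "a \<in> corner f e" and v: "v \<in> N e" and x: "x \<in> N f" and w: "w \<in> N f"
    and graph: "v \<oplus>\<^bsub>V\<^esub> x \<in> N (e \<oplus>\<^bsub>R\<^esub> a)"
  shows "form V x w = \<ominus> form V v (rho e f (\<ominus>\<^bsub>R\<^esub> star R a) w)"
proof -
  note ef' = R.orthD[OF ef] and fe = R.orth_sym[OF ef] and a' = R.cornerD[OF a]
  note b = corner_minus_star[OF ef a]
  have sa: "star R a \<in> corner e f" using R.corner_star[OF a] ef' by blast
  note sa' = R.cornerD[OF sa] and b' = R.cornerD[OF b]
  note r = rho[OF fe b w]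
  have c: "v \<in> carrier V" "x \<in> carrier V" "w \<in> carrier V" "rho e f (\<ominus>\<^bsub>R\<^esub> star R a) w \<in> carrier V"
    using N_carrier v x w r ef' by auto
  have "star R (e \<oplus>\<^bsub>R\<^esub> a) \<otimes>\<^bsub>R\<^esub> (f \<oplus>\<^bsub>R\<^esub> \<ominus>\<^bsub>R\<^esub> star R a) = \<zero>\<^bsub>R\<^esub>"
    using ef' a' sa' R.corner_orth_mult[OF sa sa fe]
    by (simp add: R.star_add R.l_distr R.r_distr R.r_minus R.star_closed projection_def R.l_neg R.r_neg)
  then have "form V (v \<oplus>\<^bsub>V\<^esub> x) (w \<oplus>\<^bsub>V\<^esub> rho e f (\<ominus>\<^bsub>R\<^esub> star R a) w) = \<zero>"
    using N_orth[OF _ _ _ graph r(2)] ef' a' b' by simp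
  moreover have "form V v w = \<zero>" using N_orth_projections ef v w by blast
  moreover have "form V x (rho e f (\<ominus>\<^bsub>R\<^esub> star R a) w) = \<zero>" using N_orth_projections[OF fe] x r by blast
  ultimately have "form V v (rho e f (\<ominus>\<^bsub>R\<^esub> star R a) w) \<oplus> form V x w = \<zero>"
    using c by (simp add: form_add_left form_add_right form_closed F.a_comm)
  then show ?thesis using c by (metis F.a_comm F.minus_equality form_closed)
qed

lemma form_rho:
  assumes "orth e f" "a \<in> corner f e" "v \<in> N e" "w \<in> N f"
  shows "form V (rho f e a v) w = \<ominus> form V v (rho e f (\<ominus>\<^bsub>R\<^esub> star R a) w)"
  using form_graph assms rho[OF assms(1-3)] by blast

lemma N_eqI:
  assumes "e \<in> carrier R" "x \<in> N e" "y \<in> N e" "\<And>w. w \<in> N e \<Longrightarrow> form V x w = form V y w"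
  shows "x = y"
  using form_eqI[OF N_submodule[OF assms(1)]] assms by blast

text \<open>By \<open>form_graph\<close> the form values of a graph point with \<open>N f\<close>
  depend on \<open>v\<close> alone, and \<open>N f\<close> separates its own vectors.\<close>

lemma rho_unique:
  assumes "orth e f" "a \<in> corner f e" "v \<in> N e" "x \<in> N f" "v \<oplus>\<^bsub>V\<^esub> x \<in> N (e \<oplus>\<^bsub>R\<^esub> a)"
  shows "x = rho f e a v"
  by (rule N_eqI[OF R.orthD(4)[OF assms(1)] assms(4) rho(1)[OF assms(1-3)]])
    (simp add: form_graph[OF assms(1-4) _ assms(5)] form_rho[OF assms(1-3)])

lemma rho_smult:
  assumes ef: "orth e f" and a: "a \<in> corner f e" and v: "v \<in> N e" and k: "k \<in> carrier F"
  shows "rho f e a (k \<odot>\<^bsub>V\<^esub> v) = k \<odot>\<^bsub>V\<^esub> rho f e a v"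
proof (rule N_eqI[of f])
  note ef' = R.orthD[OF ef]
  have kv: "k \<odot>\<^bsub>V\<^esub> v \<in> N e" by (intro submodule_smult[OF N_submodule] ef' v k)
  show "f \<in> carrier R" by (rule ef')
  show "rho f e a (k \<odot>\<^bsub>V\<^esub> v) \<in> N f" by (rule rho(1)[OF ef a kv])
  show "k \<odot>\<^bsub>V\<^esub> rho f e a v \<in> N f"
    by (intro submodule_smult[OF N_submodule] ef' rho(1)[OF ef a] v k)
  fix x assume x: "x \<in> N f"
  have c: "v \<in> carrier V" "x \<in> carrier V" "rho e f (\<ominus>\<^bsub>R\<^esub> star R a) x \<in> carrier V"
    using N_carrier v x ef' rho_carrier[OF R.orth_sym[OF ef] corner_minus_star[OF ef a]] by auto
  show "form V (rho f e a (k \<odot>\<^bsub>V\<^esub> v)) x = form V (k \<odot>\<^bsub>V\<^esub> rho f e a v) x"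
    using c rho_carrier[OF ef a] v k
    by (simp add: form_smult_left form_rho[OF ef a _ x] kv form_closed F.r_minus)
qed

lemma rho_zero:
  assumes ef: "orth e f" and v: "v \<in> N e"
  shows "rho f e \<zero>\<^bsub>R\<^esub> v = \<zero>\<^bsub>V\<^esub>"
proof -
  note ef' = R.orthD[OF ef]
  have "v \<oplus>\<^bsub>V\<^esub> \<zero>\<^bsub>V\<^esub> \<in> N (e \<oplus>\<^bsub>R\<^esub> \<zero>\<^bsub>R\<^esub>)" using v ef' N_carrier by simp
  then show ?thesis
    using rho_unique[OF ef R.corner_zero v] ef' submodule_zero[OF N_submodule] by metis
qed

text \<open>\<open>e + a + d\<close> is orthogonal to \<open>f - star R a\<close>, and vectors of
  \<open>N g\<close> are orthogonal to those of \<open>N e\<close> and \<open>N f\<close>. So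
  \<open>y\<close> drops out, and \<open>x\<close> has the form values of the graph point of
  \<open>a\<close> alone.\<close>

lemma rho_join:
  assumes ef: "orth e f" and eg: "orth e g" and fg: "orth f g"
    and a: "a \<in> corner f e" and d: "d \<in> corner g e" and v: "v \<in> N e"
    and x: "x \<in> N f" and y: "y \<in> N g"
    and graph: "v \<oplus>\<^bsub>V\<^esub> (x \<oplus>\<^bsub>V\<^esub> y) \<in> N (e \<oplus>\<^bsub>R\<^esub> (a \<oplus>\<^bsub>R\<^esub> d))"
  shows "x = rho f e a v"
proof (rule N_eqI[of f])
  note ef' = R.orthD[OF ef] and eg' = R.orthD[OF eg] and fg' = R.orthD[OF fg]
  note fe = R.orth_sym[OF ef] and ge = R.orth_sym[OF eg] and gf = R.orth_sym[OF fg]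
  have sa: "star R a \<in> corner e f" using R.corner_star[OF a] ef' by blast
  have sd: "star R d \<in> corner e g" using R.corner_star[OF d] eg' by blast
  note a' = R.cornerD[OF a] and d' = R.cornerD[OF d] and sa' = R.cornerD[OF sa] and sd' = R.cornerD[OF sd]
  note b = corner_minus_star[OF ef a]
  show "f \<in> carrier R" "x \<in> N f" by fact+
  show "rho f e a v \<in> N f" by (rule rho[OF ef a v])
  fix w assume w: "w \<in> N f"
  note r = rho[OF fe b w]
  have c: "v \<in> carrier V" "x \<in> carrier V" "y \<in> carrier V" "w \<in> carrier V"
    "rho e f (\<ominus>\<^bsub>R\<^esub> star R a) w \<in> carrier V"
    using N_carrier v x y w r ef' eg' by auto
  have "star R d \<otimes>\<^bsub>R\<^esub> f = \<zero>\<^bsub>R\<^esub>" by (rule R.corner_orth_mult[OF sd R.corner_self[OF ef'(2)] gf])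
  then have "star R (e \<oplus>\<^bsub>R\<^esub> (a \<oplus>\<^bsub>R\<^esub> d)) \<otimes>\<^bsub>R\<^esub> (f \<oplus>\<^bsub>R\<^esub> \<ominus>\<^bsub>R\<^esub> star R a) = \<zero>\<^bsub>R\<^esub>"
    using ef' a' d' sa' sd' R.corner_orth_mult[OF sa sa fe] R.corner_orth_mult[OF sd sa ge]
    by (simp add: R.star_add R.l_distr R.r_distr R.r_minus R.star_closed projection_def R.l_neg R.r_neg)
  then have "form V (v \<oplus>\<^bsub>V\<^esub> (x \<oplus>\<^bsub>V\<^esub> y)) (w \<oplus>\<^bsub>V\<^esub> rho e f (\<ominus>\<^bsub>R\<^esub> star R a) w) = \<zero>"
    using N_orth[OF _ _ _ graph r(2)] ef' a' d' sa' by simp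
  moreover have "form V v w = \<zero>" "form V y w = \<zero>"
    "form V x (rho e f (\<ominus>\<^bsub>R\<^esub> star R a) w) = \<zero>" "form V y (rho e f (\<ominus>\<^bsub>R\<^esub> star R a) w) = \<zero>"
    using N_orth_projections ef fe ge gf v w x y r by blast+
  ultimately have "form V v (rho e f (\<ominus>\<^bsub>R\<^esub> star R a) w) \<oplus> form V x w = \<zero>"
    using c by (simp add: form_add_left form_add_right form_closed F.a_comm)
  then show "form V x w = form V (rho f e a v) w"
    using c form_rho[OF ef a v w] by (metis F.a_comm F.minus_equality form_closed)
qed

text \<open>As a single element of the corner of \<open>f + g\<close> and \<open>e\<close>,
  \<open>a + d\<close> has a graph point over \<open>v\<close>; \<open>rho_join\<close> identifies
  its components in \<open>N f\<close> and \<open>N g\<close>.\<close>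

lemma graph_plus:
  assumes ef: "orth e f" and eg: "orth e g" and fg: "orth f g"
    and a: "a \<in> corner f e" and d: "d \<in> corner g e" and v: "v \<in> N e"
  shows "v \<oplus>\<^bsub>V\<^esub> (rho f e a v \<oplus>\<^bsub>V\<^esub> rho g e d v) \<in> N (e \<oplus>\<^bsub>R\<^esub> (a \<oplus>\<^bsub>R\<^esub> d))"
proof -
  note ef' = R.orthD[OF ef] and eg' = R.orthD[OF eg] and fg' = R.orthD[OF fg]
  note gf = R.orth_sym[OF fg]
  note a' = R.cornerD[OF a] and d' = R.cornerD[OF d]
  have "f \<otimes>\<^bsub>R\<^esub> d = \<zero>\<^bsub>R\<^esub>" "g \<otimes>\<^bsub>R\<^esub> a = \<zero>\<^bsub>R\<^esub>"
    using R.corner_orth_mult[OF R.corner_self d fg] R.corner_orth_mult[OF R.corner_self a gf] fg' by auto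
  then have "a \<oplus>\<^bsub>R\<^esub> d \<in> corner (f \<oplus>\<^bsub>R\<^esub> g) e"
    using a' d' ef' eg' by (simp add: R.corner_def R.l_distr R.r_distr)
  then obtain s where s: "s \<in> N (f \<oplus>\<^bsub>R\<^esub> g)" "v \<oplus>\<^bsub>V\<^esub> s \<in> N (e \<oplus>\<^bsub>R\<^esub> (a \<oplus>\<^bsub>R\<^esub> d))"
    using graph_exists[OF R.orth_plus_right[OF ef eg fg] _ v] by blast
  then obtain x y where xy: "x \<in> N f" "y \<in> N g" "s = x \<oplus>\<^bsub>V\<^esub> y"
    using N_join[of f g "\<one>\<^bsub>R\<^esub>" "\<one>\<^bsub>R\<^esub>" s] fg' by auto
  have "x = rho f e a v"
    using rho_join[OF ef eg fg a d v xy(1,2)] s xy by simp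
  moreover have "y = rho g e d v"
    using rho_join[OF eg ef gf d a v xy(2,1)] s xy N_carrier fg' a' d' by (simp add: V.a_comm R.a_comm)
  ultimately show ?thesis using s xy by simp
qed

text \<open>
  Tested against \<open>w \<in> N f\<close>, this is the orthogonality of \<open>e + a + d\<close> and \<open>f + c\<^sup>* - (a + cd)\<^sup>*\<close>.
\<close>

lemma rho_plus_mult:
  assumes ef: "orth e f" and eg: "orth e g" and fg: "orth f g"
    and a: "a \<in> corner f e" and d: "d \<in> corner g e" and c: "c \<in> corner f g" and v: "v \<in> N e"
  shows "rho f e (a \<oplus>\<^bsub>R\<^esub> c \<otimes>\<^bsub>R\<^esub> d) v = rho f e a v \<oplus>\<^bsub>V\<^esub> \<ominus>\<^bsub>V\<^esub> rho f g (\<ominus>\<^bsub>R\<^esub> c) (rho g e d v)"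
proof (rule N_eqI[of f])
  note ef' = R.orthD[OF ef] and eg' = R.orthD[OF eg] and fg' = R.orthD[OF fg]
  note fe = R.orth_sym[OF ef] and ge = R.orth_sym[OF eg] and gf = R.orth_sym[OF fg]
  have cd: "c \<otimes>\<^bsub>R\<^esub> d \<in> corner f e" using R.corner_mult[OF c d] ef' by blast
  have b: "a \<oplus>\<^bsub>R\<^esub> c \<otimes>\<^bsub>R\<^esub> d \<in> corner f e" using R.corner_add[OF a cd] ef' by blast
  have mc: "\<ominus>\<^bsub>R\<^esub> c \<in> corner f g" using R.corner_minus[OF c] fg' by blast
  have sa: "star R a \<in> corner e f" using R.corner_star[OF a] ef' by blast
  have sd: "star R d \<in> corner e g" using R.corner_star[OF d] eg' by blast
  have scc: "star R c \<in> corner g f" using R.corner_star[OF c] fg' by blast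
  have sb: "star R (a \<oplus>\<^bsub>R\<^esub> c \<otimes>\<^bsub>R\<^esub> d) \<in> corner e f" using R.corner_star[OF b] ef' by blast
  have msb: "\<ominus>\<^bsub>R\<^esub> star R (a \<oplus>\<^bsub>R\<^esub> c \<otimes>\<^bsub>R\<^esub> d) \<in> corner e f" by (rule corner_minus_star[OF ef b])
  note a' = R.cornerD[OF a] and d' = R.cornerD[OF d] and c' = R.cornerD[OF c]
    and sa' = R.cornerD[OF sa] and sd' = R.cornerD[OF sd] and scc' = R.cornerD[OF scc]
    and b' = R.cornerD[OF b] and sb' = R.cornerD[OF sb]
  let ?u = "rho g e d v"
  have u: "?u \<in> N g" by (rule rho[OF eg d v])
  show "f \<in> carrier R" by (rule ef')
  show "rho f e (a \<oplus>\<^bsub>R\<^esub> c \<otimes>\<^bsub>R\<^esub> d) v \<in> N f" by (rule rho[OF ef b v])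
  show "rho f e a v \<oplus>\<^bsub>V\<^esub> \<ominus>\<^bsub>V\<^esub> rho f g (\<ominus>\<^bsub>R\<^esub> c) ?u \<in> N f"
    by (intro submodule_add[OF N_submodule] submodule_minus[OF N_submodule] rho(1)[OF ef a v] rho(1)[OF gf mc u] ef')
  fix w assume w: "w \<in> N f"
  let ?p = "rho g f (star R c) w" and ?q = "rho e f (\<ominus>\<^bsub>R\<^esub> star R (a \<oplus>\<^bsub>R\<^esub> c \<otimes>\<^bsub>R\<^esub> d)) w"
  have p: "?p \<in> N g" and q: "?q \<in> N e" using rho(1)[OF fg scc w] rho(1)[OF fe msb w] by auto
  have ra: "rho f e a v \<in> N f" and rc: "rho f g (\<ominus>\<^bsub>R\<^esub> c) ?u \<in> N f"
    using rho(1)[OF ef a v] rho(1)[OF gf mc u] by auto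
  have cV: "v \<in> carrier V" "w \<in> carrier V" "?u \<in> carrier V" "?p \<in> carrier V" "?q \<in> carrier V"
    "rho f e a v \<in> carrier V" "rho f g (\<ominus>\<^bsub>R\<^esub> c) ?u \<in> carrier V"
    using N_carrier v w u p q ra rc ef' eg' by auto
  have x: "v \<oplus>\<^bsub>V\<^esub> (rho f e a v \<oplus>\<^bsub>V\<^esub> ?u) \<in> N (e \<oplus>\<^bsub>R\<^esub> (a \<oplus>\<^bsub>R\<^esub> d))"
    by (rule graph_plus[OF ef eg fg a d v])
  have y: "w \<oplus>\<^bsub>V\<^esub> (?p \<oplus>\<^bsub>V\<^esub> ?q) \<in> N (f \<oplus>\<^bsub>R\<^esub> (star R c \<oplus>\<^bsub>R\<^esub> \<ominus>\<^bsub>R\<^esub> star R (a \<oplus>\<^bsub>R\<^esub> c \<otimes>\<^bsub>R\<^esub> d)))"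
    by (rule graph_plus[OF fg fe ge scc msb w])
  have "star R (e \<oplus>\<^bsub>R\<^esub> (a \<oplus>\<^bsub>R\<^esub> d)) \<otimes>\<^bsub>R\<^esub> (f \<oplus>\<^bsub>R\<^esub> (star R c \<oplus>\<^bsub>R\<^esub> \<ominus>\<^bsub>R\<^esub> star R (a \<oplus>\<^bsub>R\<^esub> c \<otimes>\<^bsub>R\<^esub> d))) = \<zero>\<^bsub>R\<^esub>"
  proof -
    have z: "star R d \<otimes>\<^bsub>R\<^esub> f = \<zero>\<^bsub>R\<^esub>" "e \<otimes>\<^bsub>R\<^esub> star R c = \<zero>\<^bsub>R\<^esub>" "star R a \<otimes>\<^bsub>R\<^esub> star R c = \<zero>\<^bsub>R\<^esub>"
      "star R a \<otimes>\<^bsub>R\<^esub> star R (a \<oplus>\<^bsub>R\<^esub> c \<otimes>\<^bsub>R\<^esub> d) = \<zero>\<^bsub>R\<^esub>" "star R d \<otimes>\<^bsub>R\<^esub> star R (a \<oplus>\<^bsub>R\<^esub> c \<otimes>\<^bsub>R\<^esub> d) = \<zero>\<^bsub>R\<^esub>"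
      using R.corner_orth_mult[OF sd R.corner_self gf] R.corner_orth_mult[OF R.corner_self scc eg]
        R.corner_orth_mult[OF sa scc fg] R.corner_orth_mult[OF sa sb fe] R.corner_orth_mult[OF sd sb ge] ef'
      by auto
    have "star R (e \<oplus>\<^bsub>R\<^esub> (a \<oplus>\<^bsub>R\<^esub> d)) \<otimes>\<^bsub>R\<^esub> (f \<oplus>\<^bsub>R\<^esub> (star R c \<oplus>\<^bsub>R\<^esub> \<ominus>\<^bsub>R\<^esub> star R (a \<oplus>\<^bsub>R\<^esub> c \<otimes>\<^bsub>R\<^esub> d)))
      = \<ominus>\<^bsub>R\<^esub> star R (a \<oplus>\<^bsub>R\<^esub> c \<otimes>\<^bsub>R\<^esub> d) \<oplus>\<^bsub>R\<^esub> (star R a \<oplus>\<^bsub>R\<^esub> star R d \<otimes>\<^bsub>R\<^esub> star R c)"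
      using ef' a' d' c' sa'(1,3) sd'(1) scc'(1) sb'(1,2) b'(1) z
      by (simp add: R.star_add[of e] R.star_add[of a d] R.l_distr R.r_distr R.r_minus R.l_minus projection_def)
        (simp add: R.a_ac)
    also have "star R a \<oplus>\<^bsub>R\<^esub> star R d \<otimes>\<^bsub>R\<^esub> star R c = star R (a \<oplus>\<^bsub>R\<^esub> c \<otimes>\<^bsub>R\<^esub> d)"
      using a' c' d' by (simp add: R.star_add R.star_mult)
    finally show ?thesis using sb' by (simp add: R.l_neg)
  qed
  then have "form V (v \<oplus>\<^bsub>V\<^esub> (rho f e a v \<oplus>\<^bsub>V\<^esub> ?u)) (w \<oplus>\<^bsub>V\<^esub> (?p \<oplus>\<^bsub>V\<^esub> ?q)) = \<zero>"
    using N_orth[OF _ _ _ x y] ef' a' d' scc' sb' by simp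
  \<comment> \<open>Of the nine terms only three survive: \<open>v\<close> with \<open>?q\<close>,
    the value of \<open>a\<close> with \<open>w\<close>, and \<open>?u\<close> with
    \<open>?p\<close>.\<close>
  moreover have "form V v w = \<zero>" "form V v ?p = \<zero>" "form V (rho f e a v) ?p = \<zero>"
    "form V (rho f e a v) ?q = \<zero>" "form V ?u w = \<zero>" "form V ?u ?q = \<zero>"
    using N_orth_projections ef eg fg fe ge gf v w u p q ra by blast+
  ultimately have eq: "form V v ?q \<oplus> (form V (rho f e a v) w \<oplus> form V ?u ?p) = \<zero>"
    using cV by (simp add: form_add_left form_add_right form_closed F.a_ac)
  have "form V (rho f e (a \<oplus>\<^bsub>R\<^esub> c \<otimes>\<^bsub>R\<^esub> d) v) w = \<ominus> form V v ?q"
    by (rule form_rho[OF ef b v w])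
  also have "\<dots> = form V (rho f e a v) w \<oplus> form V ?u ?p"
    using eq cV by (metis F.a_closed F.minus_equality F.a_comm F.minus_minus form_closed)
  \<comment> \<open>The sign stays inside \<open>rho\<close>: compatibility with negatives is
    derived only later, from this very identity.\<close>
  also have "form V ?u ?p = \<ominus> form V (rho f g (\<ominus>\<^bsub>R\<^esub> c) ?u) w"
    using form_rho[OF gf mc u w] c' scc' cV by (simp add: R.star_minus form_closed)
  finally show "form V (rho f e (a \<oplus>\<^bsub>R\<^esub> c \<otimes>\<^bsub>R\<^esub> d) v) w =
    form V (rho f e a v \<oplus>\<^bsub>V\<^esub> \<ominus>\<^bsub>V\<^esub> rho f g (\<ominus>\<^bsub>R\<^esub> c) ?u) w"
    using cV by (simp add: form_add_left form_minus_left)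
qed

text \<open>If the map vanishes, \<open>N (e + a)\<close> lies in \<open>N e\<close>, and so does
  \<open>N a\<close> because \<open>a = (e + a) - e\<close>. As \<open>a = f a\<close>,
  \<open>N a\<close> also lies in \<open>N f\<close>, which is orthogonal to \<open>N e\<close>;
  hence \<open>N a\<close> is zero.\<close>

lemma rho_eq_zero:
  assumes ef: "orth e f" and a: "a \<in> corner f e" and zero: "\<And>v. v \<in> N e \<Longrightarrow> rho f e a v = \<zero>\<^bsub>V\<^esub>"
  shows "a = \<zero>\<^bsub>R\<^esub>"
proof -
  note ef' = R.orthD[OF ef] and a' = R.cornerD[OF a]
  have ea: "N (e \<oplus>\<^bsub>R\<^esub> a) \<subseteq> N e"
  proof
    fix x assume x: "x \<in> N (e \<oplus>\<^bsub>R\<^esub> a)"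
    then obtain v y where vy: "v \<in> N e" "y \<in> N f" "x = v \<oplus>\<^bsub>V\<^esub> y"
      using N_join[of e f "\<one>\<^bsub>R\<^esub>" a x] ef' a' by auto
    then have "y = \<zero>\<^bsub>V\<^esub>" using rho_unique[OF ef a] x zero by metis
    then show "x \<in> N e" using vy N_carrier ef' by simp
  qed
  have "N a \<subseteq> {\<zero>\<^bsub>V\<^esub>}"
  proof
    fix x assume x: "x \<in> N a"
    have "(e \<oplus>\<^bsub>R\<^esub> a) \<otimes>\<^bsub>R\<^esub> \<one>\<^bsub>R\<^esub> \<oplus>\<^bsub>R\<^esub> e \<otimes>\<^bsub>R\<^esub> (\<ominus>\<^bsub>R\<^esub> \<one>\<^bsub>R\<^esub>) = a"
      using ef' a' by (simp add: R.r_minus R.a_ac R.r_neg)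
    then obtain v y where vy: "v \<in> N (e \<oplus>\<^bsub>R\<^esub> a)" "y \<in> N e" "x = v \<oplus>\<^bsub>V\<^esub> y"
      using N_join[of "e \<oplus>\<^bsub>R\<^esub> a" e "\<one>\<^bsub>R\<^esub>" "\<ominus>\<^bsub>R\<^esub> \<one>\<^bsub>R\<^esub>" x] ef' a' x by auto
    then have xe: "x \<in> N e" using ea submodule_add[OF N_submodule[OF ef'(3)]] by blast
    have "f \<otimes>\<^bsub>R\<^esub> a \<oplus>\<^bsub>R\<^esub> f \<otimes>\<^bsub>R\<^esub> \<zero>\<^bsub>R\<^esub> = a" using ef' a' by simp
    then obtain v y where vy: "v \<in> N f" "y \<in> N f" "x = v \<oplus>\<^bsub>V\<^esub> y"
      using N_join[of f f a "\<zero>\<^bsub>R\<^esub>" x] ef' a' x by auto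
    then have xf: "x \<in> N f" using submodule_add[OF N_submodule[OF ef'(4)]] by blast
    then show "x \<in> {\<zero>\<^bsub>V\<^esub>}"
      using N_orth_projections[OF ef xe xf] anisotropic N_carrier[OF ef'(3) xe] by blast
  qed
  then show ?thesis using N_inj a' by blast
qed

end

section \<open>Frames\<close>

context lattice_action
begin

text \<open>Factorization of maps from \<open>eR\<close> to \<open>fR\<close> through
  \<open>gR\<close>; this is what allows \<open>rho_plus_mult\<close> to give additivity.\<close>

definition passes :: "'r \<Rightarrow> 'r \<Rightarrow> 'r \<Rightarrow> bool" where
  "passes f g e \<longleftrightarrow> (\<forall>b\<in>corner f e. \<exists>c\<in>corner f g. \<exists>d\<in>corner g e. b = c \<otimes>\<^bsub>R\<^esub> d)"

definition triple :: "'r \<Rightarrow> 'r \<Rightarrow> 'r \<Rightarrow> bool" where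
  "triple e f g \<longleftrightarrow> orth e f \<and> orth e g \<and> orth f g \<and>
    passes e f g \<and> passes e g f \<and> passes f e g \<and> passes f g e \<and> passes g e f \<and> passes g f e"

lemma triple_swap: "triple e f g \<Longrightarrow> triple f e g" "triple e f g \<Longrightarrow> triple e g f"
  using R.orth_sym by (auto simp: triple_def)

lemma tripleD:
  assumes "triple e f g"
  shows "orth e f" "orth e g" "orth f g" "passes f g e"
  using assms by (auto simp: triple_def)

text \<open>Factor \<open>b = c d\<close> through \<open>g\<close>. Applied with first summand
  \<open>0\<close>, \<open>rho_plus_mult\<close> shows that its correction term is the value of
  \<open>b\<close>; applied with \<open>a\<close>, it adds this term to the value of
  \<open>a\<close>.\<close>

lemma rho_plus:
  assumes t: "triple e f g" and a: "a \<in> corner f e" and b: "b \<in> corner f e" and v: "v \<in> N e"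
  shows "rho f e (a \<oplus>\<^bsub>R\<^esub> b) v = rho f e a v \<oplus>\<^bsub>V\<^esub> rho f e b v"
proof -
  note o = tripleD(1-3)[OF t]
  note ef = R.orthD[OF o(1)]
  obtain c d where cd: "c \<in> corner f g" "d \<in> corner g e" "b = c \<otimes>\<^bsub>R\<^esub> d"
    using tripleD(4)[OF t] b by (auto simp: passes_def)
  have z: "\<zero>\<^bsub>R\<^esub> \<in> corner f e" using ef R.corner_zero by blast
  have "\<ominus>\<^bsub>R\<^esub> c \<in> corner f g" using cd R.corner_minus R.orthD[OF o(3)] by blast
  then have w: "rho f g (\<ominus>\<^bsub>R\<^esub> c) (rho g e d v) \<in> carrier V"
    using rho_carrier[OF R.orth_sym[OF o(3)]] rho(1)[OF o(2) cd(2) v] by blast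
  have "rho f e b v = \<ominus>\<^bsub>V\<^esub> rho f g (\<ominus>\<^bsub>R\<^esub> c) (rho g e d v)"
    using rho_plus_mult[OF o z cd(2,1) v] w cd R.cornerD[OF b] rho_zero[OF o(1) v] by simp
  then show ?thesis using rho_plus_mult[OF o a cd(2,1) v] cd by simp
qed

lemma rho_minus:
  assumes t: "triple e f g" and a: "a \<in> corner f e" and v: "v \<in> N e"
  shows "rho f e (\<ominus>\<^bsub>R\<^esub> a) v = \<ominus>\<^bsub>V\<^esub> rho f e a v"
proof -
  note ef = tripleD(1)[OF t]
  note ef' = R.orthD[OF ef]
  have m: "\<ominus>\<^bsub>R\<^esub> a \<in> corner f e" using a R.corner_minus ef' by blast
  have "rho f e (\<ominus>\<^bsub>R\<^esub> a) v \<oplus>\<^bsub>V\<^esub> rho f e a v = \<zero>\<^bsub>V\<^esub>"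
    using rho_plus[OF t m a v] rho_zero[OF ef v] R.cornerD[OF a] by (simp add: R.l_neg)
  then show ?thesis using rho_carrier[OF ef m v] rho_carrier[OF ef a v] V.minus_equality by metis
qed

text \<open>This is \<open>rho_plus_mult\<close> with first summand \<open>0\<close>; the two signs
  cancel by \<open>rho_minus\<close> for the permuted triple.\<close>

lemma rho_mult:
  assumes t: "triple e f g" and c: "c \<in> corner f g" and d: "d \<in> corner g e" and v: "v \<in> N e"
  shows "rho f e (c \<otimes>\<^bsub>R\<^esub> d) v = rho f g c (rho g e d v)"
proof -
  note o = tripleD(1-3)[OF t]
  note ef = R.orthD[OF o(1)]
  have t': "triple g f e" using t triple_swap by blast
  have z: "\<zero>\<^bsub>R\<^esub> \<in> corner f e" using ef R.corner_zero by blast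
  have u: "rho g e d v \<in> N g" by (rule rho(1)[OF o(2) d v])
  have cd: "c \<otimes>\<^bsub>R\<^esub> d \<in> carrier R" using R.cornerD[OF c] R.cornerD[OF d] by simp
  show ?thesis
    using rho_plus_mult[OF o z d c v] rho_minus[OF t' c u] rho_carrier[OF tripleD(1)[OF t'] c u]
      rho_zero[OF o(1) v] cd by simp
qed

lemma form_rho_star:
  assumes t: "triple e f g" and a: "a \<in> corner f e" and v: "v \<in> N e" and w: "w \<in> N f"
  shows "form V (rho f e a v) w = form V v (rho e f (star R a) w)"
proof -
  note ef = tripleD(1)[OF t]
  note ef' = R.orthD[OF ef]
  have s: "star R a \<in> corner e f" using R.corner_star[OF a] ef' by blast
  have "rho e f (star R a) w \<in> carrier V" by (rule rho_carrier[OF R.orth_sym[OF ef] s w])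
  then show ?thesis
    using form_rho[OF ef a v w] rho_minus[OF triple_swap(1)[OF t] s w] N_carrier[OF ef'(3) v]
    by (simp add: form_minus_right form_closed)
qed

end

text \<open>\<open>u\<close> and \<open>u'\<close> are inverse isomorphisms between
  \<open>e0 R\<close> and \<open>e1 R\<close>, while \<open>z\<close> merely embeds
  \<open>e0 R\<close> into \<open>e2 R\<close>, with left inverse \<open>z'\<close>;
  \<open>e2\<close> takes up the rest of the unit.\<close>

locale frame_action = lattice_action F V R N
  for F :: "('f, 'm) star_ring_scheme" (structure)
    and V :: "('f, 'v, 'n) inner_product_space_scheme" (structure)
    and R :: "('r, 'k) star_ring_scheme" and N :: "'r \<Rightarrow> 'v set" +
  fixes e0 e1 e2 u u' z z'
  assumes orth01: "orth e0 e1" and orth02: "orth e0 e2" and orth12: "orth e1 e2"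
    and u: "u \<in> corner e1 e0" and u': "u' \<in> corner e0 e1"
    and u'u: "u' \<otimes>\<^bsub>R\<^esub> u = e0" and uu': "u \<otimes>\<^bsub>R\<^esub> u' = e1"
    and z: "z \<in> corner e2 e0" and z': "z' \<in> corner e0 e2" and z'z: "z' \<otimes>\<^bsub>R\<^esub> z = e0"
    and sum_one: "e0 \<oplus>\<^bsub>R\<^esub> (e1 \<oplus>\<^bsub>R\<^esub> e2) = \<one>\<^bsub>R\<^esub>"
begin

lemmas e = R.orthD(1,3)[OF orth01] R.orthD(2,4)[OF orth01] R.orthD(2,4)[OF orth02]

lemma passesI:
  assumes c: "c \<in> corner g e" and c': "c' \<in> corner e g" and "c' \<otimes>\<^bsub>R\<^esub> c = e" and "f \<in> carrier R" "g \<in> carrier R"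
  shows "passes f g e"
  unfolding passes_def
proof
  fix b assume b: "b \<in> corner f e"
  show "\<exists>x\<in>corner f g. \<exists>y\<in>corner g e. b = x \<otimes>\<^bsub>R\<^esub> y"
  proof (intro bexI)
    show "b = (b \<otimes>\<^bsub>R\<^esub> c') \<otimes>\<^bsub>R\<^esub> c"
      using R.cornerD[OF b] R.cornerD[OF c] R.cornerD[OF c'] assms(3) by (simp add: R.m_assoc)
  qed (use R.corner_mult[OF b c'] assms in auto)
qed

lemma passesI':
  assumes c: "c \<in> corner f g" and c': "c' \<in> corner g f" and "c \<otimes>\<^bsub>R\<^esub> c' = f" and "e \<in> carrier R" "g \<in> carrier R"
  shows "passes f g e"
  unfolding passes_def
proof
  fix b assume b: "b \<in> corner f e"
  show "\<exists>x\<in>corner f g. \<exists>y\<in>corner g e. b = x \<otimes>\<^bsub>R\<^esub> y"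
  proof (intro bexI)
    show "b = c \<otimes>\<^bsub>R\<^esub> (c' \<otimes>\<^bsub>R\<^esub> b)"
      using R.cornerD[OF b] R.cornerD[OF c] R.cornerD[OF c'] assms(3) by (simp add: R.m_assoc[symmetric])
  qed (use R.corner_mult[OF c' b] assms in auto)
qed

lemma triple: "triple e0 e1 e2"
proof -
  \<comment> \<open>Every route has an end at \<open>e0\<close> or \<open>e1\<close> where the
    identity splits through the middle as \<open>u' u\<close>, \<open>u u'\<close> or
    \<open>z' z\<close>; so a one-sided inverse of \<open>z\<close> suffices.\<close>
  have "passes e0 e1 e2" "passes e0 e2 e1" "passes e1 e0 e2" "passes e1 e2 e0" "passes e2 e0 e1" "passes e2 e1 e0"
    using passesI'[OF u' u u'u] passesI'[OF z' z z'z] passesI'[OF u u' uu'] passesI[OF z z' z'z]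
      passesI[OF u' u uu'] passesI[OF u u' u'u] e by auto
  then show ?thesis using orth01 orth02 orth12 by (simp add: triple_def)
qed

lemma triples: "triple e0 e2 e1" "triple e1 e0 e2" "triple e1 e2 e0" "triple e2 e0 e1" "triple e2 e1 e0"
  using triple triple_swap by blast+

text \<open>\<open>rho\<close> makes sense between orthogonal projections only, so an element
  \<open>b\<close> of \<open>e0 R e0\<close> acts by the detour \<open>b = (b u') u\<close> through
  \<open>e1\<close>.\<close>

definition diag :: "'r \<Rightarrow> 'v \<Rightarrow> 'v" where
  "diag b v = rho e0 e1 (b \<otimes>\<^bsub>R\<^esub> u') (rho e1 e0 u v)"

lemmas orths = orth01 orth02 orth12 R.orth_sym[OF orth01] R.orth_sym[OF orth02] R.orth_sym[OF orth12]
lemmas frame_carrier = R.cornerD(1)[OF u] R.cornerD(1)[OF u'] R.cornerD(1)[OF z] R.cornerD(1)[OF z']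

lemma diag_in:
  assumes "b \<in> corner e0 e0" "v \<in> N e0"
  shows "diag b v \<in> N e0"
  unfolding diag_def
  by (intro rho(1) orths R.corner_mult[OF assms(1) u'] e u assms(2))

lemma diag_plus:
  assumes a: "a \<in> corner e0 e0" and b: "b \<in> corner e0 e0" and v: "v \<in> N e0"
  shows "diag (a \<oplus>\<^bsub>R\<^esub> b) v = diag a v \<oplus>\<^bsub>V\<^esub> diag b v"
  using rho_plus[OF triples(2) R.corner_mult[OF a u'] R.corner_mult[OF b u'] rho(1)[OF orth01 u v]] e
    frame_carrier R.cornerD(1)[OF a] R.cornerD(1)[OF b]
  by (simp add: diag_def R.l_distr)

lemma diag_smult:
  assumes b: "b \<in> corner e0 e0" and k: "k \<in> carrier F" and v: "v \<in> N e0"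
  shows "diag b (k \<odot>\<^bsub>V\<^esub> v) = k \<odot>\<^bsub>V\<^esub> diag b v"
  using rho_smult[OF orths(4) R.corner_mult[OF b u'] rho(1)[OF orth01 u v] k] e
  by (simp add: diag_def rho_smult[OF orth01 u v k])

text \<open>\<open>b z' = (b u') (u z')\<close> moves the middle stop from \<open>e2\<close> to
  \<open>e1\<close>, and \<open>u z' z = u\<close>; so both detours agree.\<close>

lemma diag_via_e2:
  assumes b: "b \<in> corner e0 e0" and v: "v \<in> N e0"
  shows "diag b v = rho e0 e2 (b \<otimes>\<^bsub>R\<^esub> z') (rho e2 e0 z v)"
proof -
  note bc = R.cornerD[OF b] and uc = R.cornerD[OF u] and uc' = R.cornerD[OF u'] and zc = R.cornerD[OF z]
    and zc' = R.cornerD[OF z']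
  have bu': "b \<otimes>\<^bsub>R\<^esub> u' \<in> corner e0 e1" and uz': "u \<otimes>\<^bsub>R\<^esub> z' \<in> corner e1 e2"
    using R.corner_mult b u u' z' e by blast+
  have x: "rho e2 e0 z v \<in> N e2" by (rule rho(1)[OF orth02 z v])
  have "b \<otimes>\<^bsub>R\<^esub> z' = (b \<otimes>\<^bsub>R\<^esub> u') \<otimes>\<^bsub>R\<^esub> (u \<otimes>\<^bsub>R\<^esub> z')"
    using bc uc uc' zc' u'u e by (simp add: R.m_assoc) (metis R.m_assoc)
  then have "rho e0 e2 (b \<otimes>\<^bsub>R\<^esub> z') (rho e2 e0 z v)
      = rho e0 e1 (b \<otimes>\<^bsub>R\<^esub> u') (rho e1 e2 (u \<otimes>\<^bsub>R\<^esub> z') (rho e2 e0 z v))"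
    using rho_mult[OF triples(4) bu' uz' x] by simp
  also have "rho e1 e2 (u \<otimes>\<^bsub>R\<^esub> z') (rho e2 e0 z v) = rho e1 e0 (u \<otimes>\<^bsub>R\<^esub> z' \<otimes>\<^bsub>R\<^esub> z) v"
    by (rule rho_mult[OF triple uz' z v, symmetric])
  also have "u \<otimes>\<^bsub>R\<^esub> z' \<otimes>\<^bsub>R\<^esub> z = u"
    using uc zc zc' z'z by (simp add: R.m_assoc)
  finally show ?thesis by (simp add: diag_def)
qed

text \<open>\<open>rho_mult\<close> runs between three different projections and does not cover a
  path from \<open>e0\<close> to \<open>e1\<close> and back. Writing \<open>b = (b z') z\<close>
  inserts the stop \<open>e2\<close>, and \<open>diag_via_e2\<close> absorbs it.\<close>

lemma diag_via_e1_mult: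
  assumes a: "a \<in> corner e0 e1" and b: "b \<in> corner e1 e0" and v: "v \<in> N e0"
  shows "rho e0 e1 a (rho e1 e0 b v) = diag (a \<otimes>\<^bsub>R\<^esub> b) v"
proof -
  note ac = R.cornerD[OF a] and bc = R.cornerD[OF b] and zc = R.cornerD[OF z] and zc' = R.cornerD[OF z']
  have bz': "b \<otimes>\<^bsub>R\<^esub> z' \<in> corner e1 e2" and ab: "a \<otimes>\<^bsub>R\<^esub> b \<in> corner e0 e0"
    using R.corner_mult a b z' e by blast+
  have x: "rho e2 e0 z v \<in> N e2" by (rule rho(1)[OF orth02 z v])
  have "b = b \<otimes>\<^bsub>R\<^esub> z' \<otimes>\<^bsub>R\<^esub> z" using bc zc zc' z'z by (simp add: R.m_assoc)
  then have "rho e1 e0 b v = rho e1 e2 (b \<otimes>\<^bsub>R\<^esub> z') (rho e2 e0 z v)"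
    using rho_mult[OF triple bz' z v] by simp
  then have "rho e0 e1 a (rho e1 e0 b v) = rho e0 e2 (a \<otimes>\<^bsub>R\<^esub> (b \<otimes>\<^bsub>R\<^esub> z')) (rho e2 e0 z v)"
    using rho_mult[OF triples(4) a bz' x] by simp
  then show ?thesis using diag_via_e2[OF ab v] ac bc zc' by (simp add: R.m_assoc)
qed

text \<open>The mirror argument, with \<open>b = (b u') u\<close> inserting the stop
  \<open>e1\<close>.\<close>

lemma diag_via_e2_mult:
  assumes a: "a \<in> corner e0 e2" and b: "b \<in> corner e2 e0" and v: "v \<in> N e0"
  shows "rho e0 e2 a (rho e2 e0 b v) = diag (a \<otimes>\<^bsub>R\<^esub> b) v"
proof -
  note ac = R.cornerD[OF a] and bc = R.cornerD[OF b] and uc = R.cornerD[OF u] and uc' = R.cornerD[OF u']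
  have bu': "b \<otimes>\<^bsub>R\<^esub> u' \<in> corner e2 e1"
    using R.corner_mult b u' e by blast
  have x: "rho e1 e0 u v \<in> N e1" by (rule rho(1)[OF orth01 u v])
  have "b = b \<otimes>\<^bsub>R\<^esub> u' \<otimes>\<^bsub>R\<^esub> u" using bc uc uc' u'u by (simp add: R.m_assoc)
  then have "rho e2 e0 b v = rho e2 e1 (b \<otimes>\<^bsub>R\<^esub> u') (rho e1 e0 u v)"
    using rho_mult[OF triples(1) bu' u v] by simp
  then have "rho e0 e2 a (rho e2 e0 b v) = rho e0 e1 (a \<otimes>\<^bsub>R\<^esub> (b \<otimes>\<^bsub>R\<^esub> u')) (rho e1 e0 u v)"
    using rho_mult[OF triples(2) a bu' x] by simp
  then show ?thesis using ac bc uc' by (simp add: R.m_assoc diag_def)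
qed

text \<open>\<open>diag a\<close> is routed through \<open>e1\<close> and \<open>diag b\<close>
  through \<open>e2\<close>. Once both factors of \<open>diag a\<close> are moved across the form,
  each composition runs between three different projections, and the factors multiply to
  \<open>star R a b z'\<close>, again a route through \<open>e2\<close>.\<close>

lemma diag_form:
  assumes a: "a \<in> corner e0 e0" and b: "b \<in> corner e0 e0" and v: "v \<in> N e0" and w: "w \<in> N e0"
  shows "form V (diag a v) (diag b w) = form V v (diag (star R a \<otimes>\<^bsub>R\<^esub> b) w)"
proof -
  note ac = R.cornerD[OF a] and bc = R.cornerD[OF b] and uc = R.cornerD[OF u] and uc' = R.cornerD[OF u']
    and zc' = R.cornerD[OF z']
  have sa: "star R a \<in> corner e0 e0" and su: "star R u \<in> corner e0 e1" 
    using R.corner_star a u e by blast+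
  have au': "a \<otimes>\<^bsub>R\<^esub> u' \<in> corner e0 e1" and bz': "b \<otimes>\<^bsub>R\<^esub> z' \<in> corner e0 e2"
    and sab: "star R a \<otimes>\<^bsub>R\<^esub> b \<in> corner e0 e0"
    using R.corner_mult a b sa u' z' e by blast+
  have sau': "star R (a \<otimes>\<^bsub>R\<^esub> u') \<in> corner e1 e0" using R.corner_star[OF au'] e by blast
  then have sc: "star R (a \<otimes>\<^bsub>R\<^esub> u') \<otimes>\<^bsub>R\<^esub> (b \<otimes>\<^bsub>R\<^esub> z') \<in> corner e1 e2" using R.corner_mult bz' e by blast
  have x: "rho e1 e0 u v \<in> N e1" by (rule rho(1)[OF orth01 u v])
  have y: "rho e2 e0 z w \<in> N e2" by (rule rho(1)[OF orth02 z w])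
  have d: "diag b w \<in> N e0" by (rule diag_in[OF b w])
  have d': "rho e1 e0 (star R (a \<otimes>\<^bsub>R\<^esub> u')) (diag b w) \<in> N e1" by (rule rho(1)[OF orth01 sau' d])
  have "form V (diag a v) (diag b w) = form V (rho e1 e0 u v) (rho e1 e0 (star R (a \<otimes>\<^bsub>R\<^esub> u')) (diag b w))"
    unfolding diag_def[of a] by (rule form_rho_star[OF triples(2) au' x d])
  also have "\<dots> = form V v (rho e0 e1 (star R u) (rho e1 e0 (star R (a \<otimes>\<^bsub>R\<^esub> u')) (diag b w)))"
    by (rule form_rho_star[OF triple u v d'])
  also have "rho e1 e0 (star R (a \<otimes>\<^bsub>R\<^esub> u')) (diag b w)
      = rho e1 e2 (star R (a \<otimes>\<^bsub>R\<^esub> u') \<otimes>\<^bsub>R\<^esub> (b \<otimes>\<^bsub>R\<^esub> z')) (rho e2 e0 z w)"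
    unfolding diag_via_e2[OF b w] by (rule rho_mult[OF triples(5) sau' bz' y, symmetric])
  also have "rho e0 e1 (star R u) \<dots>
      = rho e0 e2 (star R u \<otimes>\<^bsub>R\<^esub> (star R (a \<otimes>\<^bsub>R\<^esub> u') \<otimes>\<^bsub>R\<^esub> (b \<otimes>\<^bsub>R\<^esub> z'))) (rho e2 e0 z w)"
    by (rule rho_mult[OF triples(4) su sc y, symmetric])
  also have "star R u \<otimes>\<^bsub>R\<^esub> (star R (a \<otimes>\<^bsub>R\<^esub> u') \<otimes>\<^bsub>R\<^esub> (b \<otimes>\<^bsub>R\<^esub> z'))
      = star R (a \<otimes>\<^bsub>R\<^esub> u' \<otimes>\<^bsub>R\<^esub> u) \<otimes>\<^bsub>R\<^esub> (b \<otimes>\<^bsub>R\<^esub> z')"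
    using ac bc uc uc' zc' by (simp add: R.star_mult R.star_closed R.m_assoc)
  also have "a \<otimes>\<^bsub>R\<^esub> u' \<otimes>\<^bsub>R\<^esub> u = a" using ac uc uc' u'u by (simp add: R.m_assoc)
  also have "star R a \<otimes>\<^bsub>R\<^esub> (b \<otimes>\<^bsub>R\<^esub> z') = star R a \<otimes>\<^bsub>R\<^esub> b \<otimes>\<^bsub>R\<^esub> z'"
    using ac bc zc' by (simp add: R.star_closed R.m_assoc)
  finally show ?thesis using diag_via_e2[OF sab w] by simp
qed

section \<open>The left ideal \<open>R e0\<close> acting by columns\<close>

definition left_ideal :: "'r set" where
  "left_ideal = {a \<in> carrier R. a \<otimes>\<^bsub>R\<^esub> e0 = a}"

text \<open>The entries of \<open>a\<close> along \<open>e0 + e1 + e2 = 1\<close>: the first is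
  diagonal and acts by \<open>diag\<close>, the others act by \<open>rho\<close>.\<close>

definition column :: "'r \<Rightarrow> 'v \<Rightarrow> 'v" where
  "column a v = diag (e0 \<otimes>\<^bsub>R\<^esub> a) v \<oplus>\<^bsub>V\<^esub>
    (rho e1 e0 (e1 \<otimes>\<^bsub>R\<^esub> a) v \<oplus>\<^bsub>V\<^esub> rho e2 e0 (e2 \<otimes>\<^bsub>R\<^esub> a) v)"

lemma left_ideal_corner:
  assumes "a \<in> left_ideal"
  shows "e0 \<otimes>\<^bsub>R\<^esub> a \<in> corner e0 e0" "e1 \<otimes>\<^bsub>R\<^esub> a \<in> corner e1 e0" "e2 \<otimes>\<^bsub>R\<^esub> a \<in> corner e2 e0"
  using assms e by (auto simp: left_ideal_def R.corner_def projection_def R.m_assoc R.m_assoc[symmetric, of _ _ a])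

lemma column_parts:
  assumes a: "a \<in> left_ideal" and v: "v \<in> N e0"
  shows "diag (e0 \<otimes>\<^bsub>R\<^esub> a) v \<in> N e0" "rho e1 e0 (e1 \<otimes>\<^bsub>R\<^esub> a) v \<in> N e1" "rho e2 e0 (e2 \<otimes>\<^bsub>R\<^esub> a) v \<in> N e2"
  using diag_in[OF left_ideal_corner(1)[OF a] v] rho(1)[OF orth01 left_ideal_corner(2)[OF a] v]
    rho(1)[OF orth02 left_ideal_corner(3)[OF a] v] by auto

lemma column_carriers:
  assumes a: "a \<in> left_ideal" and v: "v \<in> N e0"
  shows "diag (e0 \<otimes>\<^bsub>R\<^esub> a) v \<in> carrier V" "rho e1 e0 (e1 \<otimes>\<^bsub>R\<^esub> a) v \<in> carrier V"
    "rho e2 e0 (e2 \<otimes>\<^bsub>R\<^esub> a) v \<in> carrier V"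
  using column_parts[OF assms] N_carrier e by blast+

lemma column_closed: "a \<in> left_ideal \<Longrightarrow> v \<in> N e0 \<Longrightarrow> column a v \<in> carrier V"
  using column_carriers by (simp add: column_def)

lemma column_plus:
  assumes a: "a \<in> left_ideal" and b: "b \<in> left_ideal" and v: "v \<in> N e0"
  shows "column (a \<oplus>\<^bsub>R\<^esub> b) v = column a v \<oplus>\<^bsub>V\<^esub> column b v"
proof -
  have ab: "a \<in> carrier R" "b \<in> carrier R" using a b by (auto simp: left_ideal_def)
  note ac = left_ideal_corner[OF a] and bc = left_ideal_corner[OF b]
  show ?thesis
    using ab e column_carriers[OF a v] column_carriers[OF b v]
    by (simp add: column_def R.r_distr diag_plus[OF ac(1) bc(1) v] rho_plus[OF triple ac(2) bc(2) v]
        rho_plus[OF triples(1) ac(3) bc(3) v] V.a_ac)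
qed

lemma column_smult:
  assumes a: "a \<in> left_ideal" and k: "k \<in> carrier F" and v: "v \<in> N e0"
  shows "column a (k \<odot>\<^bsub>V\<^esub> v) = k \<odot>\<^bsub>V\<^esub> column a v"
  using column_carriers[OF a v] k left_ideal_corner[OF a]
  by (simp add: column_def smult_r_distr diag_smult[OF _ k v] rho_smult[OF orth01 _ v k] rho_smult[OF orth02 _ v k])

lemma column_diag:
  assumes m: "m \<in> corner e0 e0" and v: "v \<in> N e0"
  shows "column m v = diag m v"
proof -
  have "e1 \<otimes>\<^bsub>R\<^esub> m = \<zero>\<^bsub>R\<^esub>" "e2 \<otimes>\<^bsub>R\<^esub> m = \<zero>\<^bsub>R\<^esub>" "e0 \<otimes>\<^bsub>R\<^esub> m = m"
    using R.corner_orth_mult[OF R.corner_self m] orths e R.cornerD[OF m] by auto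
  then show ?thesis using diag_in[OF m v] N_carrier e rho_zero[OF orth01 v] rho_zero[OF orth02 v]
    by (simp add: column_def)
qed

text \<open>\<open>N e0\<close>, \<open>N e1\<close> and \<open>N e2\<close> are pairwise
  orthogonal, so only entries at the same projection \<open>x\<close> pair, contributing
  \<open>star R (x a)\<close> times \<open>x b\<close>. These three elements of
  \<open>e0 R e0\<close> add up to \<open>star R a b\<close> because the projections sum to
  \<open>1\<close>.\<close>

lemma column_form:
  assumes a: "a \<in> left_ideal" and b: "b \<in> left_ideal" and v: "v \<in> N e0" and w: "w \<in> N e0"
  shows "form V (column a v) (column b w) = form V v (column (star R a \<otimes>\<^bsub>R\<^esub> b) w)"
proof -
  note ac = left_ideal_corner[OF a] and bc = left_ideal_corner[OF b]
  note av = column_parts[OF a v] and bw = column_parts[OF b w]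
  note avV = column_carriers[OF a v] and bwV = column_carriers[OF b w]
  have aR: "a \<in> carrier R" "a \<otimes>\<^bsub>R\<^esub> e0 = a" and bR: "b \<in> carrier R" "b \<otimes>\<^bsub>R\<^esub> e0 = b"
    using a b by (auto simp: left_ideal_def)
  have vV: "v \<in> carrier V" using v N_carrier e by blast
  let ?s = "\<lambda>x. star R (x \<otimes>\<^bsub>R\<^esub> a)" let ?m = "\<lambda>x. ?s x \<otimes>\<^bsub>R\<^esub> (x \<otimes>\<^bsub>R\<^esub> b)"
  have s: "?s e0 \<in> corner e0 e0" "?s e1 \<in> corner e0 e1" "?s e2 \<in> corner e0 e2"
    using R.corner_star ac e by blast+
  have m: "?m e0 \<in> corner e0 e0" "?m e1 \<in> corner e0 e0" "?m e2 \<in> corner e0 e0"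
    using R.corner_mult s bc e by blast+
  note mV = diag_in[OF m(1) w] diag_in[OF m(2) w] diag_in[OF m(3) w]
  note vmF = form_closed[OF vV N_carrier[OF e(2) mV(1)]] form_closed[OF vV N_carrier[OF e(2) mV(2)]]
    form_closed[OF vV N_carrier[OF e(2) mV(3)]]
  have m12: "?m e1 \<oplus>\<^bsub>R\<^esub> ?m e2 \<in> corner e0 e0" using R.corner_add m e by blast
  have m012: "?m e0 \<oplus>\<^bsub>R\<^esub> (?m e1 \<oplus>\<^bsub>R\<^esub> ?m e2) \<in> corner e0 e0" using R.corner_add m m12 e by blast
  have m_eq: "?m x = star R a \<otimes>\<^bsub>R\<^esub> (x \<otimes>\<^bsub>R\<^esub> b)" if "projection R x" for x
    using that aR bR by (simp add: projection_def R.star_mult R.star_closed R.m_assoc)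
      (simp add: R.m_assoc[symmetric])
  have "star R a \<otimes>\<^bsub>R\<^esub> b = star R a \<otimes>\<^bsub>R\<^esub> ((e0 \<oplus>\<^bsub>R\<^esub> (e1 \<oplus>\<^bsub>R\<^esub> e2)) \<otimes>\<^bsub>R\<^esub> b)"
    using bR by (simp add: sum_one)
  also have "\<dots> = ?m e0 \<oplus>\<^bsub>R\<^esub> (?m e1 \<oplus>\<^bsub>R\<^esub> ?m e2)"
    using aR bR e by (simp add: m_eq R.l_distr R.r_distr R.star_closed)
  finally have sum: "star R a \<otimes>\<^bsub>R\<^esub> b = ?m e0 \<oplus>\<^bsub>R\<^esub> (?m e1 \<oplus>\<^bsub>R\<^esub> ?m e2)" .
  have "form V (diag (e0 \<otimes>\<^bsub>R\<^esub> a) v) (diag (e0 \<otimes>\<^bsub>R\<^esub> b) w) = form V v (diag (?m e0) w)"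
    by (rule diag_form[OF ac(1) bc(1) v w])
  moreover have "form V (rho e1 e0 (e1 \<otimes>\<^bsub>R\<^esub> a) v) (rho e1 e0 (e1 \<otimes>\<^bsub>R\<^esub> b) w) = form V v (diag (?m e1) w)"
    using form_rho_star[OF triple ac(2) v bw(2)] diag_via_e1_mult[OF s(2) bc(2) w] by simp
  moreover have "form V (rho e2 e0 (e2 \<otimes>\<^bsub>R\<^esub> a) v) (rho e2 e0 (e2 \<otimes>\<^bsub>R\<^esub> b) w) = form V v (diag (?m e2) w)"
    using form_rho_star[OF triples(1) ac(3) v bw(3)] diag_via_e2_mult[OF s(3) bc(3) w] by simp
  moreover have "form V x y = \<zero>"
    if "x \<in> N e0 \<and> y \<in> N e1 \<or> x \<in> N e0 \<and> y \<in> N e2 \<or> x \<in> N e1 \<and> y \<in> N e0 \<or> x \<in> N e1 \<and> y \<in> N e2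
      \<or> x \<in> N e2 \<and> y \<in> N e0 \<or> x \<in> N e2 \<and> y \<in> N e1" for x y
    using that N_orth_projections orths by blast
  ultimately have "form V (column a v) (column b w) =
      form V v (diag (?m e0) w) \<oplus> (form V v (diag (?m e1) w) \<oplus> form V v (diag (?m e2) w))"
    using av bw avV bwV vmF by (simp add: column_def form_add_left form_add_right form_closed)
  also have "\<dots> = form V v (diag (?m e0) w \<oplus>\<^bsub>V\<^esub> (diag (?m e1) w \<oplus>\<^bsub>V\<^esub> diag (?m e2) w))"
    using vV N_carrier[OF e(2)] mV by (simp add: form_add_right)
  also have "\<dots> = form V v (diag (star R a \<otimes>\<^bsub>R\<^esub> b) w)"
    by (simp only: sum diag_plus[OF m(1) m12 w] diag_plus[OF m(2,3) w])
  finally show ?thesis using column_diag[OF _ w] m012 sum by simp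
qed

text \<open>
  The off-diagonal parts of \<open>a\<close> are detected directly, and \<open>e\<^sub>0a\<close> through \<open>ua = e\<^sub>1(ua)\<close>.
\<close>

lemma column_eq_zero:
  assumes a: "a \<in> left_ideal" and zero: "\<And>v. v \<in> N e0 \<Longrightarrow> column a v = \<zero>\<^bsub>V\<^esub>"
  shows "a = \<zero>\<^bsub>R\<^esub>"
proof -
  have off: "e1 \<otimes>\<^bsub>R\<^esub> b = \<zero>\<^bsub>R\<^esub>" "e2 \<otimes>\<^bsub>R\<^esub> b = \<zero>\<^bsub>R\<^esub>"
    if b: "b \<in> left_ideal" and b0: "\<And>v. v \<in> N e0 \<Longrightarrow> column b v = \<zero>\<^bsub>V\<^esub>" for b
  proof -
    have "rho e1 e0 (e1 \<otimes>\<^bsub>R\<^esub> b) v = \<zero>\<^bsub>V\<^esub>" "rho e2 e0 (e2 \<otimes>\<^bsub>R\<^esub> b) v = \<zero>\<^bsub>V\<^esub>" if v: "v \<in> N e0" for v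
    proof -
      note p = column_parts[OF b v] and pV = column_carriers[OF b v]
      let ?x = "rho e1 e0 (e1 \<otimes>\<^bsub>R\<^esub> b) v" and ?y = "rho e2 e0 (e2 \<otimes>\<^bsub>R\<^esub> b) v"
      \<comment> \<open>Pairing the column with one of its entries isolates that entry.\<close>
      have "form V (column b v) ?x = form V ?x ?x" "form V (column b v) ?y = form V ?y ?y"
        using p pV N_orth_projections[OF orth01] N_orth_projections[OF orth02] N_orth_projections[OF orth12]
          N_orth_projections[OF orths(6)]
        by (simp_all add: column_def form_add_left form_closed)
      then have "form V ?x ?x = \<zero>" "form V ?y ?y = \<zero>" using b0[OF v] pV form_zero_left by auto
      then show "?x = \<zero>\<^bsub>V\<^esub>" "?y = \<zero>\<^bsub>V\<^esub>" 
        using anisotropic[OF pV(2)] anisotropic[OF pV(3)] by blast+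
    qed
    then show "e1 \<otimes>\<^bsub>R\<^esub> b = \<zero>\<^bsub>R\<^esub>" "e2 \<otimes>\<^bsub>R\<^esub> b = \<zero>\<^bsub>R\<^esub>"
      using rho_eq_zero[OF orth01 left_ideal_corner(2)[OF b]] rho_eq_zero[OF orth02 left_ideal_corner(3)[OF b]]
      by auto
  qed
  have aR: "a \<in> carrier R" "a \<otimes>\<^bsub>R\<^esub> e0 = a" using a by (auto simp: left_ideal_def)
  let ?b = "u \<otimes>\<^bsub>R\<^esub> a"
  have b: "?b \<in> left_ideal" using aR frame_carrier e by (simp add: left_ideal_def R.m_assoc)
  have c: "star R u \<otimes>\<^bsub>R\<^esub> ?b \<in> left_ideal"
    using aR frame_carrier e R.star_closed by (simp add: left_ideal_def R.m_assoc)
  \<comment> \<open>Moving \<open>u\<close> across the form turns the form of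
    \<open>column (u a) v\<close> with itself into one having \<open>column a v = 0\<close> on the
    left.\<close>
  have "column ?b v = \<zero>\<^bsub>V\<^esub>" if v: "v \<in> N e0" for v
  proof -
    have "form V (column ?b v) (column ?b v) = form V v (column (star R a \<otimes>\<^bsub>R\<^esub> (star R u \<otimes>\<^bsub>R\<^esub> ?b)) v)"
      using column_form[OF b b v v] aR frame_carrier by (simp add: R.star_mult R.star_closed R.m_assoc)
    also have "\<dots> = form V (column a v) (column (star R u \<otimes>\<^bsub>R\<^esub> ?b) v)"
      by (rule column_form[OF a c v v, symmetric])
    also have "\<dots> = \<zero>" using zero[OF v] form_zero_left column_closed[OF c v] by simp
    finally show ?thesis using anisotropic column_closed[OF b v] by blast
  qed
  then have "e1 \<otimes>\<^bsub>R\<^esub> ?b = \<zero>\<^bsub>R\<^esub>" using off[OF b] by blast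
  then have "u \<otimes>\<^bsub>R\<^esub> a = \<zero>\<^bsub>R\<^esub>" using R.cornerD[OF u] aR e by (simp add: R.m_assoc[symmetric])
  then have "e0 \<otimes>\<^bsub>R\<^esub> a = \<zero>\<^bsub>R\<^esub>" using frame_carrier aR by (simp add: u'u[symmetric] R.m_assoc)
  moreover have "a = (e0 \<oplus>\<^bsub>R\<^esub> (e1 \<oplus>\<^bsub>R\<^esub> e2)) \<otimes>\<^bsub>R\<^esub> a" using aR by (simp add: sum_one)
  ultimately show ?thesis using off[OF a zero] aR e by (simp add: R.l_distr)
qed

lemma left_ideal_action: "left_ideal_action F V R left_ideal (N e0) column"
proof (intro left_ideal_action.intro left_ideal_action_axioms.intro)
  show "inner_product_space F V" "star_ring R" by unfold_locales
  show "submodule (N e0) F V" using N_submodule e by blast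
qed (use e in \<open>auto simp: left_ideal_def R.l_distr R.m_assoc
    intro: column_closed column_plus column_smult column_form\<close>)

text \<open>For nonzero \<open>r\<close> the hypothesis supplies \<open>x e0\<close> in the left
  ideal with \<open>r x e0\<close> nonzero, and \<open>column_eq_zero\<close> turns this into
  faithfulness.\<close>

theorem ultrapower_star_representation_if_prime:
  assumes prime: "\<And>r. r \<in> carrier R \<Longrightarrow> r \<noteq> \<zero>\<^bsub>R\<^esub> \<Longrightarrow> \<exists>x\<in>carrier R. r \<otimes>\<^bsub>R\<^esub> x \<otimes>\<^bsub>R\<^esub> e0 \<noteq> \<zero>\<^bsub>R\<^esub>"
  shows "\<exists>(\<U> :: ('r, 'f, 'v) ultra_index filter) U \<rho>. ultrafilter \<U> \<and>
    closed_subspace (ultrapower_scalars \<U> F) (ultrapower_vectors \<U> F V) U \<and>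
    star_ring_representation R (ultrapower_scalars \<U> F)
      ((ultrapower_vectors \<U> F V)\<lparr>carrier := U\<rparr>) \<rho>"
proof (rule left_ideal_action.ultrapower_star_representation_if_faithful[OF left_ideal_action])
  fix r assume r: "r \<in> carrier R" "r \<noteq> \<zero>\<^bsub>R\<^esub>"
  then obtain x where x: "x \<in> carrier R" "r \<otimes>\<^bsub>R\<^esub> x \<otimes>\<^bsub>R\<^esub> e0 \<noteq> \<zero>\<^bsub>R\<^esub>" using prime by blast
  have c: "x \<otimes>\<^bsub>R\<^esub> e0 \<in> left_ideal" and rc: "r \<otimes>\<^bsub>R\<^esub> (x \<otimes>\<^bsub>R\<^esub> e0) \<in> left_ideal"
    using x r e by (auto simp: left_ideal_def R.m_assoc projection_def)
  show "\<exists>c\<in>left_ideal. \<exists>v\<in>N e0. column (r \<otimes>\<^bsub>R\<^esub> c) v \<noteq> \<zero>\<^bsub>V\<^esub>"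
    using column_eq_zero[OF rc] x r e c by (auto simp: R.m_assoc)
qed

end

section \<open>Star-regular rings\<close>

context star_regular_ring
begin

lemma diff_eq_zero: "a \<oplus> \<ominus> b = \<zero> \<Longrightarrow> a \<in> carrier R \<Longrightarrow> b \<in> carrier R \<Longrightarrow> a = b"
  by (metis a_inv_closed minus_equality minus_minus)

text \<open>Let \<open>b = a star R a\<close> and \<open>d = b y a - a\<close>. The hypothesis gives
  \<open>d star R a = 0\<close>, and \<open>star R d\<close> is a right multiple of
  \<open>star R a\<close>; so \<open>d star R d = 0\<close>, and properness gives
  \<open>d = 0\<close>.\<close>

lemma star_cancel:
  assumes a: "a \<in> carrier R" and y: "y \<in> carrier R"
    and eq: "(a \<otimes> star R a) \<otimes> y \<otimes> (a \<otimes> star R a) = a \<otimes> star R a"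
  shows "(a \<otimes> star R a) \<otimes> y \<otimes> a = a"
proof -
  let ?b = "a \<otimes> star R a"
  let ?d = "?b \<otimes> y \<otimes> a \<oplus> \<ominus> a"
  have c: "star R a \<in> carrier R" "star R y \<in> carrier R" "?b \<in> carrier R" "?d \<in> carrier R"
    using a y star_closed by auto
  have "?d \<otimes> star R a = ?b \<otimes> y \<otimes> ?b \<oplus> \<ominus> ?b"
    using a y c by (simp add: l_distr l_minus m_assoc)
  then have z: "?d \<otimes> star R a = \<zero>" using eq c by (simp add: r_neg)
  have "star R ?d = star R a \<otimes> (star R y \<otimes> ?b \<oplus> \<ominus> \<one>)"
    using a y c by (simp add: star_add star_minus star_mult star_star r_distr r_minus m_assoc)
  then have "?d \<otimes> star R ?d = ?d \<otimes> (star R a \<otimes> (star R y \<otimes> ?b \<oplus> \<ominus> \<one>))" by (rule arg_cong)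
  also have "\<dots> = (?d \<otimes> star R a) \<otimes> (star R y \<otimes> ?b \<oplus> \<ominus> \<one>)"
    by (rule m_assoc[symmetric]) (use c in auto)
  also have "\<dots> = \<zero>" unfolding z by (rule l_null) (use c in auto)
  finally have "?d = \<zero>" by (rule star_proper[OF c(4)])
  then show ?thesis by (rule diff_eq_zero) (use a y c in auto)
qed

text \<open>A projection generating \<open>aR\<close> is found as \<open>b w b\<close> with
  \<open>b = a star R a\<close> and \<open>w\<close> self-adjoint; \<open>star_cancel\<close> passes
  identities from \<open>b b\<close> down to \<open>b\<close> and from \<open>b\<close> down to
  \<open>a\<close>.\<close>

lemma left_projection:
  assumes a: "a \<in> carrier R"
  shows "\<exists>e. projection R e \<and> e \<otimes> a = a \<and> (\<exists>t\<in>carrier R. e = a \<otimes> t)"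
proof -
  define b where "b = a \<otimes> star R a"
  have b: "b \<in> carrier R" "star R b = b" using a by (auto simp: b_def star_closed star_mult star_star)
  define c where "c = b \<otimes> b"
  have c: "c \<in> carrier R" "star R c = c" using b by (auto simp: c_def star_mult)
  obtain y where y: "y \<in> carrier R" "b \<otimes> y \<otimes> b = b" using von_Neumann_regular b by blast
  obtain x where x: "x \<in> carrier R" "c \<otimes> x \<otimes> c = c" using von_Neumann_regular c by blast
  have sx: "star R x \<in> carrier R" using x star_closed by blast
  have xs: "c \<otimes> star R x \<otimes> c = c"
    using star_mult[of "c \<otimes> x" c] star_mult[of c x] x c sx by (simp add: m_assoc)
  \<comment> \<open>A symmetrised quasi-inverse of \<open>c\<close>: self-adjoint and still with
    \<open>c w c = c\<close>.\<close>
  define w where "w = x \<otimes> c \<otimes> star R x"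
  have w: "w \<in> carrier R" "star R w = w"
    using x c sx by (auto simp: w_def star_mult star_star m_assoc)
  have "c \<otimes> w \<otimes> c = (c \<otimes> x \<otimes> c) \<otimes> star R x \<otimes> c"
    using x(1) c sx by (simp add: w_def m_assoc)
  then have cw: "c \<otimes> w \<otimes> c = c" using x xs by simp
  define e where "e = b \<otimes> w \<otimes> b"
  have e: "e \<in> carrier R" "star R e = e" using b w by (auto simp: e_def star_mult m_assoc)
  have "c \<otimes> w \<otimes> b = b" using star_cancel[of b w] b w cw by (simp add: c_def)
  then have be: "b \<otimes> e = b" using b w by (simp add: e_def c_def m_assoc)
  then have eb: "e \<otimes> b = b" using star_mult[of b e] b e by simp
  have "e \<otimes> e = e \<otimes> b \<otimes> w \<otimes> b" using e b w by (subst (2) e_def) (simp add: m_assoc)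
  then have ee: "e \<otimes> e = e" using eb by (simp add: e_def)
  have ba: "b \<otimes> y \<otimes> a = a" using star_cancel[OF a y(1)] y b_def by simp
  have "e \<otimes> a = e \<otimes> (b \<otimes> y \<otimes> a)" using ba by simp
  also have "\<dots> = (e \<otimes> b) \<otimes> y \<otimes> a" using e b y a by (simp add: m_assoc)
  finally have "e \<otimes> a = a" using eb ba by simp
  moreover have "e = a \<otimes> (star R a \<otimes> w \<otimes> b)"
    using a b w star_closed[OF a] by (simp add: e_def b_def m_assoc)
  moreover have "star R a \<otimes> w \<otimes> b \<in> carrier R" using a b w star_closed by simp
  ultimately show ?thesis using e ee unfolding projection_def by blast
qed

text \<open>\<open>e\<close> and \<open>f\<close> are the left and right projections of
  \<open>a\<close>, so \<open>aR = eR\<close> and \<open>Ra = Rf\<close>, and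
  \<open>x = f y e\<close> is cut out of any quasi-inverse \<open>y\<close>. Left multiplication by
  \<open>a\<close> is thus an isomorphism from \<open>fR\<close> to \<open>eR\<close>.\<close>

lemma partial_isomorphism:
  assumes a: "a \<in> carrier R"
  shows "\<exists>e f x. projection R e \<and> projection R f \<and> a \<in> corner e f \<and> x \<in> corner f e \<and>
    a \<otimes> x = e \<and> x \<otimes> a = f \<and> (\<exists>t\<in>carrier R. e = a \<otimes> t) \<and> (\<exists>s\<in>carrier R. f = s \<otimes> a)"
proof -
  obtain e t where e: "projection R e" "e \<otimes> a = a" and t: "t \<in> carrier R" "e = a \<otimes> t"
    using left_projection[OF a] by blast
  obtain f s where f: "projection R f" "f \<otimes> star R a = star R a" and s: "s \<in> carrier R" "f = star R a \<otimes> s"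
    using left_projection[OF star_closed[OF a]] by blast
  have ec: "e \<in> carrier R" and fc: "f \<in> carrier R" using e f by (auto simp: projection_def)
  have af: "a \<otimes> f = a"
    using star_mult[of f "star R a"] f a fc star_closed[OF a] by (simp add: star_star projection_def)
  have fs: "f = star R s \<otimes> a"
    using arg_cong[OF s(2), of "star R"] f s a by (simp add: star_mult star_star star_closed projection_def)
  obtain y where y: "y \<in> carrier R" "a \<otimes> y \<otimes> a = a" using von_Neumann_regular a by blast
  define x where "x = f \<otimes> y \<otimes> e"
  have x: "x \<in> corner f e"
    using e f ec fc y by (simp add: x_def corner_def projection_def m_assoc) (simp add: m_assoc[symmetric])
  have "a \<otimes> x = (a \<otimes> f) \<otimes> y \<otimes> e" using a fc ec y by (simp add: x_def m_assoc)
  also have "\<dots> = (a \<otimes> y \<otimes> a) \<otimes> t" using a t(1) y(1) by (simp add: af t(2) m_assoc)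
  finally have ax: "a \<otimes> x = e" using y t by simp
  have "x \<otimes> a = f \<otimes> y \<otimes> (e \<otimes> a)" using a fc ec y by (simp add: x_def m_assoc)
  also have "\<dots> = star R s \<otimes> (a \<otimes> y \<otimes> a)"
    unfolding e(2) by (subst fs) (use a y(1) star_closed[OF s(1)] in \<open>simp add: m_assoc\<close>)
  finally have "x \<otimes> a = f" using y fs by simp
  moreover have "a \<in> corner e f" using a e(2) af by (simp add: corner_def)
  ultimately show ?thesis using e(1) f(1) x ax t fs star_closed[OF s(1)] by blast
qed

text \<open>Equal ideals give \<open>f e = e\<close> and \<open>e f = f\<close>; the involution
  turns the first into \<open>e f = e\<close>.\<close>

lemma projection_unique:
  assumes e: "projection R e" and f: "projection R f"
    and eq: "e <# carrier R = f <# carrier R"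
  shows "e = f"
proof -
  have ec: "e \<in> carrier R" "e \<otimes> e = e" "star R e = e" and fc: "f \<in> carrier R" "f \<otimes> f = f" "star R f = f"
    using e f by (auto simp: projection_def)
  have "e \<in> e <# carrier R" "f \<in> f <# carrier R" using ec fc by (force simp: l_coset_def)+
  then have "e \<in> f <# carrier R" "f \<in> e <# carrier R" using eq by simp_all
  then obtain s t where st: "s \<in> carrier R" "t \<in> carrier R" "e = f \<otimes> s" "f = e \<otimes> t"
    unfolding l_coset_def by blast
  have "f \<otimes> e = e" using st fc by (metis m_assoc)
  moreover have "e \<otimes> f = f" using st ec by (metis m_assoc)
  ultimately show ?thesis using star_mult[of f e] ec fc by simp
qed

text \<open>If \<open>a R b = 0\<close>, the annihilators \<open>K\<close> and \<open>K'\<close> are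
  ideals containing \<open>a\<close> and \<open>b\<close>, with \<open>K K' = 0\<close>. The
  smallest nonzero ideal lies in both, so it squares to zero, but regularity gives
  \<open>j = (j y) j\<close>.\<close>

lemma prime_if_subdirectly_irreducible:
  assumes si: "subdirectly_irreducible R"
    and a: "a \<in> carrier R" "a \<noteq> \<zero>" and b: "b \<in> carrier R" "b \<noteq> \<zero>"
  shows "\<exists>x\<in>carrier R. a \<otimes> x \<otimes> b \<noteq> \<zero>"
proof (rule ccontr)
  assume "\<not> ?thesis"
  then have ann: "a \<otimes> x \<otimes> b = \<zero>" if "x \<in> carrier R" for x using that by blast
  define K where "K = {r \<in> carrier R. \<forall>x\<in>carrier R. r \<otimes> x \<otimes> b = \<zero>}"
  define K' where "K' = {y \<in> carrier R. \<forall>k\<in>K. k \<otimes> y = \<zero>}"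
  have K: "ideal K R"
  proof (rule idealI[OF ring_axioms])
    show "subgroup K (add_monoid R)"
      by (rule add.subgroupI) (use b in \<open>auto simp: K_def l_distr l_minus\<close>)
  next
    fix k x assume k: "k \<in> K" and x: "x \<in> carrier R"
    have "k \<otimes> x \<otimes> y \<otimes> b = k \<otimes> (x \<otimes> y) \<otimes> b" if "y \<in> carrier R" for y
      using k x b that by (simp add: K_def m_assoc)
    then show "k \<otimes> x \<in> K" using k x by (simp add: K_def)
    have "x \<otimes> k \<otimes> y \<otimes> b = x \<otimes> (k \<otimes> y \<otimes> b)" if "y \<in> carrier R" for y
      using k x b that by (simp add: K_def m_assoc)
    then show "x \<otimes> k \<in> K" using k x by (simp add: K_def)
  qed
  have KK: "k \<otimes> x \<in> K" if "k \<in> K" "x \<in> carrier R" for k x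
    using that ideal.I_r_closed[OF K] by blast
  have KR: "K \<subseteq> carrier R" by (auto simp: K_def)
  have K': "ideal K' R"
  proof (rule idealI[OF ring_axioms])
    show "subgroup K' (add_monoid R)"
    proof (rule add.subgroupI)
      show "K' \<noteq> {}" using KR by (auto simp: K'_def intro!: exI[of _ "\<zero>"])
    qed (use KR in \<open>auto simp: K'_def r_distr r_minus subset_iff\<close>)
  next
    fix y x assume yx: "y \<in> K'" "x \<in> carrier R"
    have "k \<otimes> (x \<otimes> y) = \<zero>" if "k \<in> K" for k
      using KK[OF that yx(2)] yx that KR by (auto simp: K'_def m_assoc[symmetric])
    then show "x \<otimes> y \<in> K'" using yx by (auto simp: K'_def)
    have "k \<otimes> (y \<otimes> x) = \<zero>" if "k \<in> K" for k
      using yx that KR by (auto simp: K'_def m_assoc[symmetric])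
    then show "y \<otimes> x \<in> K'" using yx by (auto simp: K'_def)
  qed
  have "a \<in> K" using a ann by (simp add: K_def)
  moreover have "b \<in> K'" using b by (auto simp: K'_def K_def dest: bspec[of _ _ \<one>])
  moreover obtain J where J: "ideal J R" "J \<noteq> {\<zero>}" "\<And>I. ideal I R \<Longrightarrow> I \<noteq> {\<zero>} \<Longrightarrow> J \<subseteq> I"
    using si by (auto simp: subdirectly_irreducible_def)
  ultimately have JK: "J \<subseteq> K" "J \<subseteq> K'" using K K' a b by blast+
  have "\<zero> \<in> J" using J(1) additive_subgroup.zero_closed ideal.axioms(1) by blast
  then obtain j where j: "j \<in> J" "j \<noteq> \<zero>" using J(2) by blast
  have jR: "j \<in> carrier R" using j JK KR by blast
  obtain y where y: "y \<in> carrier R" "j \<otimes> y \<otimes> j = j" using von_Neumann_regular jR by blast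
  have "j \<otimes> y \<in> K" using KK j JK y by blast
  then show False using j JK y by (auto simp: K'_def)
qed

text \<open>Primeness gives a nonzero map from \<open>f1 R\<close> to \<open>f2 R\<close>, then a
  nonzero map to \<open>f3 R\<close> from the right projection of the first. The right projection of
  the second is \<open>e0\<close>, the first restricted to it gives \<open>e1\<close>, and the
  complement \<open>e2\<close> still contains the image of the second.\<close>

lemma frame_exists:
  assumes si: "subdirectly_irreducible R"
    and o: "orth f1 f2" "orth f1 f3" "orth f2 f3" and nz: "f1 \<noteq> \<zero>" "f2 \<noteq> \<zero>" "f3 \<noteq> \<zero>"
  shows "\<exists>e0 e1 e2 u u' z z'. orth e0 e1 \<and> orth e0 e2 \<and> orth e1 e2 \<and> u \<in> corner e1 e0 \<and> u' \<in> corner e0 e1 \<and>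
    u' \<otimes> u = e0 \<and> u \<otimes> u' = e1 \<and> z \<in> corner e2 e0 \<and> z' \<in> corner e0 e2 \<and> z' \<otimes> z = e0 \<and>
    e0 \<oplus> (e1 \<oplus> e2) = \<one> \<and> e0 \<noteq> \<zero>"
proof -
  note f12 = orthD[OF o(1)] and f13 = orthD[OF o(2)] and f23 = orthD[OF o(3)]
  obtain r where r: "r \<in> carrier R" "f2 \<otimes> r \<otimes> f1 \<noteq> \<zero>"
    using prime_if_subdirectly_irreducible[OF si _ nz(2) _ nz(1)] f12 by blast
  define a where "a = f2 \<otimes> r \<otimes> f1"
  have a: "a \<in> corner f2 f1"
    using r f12 by (simp add: a_def corner_def projection_def m_assoc) (simp add: m_assoc[symmetric])
  \<comment> \<open>\<open>f\<close> lies below \<open>f1\<close>, and on \<open>fR\<close> left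
    multiplication by \<open>a\<close> has the left inverse \<open>x\<close>.\<close>
  obtain e f x where ef: "projection R f" "a \<in> corner e f" "x \<in> corner f e" "x \<otimes> a = f"
    and fs: "\<exists>s\<in>carrier R. f = s \<otimes> a"
    using partial_isomorphism[OF cornerD(1)[OF a]] by blast
  have f: "f \<in> carrier R" "f \<otimes> f = f" "star R f = f" using ef by (auto simp: projection_def)
  have ff1: "f \<otimes> f1 = f" using fs cornerD[OF a] f12 by (auto simp: m_assoc)
  have "f \<noteq> \<zero>" using cornerD[OF ef(2)] r a_def by auto
  then obtain r' where r': "r' \<in> carrier R" "f3 \<otimes> r' \<otimes> f \<noteq> \<zero>"
    using prime_if_subdirectly_irreducible[OF si _ nz(3) f(1)] f13 by blast
  define b where "b = f3 \<otimes> r' \<otimes> f"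
  have b: "b \<in> corner f3 f"
    using r' f f13 by (simp add: b_def corner_def projection_def m_assoc) (simp add: m_assoc[symmetric])
  obtain e' f' x' where ef': "projection R e'" "projection R f'" "b \<in> corner e' f'" "x' \<in> corner f' e'" "x' \<otimes> b = f'"
    and e't: "\<exists>t\<in>carrier R. e' = b \<otimes> t" and f's: "\<exists>s\<in>carrier R. f' = s \<otimes> b"
    using partial_isomorphism[OF cornerD(1)[OF b]] by blast
  have f': "f' \<in> carrier R" "f' \<otimes> f' = f'" "star R f' = f'" using ef' by (auto simp: projection_def)
  have e': "e' \<in> carrier R" "e' \<otimes> e' = e'" "star R e' = e'" using ef' by (auto simp: projection_def)
  have f'f: "f' \<otimes> f = f'" using f's cornerD[OF b] f by (auto simp: m_assoc)
  have ff': "f \<otimes> f' = f'" using star_mult[of f' f] f f' f'f by simp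
  have f'f1: "f' \<otimes> f1 = f'" using f'f ff1 f f' f12 by (metis m_assoc)
  have f1f': "f1 \<otimes> f' = f'" using star_mult[of f' f1] f' f12 f'f1 by (simp add: projection_def)
  have f3e': "f3 \<otimes> e' = e'" using e't cornerD[OF b] f13 by (auto simp: m_assoc[symmetric])
  have e'f3: "e' \<otimes> f3 = e'" using star_mult[of f3 e'] e' f13 f3e' by (simp add: projection_def)
  have f'0: "f' \<noteq> \<zero>" using cornerD[OF ef'(3)] r' b_def by auto
  \<comment> \<open>\<open>c\<close> is \<open>a\<close> restricted to \<open>f' R\<close>; it
    becomes \<open>u\<close>, and its relative inverse \<open>x''\<close> becomes
    \<open>u'\<close>.\<close>
  define c where "c = a \<otimes> f'"
  have c: "c \<in> carrier R" using a f' by (auto simp: c_def dest: cornerD)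
  obtain e'' f'' x'' where ef'': "projection R e''" "projection R f''" "c \<in> corner e'' f''" "x'' \<in> corner f'' e''"
      "x'' \<otimes> c = f''" "c \<otimes> x'' = e''"
    and e''t: "\<exists>t\<in>carrier R. e'' = c \<otimes> t" and f''s: "\<exists>s\<in>carrier R. f'' = s \<otimes> c"
    using partial_isomorphism[OF c] by blast
  have f'': "f'' \<in> carrier R" "star R f'' = f''" using ef'' by (auto simp: projection_def)
  have e'': "e'' \<in> carrier R" "e'' \<otimes> e'' = e''" "star R e'' = e''" using ef'' by (auto simp: projection_def)
  have "f'' \<otimes> f' = f''" using f''s f' cornerD[OF a] by (auto simp: m_assoc c_def)
  then have 1: "f' \<otimes> f'' = f''" using star_mult[of f'' f'] f' f'' by simp
  \<comment> \<open>\<open>a\<close> is injective on \<open>f' R\<close>, so the right projection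
    \<open>f''\<close> of the restriction is all of \<open>f'\<close>.\<close>
  have "f' = x \<otimes> c" using ff' ef(4) cornerD[OF a] cornerD[OF ef(3)] f' by (simp add: c_def m_assoc[symmetric])
  then have "f' \<otimes> f'' = f'" using cornerD[OF ef''(3)] cornerD[OF ef(3)] f'' by (simp add: m_assoc)
  with 1 have eq: "f'' = f'" by simp
  have f2e'': "f2 \<otimes> e'' = e''"
    using e''t cornerD[OF a] f12 f' by (auto simp: m_assoc c_def) (simp add: m_assoc[symmetric])
  have e''f2: "e'' \<otimes> f2 = e''" using star_mult[of f2 e''] e'' f12 f2e'' by (simp add: projection_def)
  have cf': "f' \<in> corner f1 f1" and ce'': "e'' \<in> corner f2 f2" and ce': "e' \<in> corner f3 f3"
    using f' f1f' f'f1 e'' f2e'' e''f2 e' f3e' e'f3 by (auto simp: corner_def)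
  have zero: "f' \<otimes> e'' = \<zero>" "e'' \<otimes> f' = \<zero>" "f' \<otimes> e' = \<zero>" "e' \<otimes> f' = \<zero>" "e'' \<otimes> e' = \<zero>" "e' \<otimes> e'' = \<zero>"
    using corner_orth_mult[OF cf' ce'' o(1)] corner_orth_mult[OF ce'' cf' orth_sym[OF o(1)]]
      corner_orth_mult[OF cf' ce' o(2)] corner_orth_mult[OF ce' cf' orth_sym[OF o(2)]]
      corner_orth_mult[OF ce'' ce' o(3)] corner_orth_mult[OF ce' ce'' orth_sym[OF o(3)]] by auto
  \<comment> \<open>The remainder becomes \<open>e2\<close>. It contains \<open>e'\<close>, which
    lies below \<open>f3\<close> and so is orthogonal to \<open>f'\<close> and \<open>e''\<close>;
    hence \<open>b\<close> and \<open>x'\<close> serve as \<open>z\<close> and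
    \<open>z'\<close>.\<close>
  define g where "g = \<one> \<oplus> \<ominus> f' \<oplus> \<ominus> e''"
  have g: "projection R g" "g \<in> carrier R"
    using f' e'' zero star_one
    by (auto simp: g_def projection_def l_distr r_distr l_minus r_minus star_add star_minus r_neg a_ac)
  have og: "orth f' e''" "orth f' g" "orth e'' g"
    using ef' ef'' g zero f' e'' by (auto simp: orth_def g_def r_distr r_minus r_neg)
  have ge': "g \<otimes> e' = e'" "e' \<otimes> g = e'"
    using e' f' e'' zero by (auto simp: g_def r_distr l_distr r_minus l_minus)
  have z: "b \<in> corner g f'"
    using cornerD[OF ef'(3)] ge' g e' by (simp add: corner_def) (metis m_assoc)
  have z': "x' \<in> corner f' g"
    using cornerD[OF ef'(4)] ge' g e' by (simp add: corner_def) (metis m_assoc)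
  have "f' \<oplus> (e'' \<oplus> g) = \<one> \<oplus> ((f' \<oplus> \<ominus> f') \<oplus> (e'' \<oplus> \<ominus> e''))"
    using f'(1) e''(1) by (simp add: g_def a_ac del: r_neg)
  then have "f' \<oplus> (e'' \<oplus> g) = \<one>" using f'(1) e''(1) by (simp add: r_neg)
  then show ?thesis using og ef'' z z' ef'(5) eq f'0 by blast
qed

end

section \<open>The lattice of principal right ideals\<close>

text \<open>Removing the least element three times leaves at least one more.\<close>

lemma card4_chain:
  fixes C :: "'a set set"
  assumes "finite C" "card C \<ge> 4" and chain: "\<forall>X\<in>C. \<forall>Y\<in>C. X \<subseteq> Y \<or> Y \<subseteq> X"
  shows "\<exists>X1\<in>C. \<exists>X2\<in>C. \<exists>X3\<in>C. \<exists>X4\<in>C. X1 \<subset> X2 \<and> X2 \<subset> X3 \<and> X3 \<subset> X4"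
proof -
  have least: "\<exists>X\<in>D. (\<forall>Y\<in>D - {X}. X \<subset> Y) \<and> card (D - {X}) \<ge> n"
    if "D \<subseteq> C" "card D \<ge> Suc n" for D n
  proof -
    have fin: "finite D" using that(1) assms(1) finite_subset by blast
    have "D \<noteq> {}" using that(2) by auto
    then obtain X where X: "X \<in> D" "\<And>Y. Y \<in> D \<Longrightarrow> Y \<subseteq> X \<Longrightarrow> X = Y"
      using finite_has_minimal[OF fin] by blast
    then have "\<forall>Y\<in>D - {X}. X \<subset> Y" using chain that(1) by blast
    then show ?thesis using X(1) that(2) fin by (intro bexI[of _ X]) auto
  qed
  obtain X1 where X1: "X1 \<in> C" "\<forall>Y\<in>C - {X1}. X1 \<subset> Y" "card (C - {X1}) \<ge> 3"
    using least[of C 3] assms(2) by auto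
  obtain X2 where X2: "X2 \<in> C - {X1}" "\<forall>Y\<in>C - {X1} - {X2}. X2 \<subset> Y" "card (C - {X1} - {X2}) \<ge> 2"
    using least[of "C - {X1}" 2] X1(3) by auto
  obtain X3 where X3: "X3 \<in> C - {X1} - {X2}" "\<forall>Y\<in>C - {X1} - {X2} - {X3}. X3 \<subset> Y"
      "card (C - {X1} - {X2} - {X3}) \<ge> 1"
    using least[of "C - {X1} - {X2}" 1] X2(3) by auto
  then have "C - {X1} - {X2} - {X3} \<noteq> {}" by (intro notI) simp
  then obtain X4 where X4: "X4 \<in> C - {X1} - {X2} - {X3}" by blast
  have "X1 \<subset> X2" "X2 \<subset> X3" "X3 \<subset> X4" using X1(2) X2(1,2) X3(1,2) X4 by simp_all
  then show ?thesis using X1(1) X2(1) X3(1) X4 by (meson DiffD1)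
qed

context star_regular_ring
begin

lemma mem_principal: "y \<in> a <# carrier R \<longleftrightarrow> (\<exists>t\<in>carrier R. y = a \<otimes> t)"
  by (auto simp: l_coset_def)

lemma principal_subset_iff:
  assumes "x \<in> carrier R" "y \<in> carrier R"
  shows "x <# carrier R \<subseteq> y <# carrier R \<longleftrightarrow> (\<exists>t\<in>carrier R. x = y \<otimes> t)"
proof
  assume "x <# carrier R \<subseteq> y <# carrier R"
  moreover have "x \<in> x <# carrier R"
    unfolding mem_principal using assms by (intro bexI[of _ \<one>]) auto
  ultimately have "x \<in> y <# carrier R" by blast
  then show "\<exists>t\<in>carrier R. x = y \<otimes> t" by (simp only: mem_principal)
next
  assume "\<exists>t\<in>carrier R. x = y \<otimes> t"
  then show "x <# carrier R \<subseteq> y <# carrier R" using assms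
    by (auto simp: mem_principal m_assoc) (blast intro: m_closed)
qed

lemma projection_ortholattice_simps:
  "carrier (projection_ortholattice R) = {a <# carrier R | a. a \<in> carrier R}"
  "le (projection_ortholattice R) = (\<subseteq>)"
  by (simp_all add: projection_ortholattice_def)

lemma principal_projection:
  assumes "a \<in> carrier R"
  shows "\<exists>e. projection R e \<and> a <# carrier R = e <# carrier R"
proof -
  obtain e t where e: "projection R e" "e \<otimes> a = a" "t \<in> carrier R" "e = a \<otimes> t"
    using left_projection[OF assms] by blast
  have "e \<in> carrier R" using e by (simp add: projection_def)
  then have "a <# carrier R \<subseteq> e <# carrier R" "e <# carrier R \<subseteq> a <# carrier R"
    using principal_subset_iff[of a e] principal_subset_iff[of e a] assms e(3,4) e(2)[symmetric] by blast+
  then show ?thesis using e(1) by blast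
qed

lemma ocompl_principal:
  assumes e: "projection R e"
  shows "ocompl (projection_ortholattice R) (e <# carrier R) = (\<one> \<ominus> e) <# carrier R"
proof -
  have "(THE f. projection R f \<and> e <# carrier R = f <# carrier R) = e"
  proof (rule the_equality)
    fix f assume "projection R f \<and> e <# carrier R = f <# carrier R"
    then show "f = e" using projection_unique[OF e] by metis
  qed (simp add: e)
  then show ?thesis by (simp add: projection_ortholattice_def)
qed

lemma lattice_action_of_representation:
  assumes V: "inner_product_space F V"
    and rep: "ortholattice_representation (projection_ortholattice R) F V \<eta>"
  shows "lattice_action F V R (\<lambda>x. \<eta> (x <# carrier R))"
proof -
  let ?L = "projection_ortholattice R" and ?S = "subspace_lattice F V"
  interpret V: inner_product_space F V by (rule V)
  have \<eta>: "\<eta> \<in> carrier ?L \<rightarrow> carrier ?S" and join: "join_pres ?L ?S \<eta>" and inj: "inj_on \<eta> (carrier ?L)"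
    and orth: "\<And>a. a \<in> carrier ?L \<Longrightarrow> \<eta> (ocompl ?L a) = orthogonal F V (\<eta> a)"
    using rep by (auto simp: ortholattice_representation_def)
  interpret L: lattice ?L using join by (simp add: join_pres_def)
  interpret S: lattice ?S using join by (simp add: join_pres_def)
  note L_simps = projection_ortholattice_simps
  have S_simps: "carrier ?S = {U. submodule U F V}" "le ?S = (\<subseteq>)" by (simp_all add: subspace_lattice_def)
  have mem: "x <# carrier R \<in> carrier ?L" if "x \<in> carrier R" for x using that by (auto simp: L_simps)
  have sub: "submodule (\<eta> X) F V" if "X \<in> carrier ?L" for X using \<eta> that by (auto simp: S_simps)
  have mono: "\<eta> X \<subseteq> \<eta> Y" if "X \<in> carrier ?L" "Y \<in> carrier ?L" "X \<subseteq> Y" for X Y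
    using use_iso2[OF join_pres_isotone[OF \<eta> join] that(1,2)] that(3) by (simp add: L_simps S_simps)
  \<comment> \<open>\<open>g\<close> is the projection generating \<open>xR\<close>, and it is a
    left multiple of \<open>star R x\<close>. Hence \<open>g y = 0\<close>, and
    \<open>y = (1 - g) y\<close> lies in the orthocomplement of \<open>xR\<close>.\<close>
  have orth': "form V v w = \<zero>\<^bsub>F\<^esub>"
    if x: "x \<in> carrier R" and y: "y \<in> carrier R" and xy: "star R x \<otimes> y = \<zero>"
      and v: "v \<in> \<eta> (x <# carrier R)" and w: "w \<in> \<eta> (y <# carrier R)" for x y v w
  proof -
    obtain g t where g: "projection R g" "t \<in> carrier R" "g = x \<otimes> t" "g \<otimes> x = x"
      using left_projection[OF x] by blast
    have gc: "g \<in> carrier R" "star R g = g" using g by (auto simp: projection_def)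
    have xg: "x <# carrier R = g <# carrier R"
      using principal_subset_iff[OF x gc(1)] principal_subset_iff[OF gc(1) x] g(2,3) g(4)[symmetric] x by blast
    have "g = star R t \<otimes> star R x" using star_mult[OF x g(2)] gc g(3) by simp
    then have "g \<otimes> y = star R t \<otimes> (star R x \<otimes> y)"
      using x y g star_closed by (simp add: m_assoc)
    then have "g \<otimes> y = \<zero>" using xy g star_closed by simp
    then have "y = (\<one> \<ominus> g) \<otimes> y" using y gc by (simp add: minus_eq l_distr l_minus)
    then have "y <# carrier R \<subseteq> ocompl ?L (x <# carrier R)"
      using principal_subset_iff[OF y, of "\<one> \<ominus> g"] gc y by (auto simp: xg ocompl_principal[OF g(1)])
    moreover have "ocompl ?L (x <# carrier R) \<in> carrier ?L"
      using gc mem by (simp add: xg ocompl_principal[OF g(1)])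
    ultimately have "\<eta> (y <# carrier R) \<subseteq> orthogonal F V (\<eta> (x <# carrier R))"
      using mono orth mem x y by metis
    then show ?thesis using v w by (auto simp: orthogonal_def)
  qed
  show ?thesis
  proof (intro lattice_action.intro lattice_action_axioms.intro)
    show "inner_product_space F V" "star_ring R" by unfold_locales
  next
    fix x assume "x \<in> carrier R"
    then show "submodule (\<eta> (x <# carrier R)) F V" using sub mem by blast
  next
    fix x assume x: "x \<in> carrier R" and zero: "\<eta> (x <# carrier R) \<subseteq> {\<zero>\<^bsub>V\<^esub>}"
    \<comment> \<open>The zero ideal is orthogonal to itself, so its image is zero by anisotropy;
      injectivity of \<open>\<eta>\<close> then forces \<open>xR = 0\<close>.\<close>
    have "\<eta> (\<zero> <# carrier R) \<subseteq> {\<zero>\<^bsub>V\<^esub>}"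
    proof
      fix v assume v: "v \<in> \<eta> (\<zero> <# carrier R)"
      then have "form V v v = \<zero>\<^bsub>F\<^esub>" using orth'[of \<zero> \<zero>] star_zero by simp
      then show "v \<in> {\<zero>\<^bsub>V\<^esub>}" using V.anisotropic V.submodule_carrier[OF sub[OF mem]] v by blast
    qed
    moreover have "\<zero>\<^bsub>V\<^esub> \<in> \<eta> (y <# carrier R)" if "y \<in> carrier R" for y
      using V.submodule_zero sub mem that by blast
    ultimately have "\<eta> (x <# carrier R) = \<eta> (\<zero> <# carrier R)" using zero x by blast
    then have "x <# carrier R = \<zero> <# carrier R" using inj mem x by (metis inj_onD zero_closed)
    then show "x = \<zero>" using principal_subset_iff[of x \<zero>] x by auto
  next
    fix x y v w assume "x \<in> carrier R" "y \<in> carrier R" "star R x \<otimes> y = \<zero>"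
      "v \<in> \<eta> (x <# carrier R)" "w \<in> \<eta> (y <# carrier R)"
    then show "form V v w = \<zero>\<^bsub>F\<^esub>" by (rule orth')
  next
    fix x y r s v assume c: "x \<in> carrier R" "y \<in> carrier R" "r \<in> carrier R" "s \<in> carrier R"
      and v: "v \<in> \<eta> ((x \<otimes> r \<oplus> y \<otimes> s) <# carrier R)"
    let ?X = "x <# carrier R" and ?Y = "y <# carrier R"
    let ?J = "?X \<squnion>\<^bsub>?L\<^esub> ?Y"
    have XY: "?X \<in> carrier ?L" "?Y \<in> carrier ?L" using c mem by auto
    have J: "?J \<in> carrier ?L" by (rule L.join_closed[OF XY])
    have XJ: "?X \<subseteq> ?J" "?Y \<subseteq> ?J" using L.join_left[OF XY] L.join_right[OF XY] by (auto simp: L_simps)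
    \<comment> \<open>The join of principal right ideals is again principal; its generator divides
      \<open>x\<close> and \<open>y\<close> on the left, hence also
      \<open>x r + y s\<close>.\<close>
    obtain w where w: "w \<in> carrier R" "?J = w <# carrier R" using J by (auto simp: L_simps)
    obtain a b where ab: "a \<in> carrier R" "x = w \<otimes> a" "b \<in> carrier R" "y = w \<otimes> b"
      using XJ principal_subset_iff[OF c(1) w(1)] principal_subset_iff[OF c(2) w(1)] w(2) by auto
    have "x \<otimes> r \<oplus> y \<otimes> s = w \<otimes> (a \<otimes> r \<oplus> b \<otimes> s)" using ab w c by (simp add: r_distr m_assoc)
    then have "\<exists>t\<in>carrier R. x \<otimes> r \<oplus> y \<otimes> s = w \<otimes> t" by (rule bexI) (use ab(1,3) c in simp)
    moreover have xrys: "x \<otimes> r \<oplus> y \<otimes> s \<in> carrier R" using c by simp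
    ultimately have "(x \<otimes> r \<oplus> y \<otimes> s) <# carrier R \<subseteq> ?J"
      unfolding w(2) by (rule principal_subset_iff[OF _ w(1), THEN iffD2, rotated])
    then have "v \<in> \<eta> ?J" using mono[OF mem[OF xrys] J] v by blast
    also have "\<eta> ?J = \<eta> ?X \<squnion>\<^bsub>?S\<^esub> \<eta> ?Y" using join XY by (simp add: join_pres_def)
    finally have vJ: "v \<in> \<eta> ?X \<squnion>\<^bsub>?S\<^esub> \<eta> ?Y" .
    note sX = sub[OF XY(1)] and sY = sub[OF XY(2)]
    \<comment> \<open>The sum of both subspaces is an upper bound, so it contains their join in the
      subspace lattice.\<close>
    let ?W = "{v1 \<oplus>\<^bsub>V\<^esub> v2 | v1 v2. v1 \<in> \<eta> ?X \<and> v2 \<in> \<eta> ?Y}"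
    note cX = V.submodule_carrier[OF sX] and cY = V.submodule_carrier[OF sY]
    have W: "submodule ?W F V"
    proof (rule V.submoduleI)
      show "?W \<subseteq> carrier V" using cX cY by auto
      show "\<zero>\<^bsub>V\<^esub> \<in> ?W" using V.submodule_zero[OF sX] V.submodule_zero[OF sY] V.V.l_zero by force
    next
      fix p q assume "p \<in> ?W" "q \<in> ?W"
      then obtain p1 p2 q1 q2 where pq: "p = p1 \<oplus>\<^bsub>V\<^esub> p2" "q = q1 \<oplus>\<^bsub>V\<^esub> q2"
        "p1 \<in> \<eta> ?X" "p2 \<in> \<eta> ?Y" "q1 \<in> \<eta> ?X" "q2 \<in> \<eta> ?Y" by auto
      then have "p \<oplus>\<^bsub>V\<^esub> q = (p1 \<oplus>\<^bsub>V\<^esub> q1) \<oplus>\<^bsub>V\<^esub> (p2 \<oplus>\<^bsub>V\<^esub> q2)"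
        using cX cY by (simp add: V.V.a_ac)
      then show "p \<oplus>\<^bsub>V\<^esub> q \<in> ?W" using pq V.submodule_add[OF sX] V.submodule_add[OF sY] by blast
    next
      fix k p assume k: "k \<in> carrier F" and "p \<in> ?W"
      then obtain p1 p2 where p: "p = p1 \<oplus>\<^bsub>V\<^esub> p2" "p1 \<in> \<eta> ?X" "p2 \<in> \<eta> ?Y" by auto
      then have "k \<odot>\<^bsub>V\<^esub> p = k \<odot>\<^bsub>V\<^esub> p1 \<oplus>\<^bsub>V\<^esub> k \<odot>\<^bsub>V\<^esub> p2" using k cX cY V.smult_r_distr by simp
      then show "k \<odot>\<^bsub>V\<^esub> p \<in> ?W"
        using p k V.submodule_smult[OF sX] V.submodule_smult[OF sY] by blast
    qed
    have "\<eta> ?X \<subseteq> ?W"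
    proof
      fix p assume "p \<in> \<eta> ?X"
      then show "p \<in> ?W" using V.submodule_zero[OF sY] cX V.V.r_zero by force
    qed
    moreover have "\<eta> ?Y \<subseteq> ?W"
    proof
      fix p assume "p \<in> \<eta> ?Y"
      then show "p \<in> ?W" using V.submodule_zero[OF sX] cY V.V.l_zero by force
    qed
    ultimately have "\<eta> ?X \<squnion>\<^bsub>?S\<^esub> \<eta> ?Y \<subseteq> ?W"
      using S.join_le[of "\<eta> ?X" ?W "\<eta> ?Y"] sX sY W by (simp add: S_simps)
    then show "\<exists>v1\<in>\<eta> ?X. \<exists>v2\<in>\<eta> ?Y. v = v1 \<oplus>\<^bsub>V\<^esub> v2" using vJ by blast
  qed
qed

text \<open>For projections \<open>g \<le> h \<le> k \<le> l\<close> the product of the differences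
  expands to \<open>h - h - g + g\<close>. The case \<open>h = k\<close> covers neighbouring gaps of
  a chain.\<close>

lemma projection_diff_orth:
  assumes p: "projection R g" "projection R h" "projection R k" "projection R l"
    and le: "h \<otimes> g = g" "k \<otimes> h = h" "l \<otimes> k = k"
  shows "orth (h \<oplus> \<ominus> g) (l \<oplus> \<ominus> k)"
proof -
  have c: "g \<in> carrier R" "h \<in> carrier R" "k \<in> carrier R" "l \<in> carrier R"
    and s: "star R g = g" "star R h = h" "star R k = k" "star R l = l"
    and i: "g \<otimes> g = g" "h \<otimes> h = h" "k \<otimes> k = k" "l \<otimes> l = l"
    using p by (auto simp: projection_def)
  have le': "g \<otimes> h = g" "h \<otimes> k = h" "k \<otimes> l = k"
    using star_mult[of h g] star_mult[of k h] star_mult[of l k] le c s by auto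
  have gk: "g \<otimes> k = g" using le' c by (metis m_assoc)
  have hl: "h \<otimes> l = h" using le' c by (metis m_assoc)
  have gl: "g \<otimes> l = g" using le' hl c by (metis m_assoc)
  have idem: "projection R (q \<oplus> \<ominus> p)"
    if q: "q \<in> carrier R" "star R q = q" "q \<otimes> q = q" and p: "p \<in> carrier R" "star R p = p" "p \<otimes> p = p"
      and qp: "q \<otimes> p = p" "p \<otimes> q = p" for p q
  proof -
    have "(q \<oplus> \<ominus> p) \<otimes> (q \<oplus> \<ominus> p) = (q \<oplus> \<ominus> p) \<oplus> (p \<oplus> \<ominus> p)"
      using p q qp by (simp add: l_distr r_distr l_minus r_minus minus_add a_ac)
    then show ?thesis using p q by (simp add: projection_def star_add star_minus r_neg)
  qed
  have "(h \<oplus> \<ominus> g) \<otimes> (l \<oplus> \<ominus> k) = (h \<oplus> \<ominus> h) \<oplus> (g \<oplus> \<ominus> g)"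
    using c hl gl le' gk by (simp add: l_distr r_distr l_minus r_minus minus_add a_ac)
  then show ?thesis using idem c s i le le' by (simp add: orth_def r_neg)
qed

lemma three_orth_if_height:
  assumes "lattice_height (projection_ortholattice R) \<ge> 3"
  shows "\<exists>f1 f2 f3. orth f1 f2 \<and> orth f1 f3 \<and> orth f2 f3 \<and> f1 \<noteq> \<zero> \<and> f2 \<noteq> \<zero> \<and> f3 \<noteq> \<zero>"
proof -
  let ?L = "projection_ortholattice R"
  let ?P = "\<lambda>k C. C \<subseteq> carrier ?L \<and> finite C \<and> card C = k + 1 \<and> (\<forall>x\<in>C. \<forall>y\<in>C. x \<sqsubseteq>\<^bsub>?L\<^esub> y \<or> y \<sqsubseteq>\<^bsub>?L\<^esub> x)"
  \<comment> \<open>Some chain attains length at least \<open>3\<close>; otherwise all lengths, and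
    so their supremum, would be at most \<open>2\<close>.\<close>
  have "\<exists>k C. k \<ge> 3 \<and> ?P k C"
  proof (rule ccontr)
    assume *: "\<not> (\<exists>k C. k \<ge> 3 \<and> ?P k C)"
    have "lattice_height ?L \<le> enat 2"
      unfolding lattice_height_def
    proof (rule Sup_least)
      fix x assume "x \<in> {enat k | k. \<exists>C \<subseteq> carrier ?L. finite C \<and> card C = k + 1 \<and>
                        (\<forall>x\<in>C. \<forall>y\<in>C. x \<sqsubseteq>\<^bsub>?L\<^esub> y \<or> y \<sqsubseteq>\<^bsub>?L\<^esub> x)}"
      then obtain k C where k: "x = enat k" "?P k C" by blast
      then have "\<not> 3 \<le> k" using * by blast
      then show "x \<le> enat 2" using k(1) by simp
    qed
    then have "(3::enat) \<le> enat 2" using assms order_trans by blast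
    then show False by (simp add: numeral_eq_enat)
  qed
  then obtain k C where k: "k \<ge> 3" and C: "C \<subseteq> carrier ?L" "finite C" "card C = k + 1"
    and chain: "\<forall>X\<in>C. \<forall>Y\<in>C. X \<subseteq> Y \<or> Y \<subseteq> X"
    by (auto simp: projection_ortholattice_simps)
  \<comment> \<open>Four members leave three proper gaps, each of which yields a nonzero
    projection.\<close>
  obtain X1 X2 X3 X4 where X: "X1 \<in> C" "X2 \<in> C" "X3 \<in> C" "X4 \<in> C" "X1 \<subset> X2" "X2 \<subset> X3" "X3 \<subset> X4"
    using card4_chain[OF C(2) _ chain] k C(3) by auto
  have proj: "\<exists>g. projection R g \<and> X = g <# carrier R" if "X \<in> C" for X
    using that C(1) principal_projection by (auto simp: projection_ortholattice_simps)
  obtain g1 g2 g3 g4 where g: "projection R g1" "projection R g2" "projection R g3" "projection R g4"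
    and Xg: "X1 = g1 <# carrier R" "X2 = g2 <# carrier R" "X3 = g3 <# carrier R" "X4 = g4 <# carrier R"
    using proj[OF X(1)] proj[OF X(2)] proj[OF X(3)] proj[OF X(4)] by blast
  have le: "h \<otimes> g = g"
    if "projection R g" "projection R h" and less: "g <# carrier R \<subset> h <# carrier R" for g h
  proof -
    have c: "g \<in> carrier R" "h \<in> carrier R" "h \<otimes> h = h" using that by (auto simp: projection_def)
    then obtain t where "t \<in> carrier R" "g = h \<otimes> t"
      using less principal_subset_iff[OF c(1,2)] by blast
    then show ?thesis using c by (metis m_assoc)
  qed
  have ne: "h \<oplus> \<ominus> g \<noteq> \<zero>" if "projection R g" "projection R h" "g <# carrier R \<subset> h <# carrier R" for g h
    using that diff_eq_zero[of h g] projection_carrier by blast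
  have l: "g2 \<otimes> g1 = g1" "g3 \<otimes> g2 = g2" "g4 \<otimes> g3 = g3" and i: "g2 \<otimes> g2 = g2" "g3 \<otimes> g3 = g3"
    using le g X(5-7)[unfolded Xg] by (auto simp: projection_def)
  have "g2 \<oplus> \<ominus> g1 \<noteq> \<zero>" "g3 \<oplus> \<ominus> g2 \<noteq> \<zero>" "g4 \<oplus> \<ominus> g3 \<noteq> \<zero>"
    by (rule ne; fact g X(5-7)[unfolded Xg])+
  then show ?thesis
    using projection_diff_orth[OF g(1,2,2,3) l(1) i(1) l(2)] projection_diff_orth[OF g(1,2,3,4) l]
      projection_diff_orth[OF g(2,3,3,4) l(2) i(2) l(3)] by blast
qed

end

theorem corollary6p3:
  fixes R :: "('r, 'k) star_ring_scheme"
    and F :: "('f, 'm) star_ring_scheme"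
    and V :: "('f, 'v, 'n) inner_product_space_scheme"
  assumes "star_regular_ring R"
    and "subdirectly_irreducible R"
    and "lattice_height (projection_ortholattice R) \<ge> 3"
    and "inner_product_space F V"
    and "\<exists>\<eta>. ortholattice_representation (projection_ortholattice R) F V \<eta>"
  shows "\<exists>(\<U> :: ('r, 'f, 'v) ultra_index filter) U \<rho>.
    ultrafilter \<U> \<and>
    closed_subspace (ultrapower_scalars \<U> F) (ultrapower_vectors \<U> F V) U \<and>
    star_ring_representation R (ultrapower_scalars \<U> F)
      ((ultrapower_vectors \<U> F V)\<lparr>carrier := U\<rparr>) \<rho>"
proof -
  interpret R: star_regular_ring R by (rule assms(1))
  obtain \<eta> where \<eta>: "ortholattice_representation (projection_ortholattice R) F V \<eta>" using assms(5) by blast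
  interpret lattice_action F V R "\<lambda>x. \<eta> (x <#\<^bsub>R\<^esub> carrier R)"
    by (rule R.lattice_action_of_representation[OF assms(4) \<eta>])
  obtain f1 f2 f3 where "R.orth f1 f2" "R.orth f1 f3" "R.orth f2 f3"
      "f1 \<noteq> \<zero>\<^bsub>R\<^esub>" "f2 \<noteq> \<zero>\<^bsub>R\<^esub>" "f3 \<noteq> \<zero>\<^bsub>R\<^esub>"
    using R.three_orth_if_height[OF assms(3)] by blast
  from R.frame_exists[OF assms(2) this]
  obtain e0 e1 e2 u u' z z' where frame: "R.orth e0 e1" "R.orth e0 e2" "R.orth e1 e2"
      "u \<in> R.corner e1 e0" "u' \<in> R.corner e0 e1" "u' \<otimes>\<^bsub>R\<^esub> u = e0" "u \<otimes>\<^bsub>R\<^esub> u' = e1"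
      "z \<in> R.corner e2 e0" "z' \<in> R.corner e0 e2" "z' \<otimes>\<^bsub>R\<^esub> z = e0"
      "e0 \<oplus>\<^bsub>R\<^esub> (e1 \<oplus>\<^bsub>R\<^esub> e2) = \<one>\<^bsub>R\<^esub>" and e0: "e0 \<noteq> \<zero>\<^bsub>R\<^esub>"
    by blast
  interpret frame_action F V R "\<lambda>x. \<eta> (x <#\<^bsub>R\<^esub> carrier R)" e0 e1 e2 u u' z z'
    by unfold_locales (fact frame)+
  \<comment> \<open>Primeness for \<open>r\<close> and the nonzero \<open>e0\<close> gives the
    remaining hypothesis.\<close>
  show ?thesis
    by (rule ultrapower_star_representation_if_prime)
      (use R.prime_if_subdirectly_irreducible[OF assms(2)] R.orthD[OF frame(1)] e0 in blast)
qed

end
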